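(* Let $k\ge1$, $r>0$ and let $(W,f),(V,g)\in\mathcal{WS}_r$ be two graphon-signals. Then $\nu_{(W,f)}^{k\text{-WL}}=\nu_{(V,g)}^{k\text{-WL}}$ (i.e. the graphon-signals are $k$-WL indistinguishable) if and only if $$t((F,\boldsymbol d),(W,f))=t((F,\boldsymbol d),(V,g))$$ for all multigraphs $F$ of treewidth $\le k-1$ and all $\boldsymbol d\in\mathbb N_0^{v(F)}$.
   Context: $\lambda^m$ is $m$-dimensional Lebesgue measure, $\lambda=\lambda^1$. A graphon is a symmetric measurable function $W:[0,1]^2\to[0,1]$. $\mathcal{WS}_r$ is the set of graphon-signals $(W,f)$ with $W$ a graphon and $f\in L^\infty[0,1]$, $\|f\|_\infty\le r$. In a multigraph the edges form a finite multiset of two-element subsets of the (finite) vertex set; its treewidth is that of the underlying simple graph. For a multigraph $F$ with $V(F)=[m]$ and $\boldsymbol d\in\mathbb N_0^m$, $$t((F,\boldsymbol d),(W,f))=\int_{[0,1]^m}\Big(\prod_{i\in V(F)}f(x_i)^{d_i}\Big)\Big(\prod_{\{i,j\}\in E(F)}W(x_i,x_j)\Big)d\lambda^m(\boldsymbol x),$$ factors being repeated according to edge multiplicity. $k$-WL color space: let $P_0^k=[0,1]^{\binom{[k]}{2}}\times[-r,r]^k$ with its standard topology, and inductively for $s\in\mathbb N_0$ let $\mathbb M_s^k=\prod_{i\le s}P_i^k$ (product over $0\le i\le s$) and $P_{s+1}^k=\mathcal P(\mathbb M_s^k)^k$, where $\mathcal P(\cdot)$ denotes the Borel probability measures with the weak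 topology. Let $\mathbb M^k=\prod_{s\in\mathbb N_0}P_s^k$ with the product topology. All spaces carry their Borel $\sigma$-algebras. $k$-WL test for $(W,f)\in\mathcal{WS}_r$: define $\mathfrak C^{(0)}:[0,1]^k\to\mathbb M_0^k$ by $\mathfrak C^{(0)}(\boldsymbol x)=\big((W(x_i,x_j))_{\{i,j\}\in\binom{[k]}{2}},(f(x_j))_{j\in[k]}\big)$ and, for $s\ge1$, $\mathfrak C^{(s)}:[0,1]^k\to\mathbb M_s^k$ by $$\mathfrak C^{(s)}(\boldsymbol x)=\Big(\mathfrak C^{(s-1)}(\boldsymbol x),\big((\mathfrak C^{(s-1)}\circ\boldsymbol x[\cdot/j])_*\lambda\big)_{j\in[k]}\Big),$$ where $\boldsymbol x[\cdot/j]:[0,1]\to[0,1]^k$, $y\mapsto(x_1,\dots,x_{j-1},y,x_{j+1},\dots,x_k)$, and $(\cdot)_*$ is the pushforward of measures. Let $\mathfrak C^{k\text{-WL}}_{(W,f)}:[0,1]^k\to\mathbb M^k$ be the map whose $s$-th coordinate is the $s$-th coordinate of $\mathfrak C^{(s)}$ for every $s\in\mathbb N_0$. The $k$-WL distribution is $\nu^{k\text{-WL}}_{(W,f)}=(\mathfrak C^{k\text{-WL}}_{(W,f)})_*\lambda^k\in\mathcal P(\mathbb M^k)$. *)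

theory Defs
  imports "HOL-Probability.Probability"
begin

section \<open>Borel probability measures and the weak topology\<close>

definition borel_of :: "'a topology \<Rightarrow> 'a measure" where
  "borel_of X = sigma (topspace X) {U. openin X U}"

definition borel_probs :: "'a topology \<Rightarrow> 'a measure set" where
  "borel_probs X = {\<mu>. prob_space \<mu> \<and> sets \<mu> = sets (borel_of X)}"

definition weak_topology :: "'a topology \<Rightarrow> 'a measure topology" where
  "weak_topology X = topology_generated_by
     {{\<mu> \<in> borel_probs X. (\<integral>x. f x \<partial>\<mu>) \<in> U} | f U.
        continuous_map X euclideanreal f \<and> bounded (f ` topspace X) \<and> open U}"


section \<open>The color space\<close>

text \<open>
  The colors of level \<open>s + 1\<close> are tuples of measures on a space built from the colors of level
  \<open>\<le> s\<close>, so the type of a color would have to depend on its level.  To collect all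
  levels in one type, the points of each space are renamed by an injection into the type
  \<open>nat \<Rightarrow> real\<close>, and the topology is carried along, so that \<open>recode X\<close> is a homeomorphic copy
  of \<open>X\<close>.  The lemmas \<open>homeomorphic_wl_P_0\<close> and \<open>homeomorphic_wl_P_Suc\<close> below show that
  the injections needed exist.  The choice of injection is immaterial, and nothing relates it
  to the usual topology of \<open>nat \<Rightarrow> real\<close>.
\<close>

definition code :: "'a topology \<Rightarrow> 'a \<Rightarrow> (nat \<Rightarrow> real)" where
  "code X = (SOME c. inj_on c (topspace X))"

definition recode :: "'a topology \<Rightarrow> (nat \<Rightarrow> real) topology" where
  "recode X = pullback_topology (code X ` topspace X) (inv_into (topspace X) (code X)) X"

definition pairs :: "nat \<Rightarrow> nat set set" where
  "pairs k = {e. e \<subseteq> {..<k} \<and> card e = 2}"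

definition init_space :: "nat \<Rightarrow> real \<Rightarrow> ((nat set \<Rightarrow> real) \<times> (nat \<Rightarrow> real)) topology" where
  "init_space k r = prod_topology
     (product_topology (\<lambda>_. top_of_set {0..1}) (pairs k))
     (product_topology (\<lambda>_. top_of_set {-r..r}) {..<k})"

definition refine_space :: "nat \<Rightarrow> (nat \<Rightarrow> nat \<Rightarrow> real) topology
    \<Rightarrow> (nat \<Rightarrow> (nat \<Rightarrow> nat \<Rightarrow> real) measure) topology" where
  "refine_space k X = product_topology (\<lambda>_. weak_topology X) {..<k}"

text \<open>
  \<open>wl_P k r s\<close> is (a copy of) \<open>P\<^sub>s\<close>.  In the second equation the factors
  with \<open>i > s\<close> are not part of the product; the conditional only serves termination.
\<close>

fun wl_P :: "nat \<Rightarrow> real \<Rightarrow> nat \<Rightarrow> (nat \<Rightarrow> real) topology" where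
  "wl_P k r 0 = recode (init_space k r)"
| "wl_P k r (Suc s) = recode (refine_space k
     (product_topology (\<lambda>i. if i \<le> s then wl_P k r i else discrete_topology {}) {..s}))"

definition wl_M :: "nat \<Rightarrow> real \<Rightarrow> nat \<Rightarrow> (nat \<Rightarrow> nat \<Rightarrow> real) topology" where
  "wl_M k r s = product_topology (wl_P k r) {..s}"

definition wl_M_all :: "nat \<Rightarrow> real \<Rightarrow> (nat \<Rightarrow> nat \<Rightarrow> real) topology" where
  "wl_M_all k r = product_topology (wl_P k r) UNIV"

lemma product_topology_agree:
  assumes "\<And>i. i \<in> I \<Longrightarrow> X i = Y i"
  shows "product_topology X I = product_topology Y I"
proof -
  have *: "(\<lambda>F. \<exists>i U. F = {f. f i \<in> U} \<and> i \<in> I \<and> openin (X i) U) =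
      (\<lambda>F. \<exists>i U. F = {f. f i \<in> U} \<and> i \<in> I \<and> openin (Y i) U)"
    using assms by (intro ext) metis
  have **: "(\<Pi>\<^sub>E i\<in>I. topspace (X i)) = (\<Pi>\<^sub>E i\<in>I. topspace (Y i))"
    using assms by (intro PiE_cong) auto
  show ?thesis unfolding product_topology * ** ..
qed

lemma wl_P_Suc: "wl_P k r (Suc s) = recode (refine_space k (wl_M k r s))"
proof -
  have "product_topology (\<lambda>i. if i \<le> s then wl_P k r i else discrete_topology {}) {..s}
      = product_topology (wl_P k r) {..s}"
    by (intro product_topology_agree) auto
  then show ?thesis by (simp add: wl_M_def)
qed


section \<open>Graphon-signals and the Weisfeiler--Leman distribution\<close>

definition unit_lebesgue :: "real measure" where
  "unit_lebesgue = restrict_space lborel {0..1}"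

definition graphon :: "(real \<Rightarrow> real \<Rightarrow> real) \<Rightarrow> bool" where
  "graphon W \<longleftrightarrow>
     (\<lambda>(x, y). W x y) \<in> borel_measurable (unit_lebesgue \<Otimes>\<^sub>M unit_lebesgue) \<and>
     (\<forall>x\<in>{0..1}. \<forall>y\<in>{0..1}. W x y = W y x \<and> W x y \<in> {0..1})"

definition graphon_signal :: "real \<Rightarrow> (real \<Rightarrow> real \<Rightarrow> real) \<Rightarrow> (real \<Rightarrow> real) \<Rightarrow> bool" where
  "graphon_signal r W f \<longleftrightarrow> graphon W \<and> f \<in> borel_measurable unit_lebesgue \<and>
     (AE x in unit_lebesgue. \<bar>f x\<bar> \<le> r)"

text \<open>\<open>W(x\<^sub>i, x\<^sub>j)\<close> for a two-element set \<open>e = {i, j}\<close>; the order is irrelevant as \<open>W\<close> is symmetric.\<close>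

definition edge_value :: "(real \<Rightarrow> real \<Rightarrow> real) \<Rightarrow> (nat \<Rightarrow> real) \<Rightarrow> nat set \<Rightarrow> real" where
  "edge_value W x e = W (x (Min e)) (x (Max e))"

text \<open>
  The bound on the signal holds almost everywhere only, whereas colors need signal values in
  \<open>[-r, r]\<close> everywhere.  Hence the initial color uses the representative of \<open>f\<close> that is clipped
  to \<open>[-r, r]\<close>, which is \<open>f\<close> itself if the bound holds everywhere.
\<close>

definition clip :: "real \<Rightarrow> real \<Rightarrow> real" where
  "clip r t = max (-r) (min r t)"

primrec wl_color :: "nat \<Rightarrow> real \<Rightarrow> (real \<Rightarrow> real \<Rightarrow> real) \<Rightarrow> (real \<Rightarrow> real) \<Rightarrow> nat
    \<Rightarrow> (nat \<Rightarrow> real) \<Rightarrow> (nat \<Rightarrow> nat \<Rightarrow> real)" where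
  "wl_color k r W f 0 x = (\<lambda>i\<in>{..0}. code (init_space k r)
     (\<lambda>e\<in>pairs k. edge_value W x e, \<lambda>j\<in>{..<k}. clip r (f (x j))))"
| "wl_color k r W f (Suc s) x = (wl_color k r W f s x)
     (Suc s := code (refine_space k (wl_M k r s))
        (\<lambda>j\<in>{..<k}. distr unit_lebesgue (borel_of (wl_M k r s))
           (\<lambda>y. wl_color k r W f s (x(j := y)))))"

definition wl_color_all :: "nat \<Rightarrow> real \<Rightarrow> (real \<Rightarrow> real \<Rightarrow> real) \<Rightarrow> (real \<Rightarrow> real)
    \<Rightarrow> (nat \<Rightarrow> real) \<Rightarrow> (nat \<Rightarrow> nat \<Rightarrow> real)" where
  "wl_color_all k r W f x = (\<lambda>s. wl_color k r W f s x s)"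

definition wl_distribution :: "nat \<Rightarrow> real \<Rightarrow> (real \<Rightarrow> real \<Rightarrow> real) \<Rightarrow> (real \<Rightarrow> real)
    \<Rightarrow> (nat \<Rightarrow> nat \<Rightarrow> real) measure" where
  "wl_distribution k r W f =
     distr (\<Pi>\<^sub>M i\<in>{..<k}. unit_lebesgue) (borel_of (wl_M_all k r)) (wl_color_all k r W f)"


section \<open>Multigraphs, treewidth and homomorphism densities\<close>

definition multigraph :: "nat \<Rightarrow> nat set multiset \<Rightarrow> bool" where
  "multigraph m E \<longleftrightarrow> set_mset E \<subseteq> pairs m"

definition connected_in :: "'a set set \<Rightarrow> 'a set \<Rightarrow> bool" where
  "connected_in N S \<longleftrightarrow>
     (\<forall>a\<in>S. \<forall>b\<in>S. (a, b) \<in> {(u, v). u \<in> S \<and> v \<in> S \<and> {u, v} \<in> N}\<^sup>*)"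

definition is_cycle :: "'a set set \<Rightarrow> 'a list \<Rightarrow> bool" where
  "is_cycle N c \<longleftrightarrow> length c \<ge> 3 \<and> distinct c \<and>
     (\<forall>i<length c. {c ! i, c ! (Suc i mod length c)} \<in> N)"

definition is_tree :: "'a set \<Rightarrow> 'a set set \<Rightarrow> bool" where
  "is_tree T N \<longleftrightarrow> finite T \<and> T \<noteq> {} \<and> (\<forall>e\<in>N. e \<subseteq> T \<and> card e = 2) \<and>
     connected_in N T \<and> (\<nexists>c. is_cycle N c)"

definition tree_decomposition ::
    "'v set \<Rightarrow> 'v set set \<Rightarrow> 't set \<Rightarrow> 't set set \<Rightarrow> ('t \<Rightarrow> 'v set) \<Rightarrow> bool" where
  "tree_decomposition Vs Es T N \<beta> \<longleftrightarrow> is_tree T N \<and>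
     (\<Union>t\<in>T. \<beta> t) = Vs \<and>
     (\<forall>e\<in>Es. \<exists>t\<in>T. e \<subseteq> \<beta> t) \<and>
     (\<forall>v\<in>Vs. connected_in N {t \<in> T. v \<in> \<beta> t})"

text \<open>Bags may have up to \<open>w + 1\<close> vertices; the graph without vertices gets treewidth \<open>0\<close>.\<close>

definition treewidth :: "'v set \<Rightarrow> 'v set set \<Rightarrow> nat" where
  "treewidth Vs Es = (LEAST w. \<exists>(T :: nat set) N \<beta>.
     tree_decomposition Vs Es T N \<beta> \<and> (\<forall>t\<in>T. card (\<beta> t) \<le> w + 1))"

definition hom_density :: "nat \<Rightarrow> nat set multiset \<Rightarrow> (nat \<Rightarrow> nat)
    \<Rightarrow> (real \<Rightarrow> real \<Rightarrow> real) \<Rightarrow> (real \<Rightarrow> real) \<Rightarrow> real" where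
  "hom_density m E d W f =
     (\<integral>x. (\<Prod>i<m. f (x i) ^ d i) * (\<Prod>e\<in>#E. edge_value W x e) \<partial>(\<Pi>\<^sub>M i\<in>{..<m}. unit_lebesgue))"


section \<open>The renamings are homeomorphisms\<close>

text \<open>
  All spaces involved carry the initial topology of a countable point-separating family of
  continuous real functions, and this property passes to countable products and to
  \<open>weak_topology\<close>.  It yields the injections presupposed by \<open>code\<close>; see
  \<open>homeomorphic_wl_P_0\<close> and \<open>homeomorphic_wl_P_Suc\<close>.
\<close>

definition nbd :: "('a \<Rightarrow> real) set \<Rightarrow> 'a topology \<Rightarrow> 'a \<Rightarrow> 'a set \<Rightarrow> bool" where
  "nbd F X x S \<longleftrightarrow> (\<exists>L \<delta>. set L \<subseteq> F \<and> \<delta> > 0 \<and>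
     (\<forall>y\<in>topspace X. (\<Sum>\<phi>\<leftarrow>L. \<bar>\<phi> y - \<phi> x\<bar>) < \<delta> \<longrightarrow> y \<in> S))"

definition gen_fam :: "('a \<Rightarrow> real) set \<Rightarrow> 'a topology \<Rightarrow> bool" where
  "gen_fam F X \<longleftrightarrow> countable F \<and> (\<forall>\<phi>\<in>F. continuous_map X euclideanreal \<phi>) \<and>
     (\<forall>x\<in>topspace X. \<forall>y\<in>topspace X. (\<forall>\<phi>\<in>F. \<phi> x = \<phi> y) \<longrightarrow> x = y) \<and>
     (\<forall>U x. openin X U \<longrightarrow> x \<in> U \<longrightarrow> nbd F X x U)"

definition embeddable :: "'a topology \<Rightarrow> bool" where
  "embeddable X \<longleftrightarrow> (\<exists>F. gen_fam F X)"

lemma gen_fam_D: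
  assumes "gen_fam F X"
  shows "countable F" "\<phi> \<in> F \<Longrightarrow> continuous_map X euclideanreal \<phi>"
    "x \<in> topspace X \<Longrightarrow> y \<in> topspace X \<Longrightarrow> (\<And>\<phi>. \<phi> \<in> F \<Longrightarrow> \<phi> x = \<phi> y) \<Longrightarrow> x = y"
    "openin X U \<Longrightarrow> x \<in> U \<Longrightarrow> nbd F X x U"
  using assms unfolding gen_fam_def by blast+

lemma nbd_top: "nbd F X x (topspace X)"
  unfolding nbd_def by (intro exI[of _ "[]"] exI[of _ 1]) auto

lemma nbd_mono: "nbd F X x S \<Longrightarrow> S \<subseteq> T \<Longrightarrow> nbd F X x T"
  unfolding nbd_def by blast

lemma sum_list_abs_nonneg: "(\<Sum>\<phi>\<leftarrow>L. \<bar>h \<phi>\<bar>) \<ge> (0::real)"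
  by (induction L) auto

lemma nbd_Int:
  assumes "nbd F X x S" "nbd F X x T" shows "nbd F X x (S \<inter> T)"
proof -
  obtain L \<delta> where 1: "set L \<subseteq> F" "\<delta> > 0"
      "\<And>y. y\<in>topspace X \<Longrightarrow> (\<Sum>\<phi>\<leftarrow>L. \<bar>\<phi> y - \<phi> x\<bar>) < \<delta> \<Longrightarrow> y \<in> S"
    using assms(1) unfolding nbd_def by blast
  obtain M \<eta> where 2: "set M \<subseteq> F" "\<eta> > 0"
      "\<And>y. y\<in>topspace X \<Longrightarrow> (\<Sum>\<phi>\<leftarrow>M. \<bar>\<phi> y - \<phi> x\<bar>) < \<eta> \<Longrightarrow> y \<in> T"
    using assms(2) unfolding nbd_def by blast
  have "y \<in> S \<inter> T" if y: "y \<in> topspace X" "(\<Sum>\<phi>\<leftarrow>L @ M. \<bar>\<phi> y - \<phi> x\<bar>) < min \<delta> \<eta>" for y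
  proof -
    have "(\<Sum>\<phi>\<leftarrow>L. \<bar>\<phi> y - \<phi> x\<bar>) \<ge> 0" "(\<Sum>\<phi>\<leftarrow>M. \<bar>\<phi> y - \<phi> x\<bar>) \<ge> 0"
      by (rule sum_list_abs_nonneg)+
    then show ?thesis using y 1(3)[of y] 2(3)[of y] by auto
  qed
  then show ?thesis unfolding nbd_def
    using 1 2 by (intro exI[of _ "L @ M"] exI[of _ "min \<delta> \<eta>"]) auto
qed

lemma nbd_finite:
  "finite J \<Longrightarrow> (\<And>i. i \<in> J \<Longrightarrow> nbd F X x (S i)) \<Longrightarrow> nbd F X x (topspace X \<inter> (\<Inter>i\<in>J. S i))"
proof (induction J rule: finite_induct)
  case empty then show ?case by (simp add: nbd_top)
next
  case (insert j J)
  then have "nbd F X x (S j)" "nbd F X x (topspace X \<inter> (\<Inter>i\<in>J. S i))" by auto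
  then have "nbd F X x (S j \<inter> (topspace X \<inter> (\<Inter>i\<in>J. S i)))" by (rule nbd_Int)
  then show ?case by (rule nbd_mono) auto
qed

lemma nbd_map:
  assumes "nbd F X (h x) S" "\<And>\<phi>. \<phi> \<in> F \<Longrightarrow> \<phi> \<circ> h \<in> G" "h ` topspace Y \<subseteq> topspace X"
  shows "nbd G Y x (topspace Y \<inter> h -` S)"
proof -
  obtain L \<delta> where 1: "set L \<subseteq> F" "\<delta> > 0"
      "\<And>y. y\<in>topspace X \<Longrightarrow> (\<Sum>\<phi>\<leftarrow>L. \<bar>\<phi> y - \<phi> (h x)\<bar>) < \<delta> \<Longrightarrow> y \<in> S"
    using assms(1) unfolding nbd_def by blast
  have "y \<in> topspace Y \<inter> h -` S" if "y \<in> topspace Y"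
      "(\<Sum>\<psi>\<leftarrow>map (\<lambda>\<phi>. \<phi> \<circ> h) L. \<bar>\<psi> y - \<psi> x\<bar>) < \<delta>" for y
    using that 1(3)[of "h y"] assms(3) by (auto simp: o_def)
  moreover have "set (map (\<lambda>\<phi>. \<phi> \<circ> h) L) \<subseteq> G" using 1(1) assms(2) by auto
  ultimately show ?thesis unfolding nbd_def using 1(2) by blast
qed

lemma embeddable_real: "embeddable (top_of_set (S :: real set))"
proof -
  have "gen_fam {\<lambda>x. x} (top_of_set S)"
    unfolding gen_fam_def
  proof (intro conjI ballI allI impI)
    fix U x assume "openin (top_of_set S) U" "x \<in> U"
    then obtain e where e: "e > 0" "\<forall>y\<in>S. dist y x < e \<longrightarrow> y \<in> U"
      unfolding openin_euclidean_subtopology_iff by blast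
    then show "nbd {\<lambda>x. x} (top_of_set S) x U"
      unfolding nbd_def by (intro exI[of _ "[\<lambda>x. x]"] exI[of _ e]) (auto simp: dist_real_def)
  qed auto
  then show ?thesis unfolding embeddable_def by blast
qed

lemma embeddable_product:
  fixes X :: "'i \<Rightarrow> 'a topology"
  assumes "countable I" "\<And>i. i \<in> I \<Longrightarrow> embeddable (X i)"
  shows "embeddable (product_topology X I)"
proof -
  obtain F where F: "\<And>i. i \<in> I \<Longrightarrow> gen_fam (F i) (X i)"
    using assms(2) unfolding embeddable_def by metis
  define G where "G = (\<Union>i\<in>I. (\<lambda>\<phi>. \<phi> \<circ> (\<lambda>x. x i)) ` F i)"
  have "gen_fam G (product_topology X I)"
    unfolding gen_fam_def
  proof (intro conjI ballI allI impI)
    show "countable G" unfolding G_def using gen_fam_D(1)[OF F] assms(1) by simp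
  next
    fix \<psi> assume "\<psi> \<in> G"
    then obtain i \<phi> where i: "i \<in> I" "\<phi> \<in> F i" "\<psi> = \<phi> \<circ> (\<lambda>x. x i)" unfolding G_def by auto
    show "continuous_map (product_topology X I) euclideanreal \<psi>"
      unfolding i(3)
      by (rule continuous_map_compose[where X' = "X i"])
        (rule continuous_map_product_projection[OF i(1)], rule gen_fam_D(2)[OF F[OF i(1)] i(2)])
  next
    fix x y assume xy: "x \<in> topspace (product_topology X I)" "y \<in> topspace (product_topology X I)"
      and eq: "\<forall>\<psi>\<in>G. \<psi> x = \<psi> y"
    have "x i = y i" if i: "i \<in> I" for i
    proof -
      have "\<phi> \<circ> (\<lambda>x. x i) \<in> G" if "\<phi> \<in> F i" for \<phi> using i that unfolding G_def by blast
      then have "\<phi> (x i) = \<phi> (y i)" if "\<phi> \<in> F i" for \<phi>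
        using eq[rule_format, of "\<phi> \<circ> (\<lambda>x. x i)"] that by simp
      moreover have "x i \<in> topspace (X i)" "y i \<in> topspace (X i)" using xy i by auto
      ultimately show ?thesis using gen_fam_D(3)[OF F[OF i]] by metis
    qed
    then show "x = y" using xy by (auto intro: PiE_ext)
  next
    fix U x assume U: "openin (product_topology X I) U" "x \<in> U"
    obtain A where A: "x \<in> (\<Pi>\<^sub>E i\<in>I. A i)" "\<And>i. openin (X i) (A i)"
        "finite {i. A i \<noteq> topspace (X i)}" "(\<Pi>\<^sub>E i\<in>I. A i) \<subseteq> U"
      using product_topology_open_contains_basis[OF U] by blast
    define J where "J = {i\<in>I. A i \<noteq> topspace (X i)}"
    let ?P = "product_topology X I"
    have J: "finite J" unfolding J_def by (rule finite_subset[OF _ A(3)]) auto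
    have "nbd G ?P x (topspace ?P \<inter> (\<Inter>i\<in>J. topspace ?P \<inter> (\<lambda>x. x i) -` A i))"
    proof (rule nbd_finite[OF J])
      fix i assume "i \<in> J"
      then have i: "i \<in> I" by (simp add: J_def)
      have "x i \<in> A i" using A(1) i by auto
      then have "nbd (F i) (X i) (x i) (A i)" by (rule gen_fam_D(4)[OF F[OF i] A(2)])
      then show "nbd G ?P x (topspace ?P \<inter> (\<lambda>x. x i) -` A i)"
        by (rule nbd_map[where h = "\<lambda>x. x i"]) (use i in \<open>auto simp: G_def\<close>)
    qed
    moreover have "topspace ?P \<inter> (\<Inter>i\<in>J. topspace ?P \<inter> (\<lambda>x. x i) -` A i) \<subseteq> (\<Pi>\<^sub>E i\<in>I. A i)"
    proof
      fix y assume y: "y \<in> topspace ?P \<inter> (\<Inter>i\<in>J. topspace ?P \<inter> (\<lambda>x. x i) -` A i)"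
      have "y i \<in> A i" if "i \<in> I" for i
      proof (cases "i \<in> J")
        case True
        then show ?thesis using y by blast
      next
        case False
        then have "A i = topspace (X i)" using that by (simp add: J_def)
        then show ?thesis using y that by (auto simp: PiE_iff)
      qed
      then show "y \<in> (\<Pi>\<^sub>E i\<in>I. A i)" using y by (auto simp: PiE_iff)
    qed
    ultimately show "nbd G ?P x U" using A(4) by (meson nbd_mono)
  qed
  then show ?thesis unfolding embeddable_def by blast
qed

lemma embeddable_prod:
  assumes "embeddable X" "embeddable Y"
  shows "embeddable (prod_topology X Y)"
proof -
  obtain F G where F: "gen_fam F X" and G: "gen_fam G Y"
    using assms unfolding embeddable_def by metis
  define H where "H = (\<lambda>\<phi>. \<phi> \<circ> fst) ` F \<union> (\<lambda>\<phi>. \<phi> \<circ> snd) ` G"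
  let ?P = "prod_topology X Y"
  have "gen_fam H ?P"
    unfolding gen_fam_def
  proof (intro conjI ballI allI impI)
    show "countable H" unfolding H_def using gen_fam_D(1)[OF F] gen_fam_D(1)[OF G] by simp
  next
    fix \<psi> assume "\<psi> \<in> H"
    then consider \<phi> where "\<phi> \<in> F" "\<psi> = \<phi> \<circ> fst" | \<phi> where "\<phi> \<in> G" "\<psi> = \<phi> \<circ> snd"
      unfolding H_def by blast
    then show "continuous_map ?P euclideanreal \<psi>"
    proof cases
      case 1
      have "continuous_map X euclideanreal \<phi>" by (rule gen_fam_D(2)[OF F 1(1)])
      then show ?thesis unfolding 1 by (rule continuous_map_compose[OF continuous_map_fst])
    next
      case 2
      have "continuous_map Y euclideanreal \<phi>" by (rule gen_fam_D(2)[OF G 2(1)])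
      then show ?thesis unfolding 2 by (rule continuous_map_compose[OF continuous_map_snd])
    qed
  next
    fix x y assume xy: "x \<in> topspace ?P" "y \<in> topspace ?P" and eq: "\<forall>\<psi>\<in>H. \<psi> x = \<psi> y"
    have 1: "\<phi> (fst x) = \<phi> (fst y)" if "\<phi> \<in> F" for \<phi>
      using eq[rule_format, of "\<phi> \<circ> fst"] that by (simp add: H_def)
    have 2: "\<phi> (snd x) = \<phi> (snd y)" if "\<phi> \<in> G" for \<phi>
      using eq[rule_format, of "\<phi> \<circ> snd"] that by (simp add: H_def)
    have "fst x = fst y" using xy by (intro gen_fam_D(3)[OF F] 1) auto
    moreover have "snd x = snd y" using xy by (intro gen_fam_D(3)[OF G] 2) auto
    ultimately show "x = y" by (simp add: prod_eq_iff)
  next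
    fix U x assume U: "openin ?P U" "x \<in> U"
    obtain A B where AB: "openin X A" "openin Y B" "fst x \<in> A" "snd x \<in> B" "A \<times> B \<subseteq> U"
      using U(1)[unfolded openin_prod_topology_alt, rule_format, of "fst x" "snd x"] U(2) by auto
    have A: "nbd F X (fst x) A" and B: "nbd G Y (snd x) B"
      by (rule gen_fam_D(4)[OF F AB(1,3)], rule gen_fam_D(4)[OF G AB(2,4)])
    have "nbd H ?P x (topspace ?P \<inter> fst -` A)"
      by (rule nbd_map[where h = fst, OF A]) (auto simp: H_def)
    moreover have "nbd H ?P x (topspace ?P \<inter> snd -` B)"
      by (rule nbd_map[where h = snd, OF B]) (auto simp: H_def)
    ultimately have "nbd H ?P x ((topspace ?P \<inter> fst -` A) \<inter> (topspace ?P \<inter> snd -` B))"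
      by (rule nbd_Int)
    then show "nbd H ?P x U" by (rule nbd_mono) (use AB(5) in auto)
  qed
  then show ?thesis unfolding embeddable_def by blast
qed

lemma inj_code:
  assumes "embeddable X" shows "inj_on (code X) (topspace X)"
proof -
  obtain F where F: "gen_fam F X" using assms unfolding embeddable_def by blast
  define c where "c x n = from_nat_into F n x" for x and n :: nat
  have "inj_on c (topspace X)"
  proof (cases "F = {}")
    case True
    then show ?thesis using gen_fam_D(3)[OF F] by (auto intro: inj_onI)
  next
    case False
    show ?thesis
    proof (rule inj_onI)
      fix x y assume xy: "x \<in> topspace X" "y \<in> topspace X" "c x = c y"
      have "\<phi> x = \<phi> y" if "\<phi> \<in> F" for \<phi>
      proof -
        obtain n where "from_nat_into F n = \<phi>"
          using from_nat_into_surj[OF gen_fam_D(1)[OF F] \<open>\<phi> \<in> F\<close>] by blast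
        then show ?thesis using fun_cong[OF xy(3), of n] by (simp add: c_def)
      qed
      then show "x = y" by (rule gen_fam_D(3)[OF F xy(1,2)])
    qed
  qed
  then show ?thesis unfolding code_def by (rule someI[of "\<lambda>c. inj_on c (topspace X)"])
qed

lemma topspace_recode: "topspace (recode X) = code X ` topspace X"
  unfolding recode_def topspace_pullback_topology by (auto intro: inv_into_into)

lemma homeomorphic_map_recode:
  assumes "embeddable X" shows "homeomorphic_map X (recode X) (code X)"
proof -
  let ?c = "code X" and ?d = "inv_into (topspace X) (code X)"
  note inj = inj_code[OF assms]
  have "continuous_map X (recode X) ?c"
    unfolding recode_def
  proof (rule continuous_map_pullback')
    show "continuous_map X X (?d \<circ> ?c)"
      using inj by (intro continuous_map_eq[OF continuous_map_id]) auto
  qed auto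
  moreover have "continuous_map (recode X) X (id \<circ> ?d)"
    unfolding recode_def by (rule continuous_map_pullback) simp
  ultimately have "homeomorphic_maps X (recode X) ?c ?d"
    unfolding homeomorphic_maps_def using inj by (auto simp: topspace_recode f_inv_into_f)
  then show ?thesis by (rule homeomorphic_maps_imp_map)
qed

lemma embeddable_recode:
  assumes "embeddable X" shows "embeddable (recode X)"
proof -
  obtain F where F: "gen_fam F X" using assms unfolding embeddable_def by blast
  let ?d = "inv_into (topspace X) (code X)"
  have d: "?d z \<in> topspace X" if "z \<in> topspace (recode X)" for z
    using that by (auto simp: topspace_recode intro: inv_into_into)
  define G where "G = (\<lambda>\<phi>. \<phi> \<circ> ?d) ` F"
  have "gen_fam G (recode X)"
    unfolding gen_fam_def
  proof (intro conjI ballI allI impI)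
    show "countable G" unfolding G_def using gen_fam_D(1)[OF F] by simp
  next
    fix \<psi> assume "\<psi> \<in> G"
    then obtain \<phi> where \<phi>: "\<phi> \<in> F" "\<psi> = \<phi> \<circ> ?d" unfolding G_def by blast
    show "continuous_map (recode X) euclideanreal \<psi>"
      unfolding \<phi>(2) recode_def by (rule continuous_map_pullback[OF gen_fam_D(2)[OF F \<phi>(1)]])
  next
    fix x y assume xy: "x \<in> topspace (recode X)" "y \<in> topspace (recode X)"
      and eq: "\<forall>\<psi>\<in>G. \<psi> x = \<psi> y"
    have "\<phi> (?d x) = \<phi> (?d y)" if "\<phi> \<in> F" for \<phi>
      using eq[rule_format, of "\<phi> \<circ> ?d"] that by (simp add: G_def)
    then have "?d x = ?d y" by (rule gen_fam_D(3)[OF F d[OF xy(1)] d[OF xy(2)]])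
    then show "x = y" using xy unfolding topspace_recode by (rule inv_into_injective)
  next
    fix U x assume U: "openin (recode X) U" "x \<in> U"
    then obtain V where V: "openin X V" "U = ?d -` V \<inter> code X ` topspace X"
      unfolding recode_def openin_pullback_topology by blast
    have "nbd F X (?d x) V" by (rule gen_fam_D(4)[OF F V(1)]) (use U(2) V(2) in simp)
    then have "nbd G (recode X) x (topspace (recode X) \<inter> ?d -` V)"
      by (rule nbd_map[where h = ?d]) (use d in \<open>auto simp: G_def\<close>)
    then show "nbd G (recode X) x U" using V(2) by (simp add: topspace_recode Int_commute)
  qed
  then show ?thesis unfolding embeddable_def by blast
qed


definition lsc_on :: "'a topology \<Rightarrow> ('a \<Rightarrow> real) \<Rightarrow> bool" where
  "lsc_on X f \<longleftrightarrow> (\<forall>c. openin X {y \<in> topspace X. c < f y})"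

definition lsc_fam :: "('a \<Rightarrow> real) set \<Rightarrow> 'a topology \<Rightarrow> bool" where
  "lsc_fam H X \<longleftrightarrow> countable H \<and>
     (\<forall>h\<in>H. continuous_map X euclideanreal h \<and> bounded (h ` topspace X) \<and> (\<forall>y. 0 \<le> h y)) \<and>
     (\<lambda>_. 0) \<in> H \<and> (\<forall>g\<in>H. \<forall>h\<in>H. (\<lambda>y. max (g y) (h y)) \<in> H) \<and>
     (\<forall>f x a. lsc_on X f \<longrightarrow> (\<forall>y\<in>topspace X. 0 \<le> f y) \<longrightarrow> x \<in> topspace X \<longrightarrow> a < f x \<longrightarrow>
        (\<exists>h\<in>H. (\<forall>y\<in>topspace X. h y \<le> f y) \<and> a < h x))"

lemma lsc_on_continuous: "continuous_map X euclideanreal f \<Longrightarrow> lsc_on X f"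
  unfolding lsc_on_def
  using openin_continuous_map_preimage[of X euclideanreal f "{c<..}" for c] by simp

definition bump :: "real \<times> real \<times> (('a \<Rightarrow> real) \<times> real) list \<Rightarrow> 'a \<Rightarrow> real" where
  "bump = (\<lambda>(c, e, L) y. c * max 0 (1 - (\<Sum>(\<phi>, q)\<leftarrow>L. \<bar>\<phi> y - q\<bar>) / e))"

definition bumps :: "(real \<times> real \<times> (('a \<Rightarrow> real) \<times> real) list) list \<Rightarrow> 'a \<Rightarrow> real" where
  "bumps l y = foldr (\<lambda>i. max (bump i y)) l 0"

lemma bumps_nonneg: "0 \<le> bumps l y"
  unfolding bumps_def by (induction l) (auto simp: le_max_iff_disj)

lemma bumps_append: "bumps (l @ l') y = max (bumps l y) (bumps l' y)"
proof (induction l)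
  case Nil
  show ?case using bumps_nonneg[of l' y] by (simp add: bumps_def max_def)
next
  case (Cons i l)
  then show ?case by (simp add: bumps_def max.assoc)
qed

lemma continuous_map_list_sum:
  "(\<And>p. p \<in> set L \<Longrightarrow> continuous_map X euclideanreal (fst p)) \<Longrightarrow>
   continuous_map X euclideanreal (\<lambda>y. \<Sum>(\<phi>, q)\<leftarrow>L. \<bar>\<phi> y - q\<bar>)"
  by (induction L) (auto simp: case_prod_beta intro!: continuous_intros)

lemma embeddable_lsc_fam:
  assumes "embeddable X" obtains H where "lsc_fam H X"
proof -
  obtain F where F: "gen_fam F X" using assms unfolding embeddable_def by blast
  define I :: "(real \<times> real \<times> (('a \<Rightarrow> real) \<times> real) list) set"
    where "I = (\<rat> \<inter> {0..}) \<times> (\<rat> \<inter> {0<..}) \<times> lists (F \<times> \<rat>)"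
  have cI: "countable I" unfolding I_def
    by (intro countable_SIGMA countable_lists countable_Int1 countable_rat gen_fam_D(1)[OF F])
  define H where "H = bumps ` lists I"
  have bump_cont: "continuous_map X euclideanreal (bump i)" if i: "i \<in> I" for i
  proof -
    obtain c e L where ceL: "i = (c, e, L)" by (cases i) auto
    have "continuous_map X euclideanreal (\<lambda>y. \<Sum>(\<phi>, q)\<leftarrow>L. \<bar>\<phi> y - q\<bar>)"
      by (rule continuous_map_list_sum) 
        (use i ceL in \<open>auto simp: I_def intro!: gen_fam_D(2)[OF F]\<close>)
    then show ?thesis using i unfolding ceL bump_def I_def
      by (auto intro!: continuous_intros)
  qed
  have bump_bd: "0 \<le> bump i y \<and> bump i y \<le> fst i" if "i \<in> I" for i y
  proof -
    obtain c e L where ceL: "i = (c, e, L)" by (cases i) auto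
    have c: "c \<ge> 0" "e > 0" using that ceL by (auto simp: I_def)
    have "(\<Sum>(\<phi>, q)\<leftarrow>L. \<bar>\<phi> y - q\<bar>) \<ge> 0" by (induction L) auto
    then have "(\<Sum>(\<phi>, q)\<leftarrow>L. \<bar>\<phi> y - q\<bar>) / e \<ge> 0" using c by auto
    then have "max 0 (1 - (\<Sum>(\<phi>, q)\<leftarrow>L. \<bar>\<phi> y - q\<bar>) / e) \<le> 1" by auto
    then show ?thesis using c(1) unfolding ceL bump_def by (auto intro: mult_left_le)
  qed
  have H_cont: "continuous_map X euclideanreal (bumps l) \<and> (\<exists>B. \<forall>y. bumps l y \<le> B)"
    if "l \<in> lists I" for l
    using that
  proof (induction l)
    case Nil
    then show ?case by (auto simp: bumps_def)
  next
    case (Cons i l)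
    then obtain B where B: "\<And>y. bumps l y \<le> B" by auto
    have eq: "bumps (i # l) = (\<lambda>y. max (bump i y) (bumps l y))" by (auto simp: bumps_def)
    have "bumps (i # l) y \<le> max (fst i) B" for y
      unfolding eq using bump_bd[of i y] B[of y] Cons by auto
    moreover have "continuous_map X euclideanreal (bumps (i # l))"
      unfolding eq using bump_cont[of i] Cons by (auto intro!: continuous_intros)
    ultimately show ?case by blast
  qed
  have "lsc_fam H X"
    unfolding lsc_fam_def
  proof (intro conjI ballI allI impI)
    show "countable H" unfolding H_def using cI by simp
  next
    fix h assume "h \<in> H"
    then obtain l where l: "l \<in> lists I" "h = bumps l" by (auto simp: H_def)
    show "continuous_map X euclideanreal h" using H_cont[OF l(1)] l(2) by simp
    show "0 \<le> h y" for y using l(2) bumps_nonneg by simp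
    obtain B where "\<And>y. h y \<le> B" using H_cont[OF l(1)] l(2) by auto
    then have "\<bar>h y\<bar> \<le> B" for y using l(2) bumps_nonneg[of l y] by simp
    then show "bounded (h ` topspace X)" by (auto intro!: boundedI[of _ B])
  next
    have "(\<lambda>_. 0) = (bumps [] :: 'a \<Rightarrow> real)" by (auto simp: bumps_def)
    then show "(\<lambda>_. 0) \<in> H" unfolding H_def by (intro image_eqI[of _ _ "[]"]) auto
  next
    fix g h assume "g \<in> H" "h \<in> H"
    then obtain l l' where l: "l \<in> lists I" "g = bumps l" "l' \<in> lists I" "h = bumps l'"
      by (auto simp: H_def)
    then have "(\<lambda>y. max (g y) (h y)) = bumps (l @ l')" by (auto simp: bumps_append)
    moreover have "bumps (l @ l') \<in> H" unfolding H_def using l by (intro imageI) auto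
    ultimately show "(\<lambda>y. max (g y) (h y)) \<in> H" using l by simp
  next
    fix f x a
    assume f: "lsc_on X f" "\<forall>y\<in>topspace X. 0 \<le> f y" and x: "x \<in> topspace X" and a: "a < f x"
    show "\<exists>h\<in>H. (\<forall>y\<in>topspace X. h y \<le> f y) \<and> a < h x"
    proof (cases "a < 0")
      case True
      have "(\<lambda>_. 0) = (bumps [] :: 'a \<Rightarrow> real)" by (auto simp: bumps_def)
      then have "(\<lambda>_. 0) \<in> H" unfolding H_def by (intro image_eqI[of _ _ "[]"]) auto
      then show ?thesis using True f(2) by (intro bexI[of _ "\<lambda>_. 0"]) auto
    next
      case False
      obtain c where c: "c \<in> \<rat>" "a < c" "c < f x" using Rats_dense_in_real[OF a] by blast
      have cpos: "c > 0" using c False by linarith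
      let ?U = "{y \<in> topspace X. c < f y}"
      have "openin X ?U" using f(1) unfolding lsc_on_def by blast
      then have "nbd F X x ?U" by (rule gen_fam_D(4)[OF F]) (use x c(3) in simp)
      then obtain L \<delta> where L: "set L \<subseteq> F" "\<delta> > 0"
          "\<And>y. y \<in> topspace X \<Longrightarrow> (\<Sum>\<phi>\<leftarrow>L. \<bar>\<phi> y - \<phi> x\<bar>) < \<delta> \<Longrightarrow> c < f y"
        unfolding nbd_def by blast
      obtain e where e: "e \<in> \<rat>" "0 < e" "e < \<delta> / 2"
        using Rats_dense_in_real[of 0 "\<delta> / 2"] L(2) by auto
      define \<eta> where "\<eta> = min 1 ((c - a) / c) * e"
      have \<eta>: "\<eta> > 0" "\<eta> \<le> e" "c * (1 - t / e) > a" if "t < \<eta>" for t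
      proof -
        show "\<eta> > 0" using e c cpos by (auto simp: \<eta>_def)
        show "\<eta> \<le> e" using e by (auto simp: \<eta>_def intro: mult_right_le_one_le mult_left_le_one_le)
        have "t < (c - a) / c * e" using that e(2) unfolding \<eta>_def
          by (smt (verit) mult_right_mono min.cobounded2)
        then have "t / e < (c - a) / c" using e(2) by (simp add: field_simps)
        then have "c * (t / e) < c - a" using cpos by (simp add: field_simps)
        then show "c * (1 - t / e) > a" by (simp add: algebra_simps)
      qed
      have \<eta>pos: "\<eta> > 0" using e c cpos by (auto simp: \<eta>_def)
      have "\<exists>M. set M \<subseteq> F \<times> \<rat> \<and> map fst M = L \<and> (\<Sum>(\<phi>, q)\<leftarrow>M. \<bar>\<phi> x - q\<bar>) < \<epsilon>"
        if "\<epsilon> > 0" "set L \<subseteq> F" for \<epsilon> :: real and L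
        using that
      proof (induction L arbitrary: \<epsilon>)
        case Nil
        then show ?case by (intro exI[of _ "[]"]) auto
      next
        case (Cons \<phi> L)
        obtain M where M: "set M \<subseteq> F \<times> \<rat>" "map fst M = L" "(\<Sum>(\<phi>, q)\<leftarrow>M. \<bar>\<phi> x - q\<bar>) < \<epsilon> / 2"
          using Cons.IH[of "\<epsilon> / 2"] Cons.prems by auto
        obtain q where q: "q \<in> \<rat>" "\<phi> x < q" "q < \<phi> x + \<epsilon> / 2"
          using Rats_dense_in_real[of "\<phi> x" "\<phi> x + \<epsilon> / 2"] Cons.prems by auto
        show ?case
          using M q Cons.prems by (intro exI[of _ "(\<phi>, q) # M"]) auto
      qed
      from this[OF \<eta>pos L(1)] obtain M where
        M: "set M \<subseteq> F \<times> \<rat>" "map fst M = L" "(\<Sum>(\<phi>, q)\<leftarrow>M. \<bar>\<phi> x - q\<bar>) < \<eta>" by blast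
      let ?i = "(c, e, M)"
      have iI: "?i \<in> I" using c cpos e M(1) by (auto simp: I_def)
      have Mx: "(\<Sum>\<phi>\<leftarrow>map fst M. \<bar>\<phi> y - \<phi> x\<bar>) \<le>
          (\<Sum>(\<phi>, q)\<leftarrow>M. \<bar>\<phi> y - q\<bar>) + (\<Sum>(\<phi>, q)\<leftarrow>M. \<bar>\<phi> x - q\<bar>)" for y
        by (induction M) auto
      have "bump ?i y \<le> f y" if y: "y \<in> topspace X" for y
      proof (cases "(\<Sum>(\<phi>, q)\<leftarrow>M. \<bar>\<phi> y - q\<bar>) < e")
        case True
        then have "(\<Sum>\<phi>\<leftarrow>L. \<bar>\<phi> y - \<phi> x\<bar>) < \<delta>"
          using Mx[of y] M(2,3) \<eta>(2)[OF M(3)] e(3) by simp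
        then have "c < f y" using L(3) y by blast
        then show ?thesis using bump_bd[OF iI, of y] by simp
      next
        case False
        then have "(\<Sum>(\<phi>, q)\<leftarrow>M. \<bar>\<phi> y - q\<bar>) / e \<ge> 1" using e(2) by (simp add: field_simps)
        then have "bump ?i y = 0" by (simp add: bump_def)
        then show ?thesis using f(2) y by simp
      qed
      then have "\<forall>y\<in>topspace X. bumps [?i] y \<le> f y" using f(2) by (simp add: bumps_def)
      moreover have "a < bump ?i x"
      proof -
        have "c * (1 - (\<Sum>(\<phi>, q)\<leftarrow>M. \<bar>\<phi> x - q\<bar>) / e) \<le> bump ?i x"
          unfolding bump_def using cpos by (auto intro!: mult_left_mono)
        then show ?thesis using \<eta>(3)[OF M(3)] by linarith
      qed
      then have "a < bumps [?i] x" by (simp add: bumps_def)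
      moreover have "bumps [?i] \<in> H" unfolding H_def using iI by (intro imageI) auto
      ultimately show ?thesis by blast
    qed
  qed
  then show ?thesis by (rule that)
qed

lemma borel_of_simps: "space (borel_of X) = topspace X"
    "sets (borel_of X) = sigma_sets (topspace X) {U. openin X U}"
proof -
  have "{U. openin X U} \<subseteq> Pow (topspace X)" by (auto dest: openin_subset)
  then show "space (borel_of X) = topspace X"
    "sets (borel_of X) = sigma_sets (topspace X) {U. openin X U}"
    unfolding borel_of_def by (simp_all add: space_measure_of sets_measure_of)
qed

lemma borel_probs_D:
  assumes "\<mu> \<in> borel_probs X"
  shows "prob_space \<mu>" "space \<mu> = topspace X" "sets \<mu> = sigma_sets (topspace X) {U. openin X U}"
    "lsc_on X f \<Longrightarrow> f \<in> borel_measurable \<mu>"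
proof -
  show "prob_space \<mu>" and 2: "sets \<mu> = sigma_sets (topspace X) {U. openin X U}"
    using assms by (auto simp: borel_probs_def borel_of_simps)
  show 1: "space \<mu> = topspace X"
    using assms sets_eq_imp_space_eq[of \<mu> "borel_of X"]
    by (simp add: borel_probs_def borel_of_simps)
  show "f \<in> borel_measurable \<mu>" if "lsc_on X f"
    using that unfolding lsc_on_def
    by (intro borel_measurableI_greater) (auto simp: 1 2)
qed

lemma integrable_lsc:
  assumes "\<mu> \<in> borel_probs X" "lsc_on X f" "\<And>y. y \<in> topspace X \<Longrightarrow> \<bar>f y\<bar> \<le> B"
  shows "integrable \<mu> f"
proof -
  interpret prob_space \<mu> using borel_probs_D(1)[OF assms(1)] .
  show ?thesis
    by (rule integrable_const_bound[of _ B])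
      (use assms borel_probs_D[OF assms(1)] in auto)
qed

lemma lsc_fam_D:
  assumes "lsc_fam H X" "h \<in> H"
  shows "lsc_on X h" "\<exists>B. \<forall>y\<in>topspace X. \<bar>h y\<bar> \<le> B" "0 \<le> h y"
    "continuous_map X euclideanreal h" "bounded (h ` topspace X)"
proof -
  show c: "continuous_map X euclideanreal h" and b: "bounded (h ` topspace X)" and "0 \<le> h y"
    using assms unfolding lsc_fam_def by blast+
  show "lsc_on X h" using c by (rule lsc_on_continuous)
  show "\<exists>B. \<forall>y\<in>topspace X. \<bar>h y\<bar> \<le> B" using b by (simp add: bounded_iff)
qed

lemma lsc_fam_D2:
  assumes "lsc_fam H X"
  shows "countable H" "(\<lambda>_. 0) \<in> H"
    "g \<in> H \<Longrightarrow> h \<in> H \<Longrightarrow> (\<lambda>y. max (g y) (h y)) \<in> H"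
  using assms unfolding lsc_fam_def by blast+

lemma lsc_fam_D3:
  assumes "lsc_fam H X" "lsc_on X f" "\<And>y. y \<in> topspace X \<Longrightarrow> 0 \<le> f y" "x \<in> topspace X" "a < f x"
  obtains h where "h \<in> H" "\<forall>y\<in>topspace X. h y \<le> f y" "a < h x"
  using assms unfolding lsc_fam_def by blast

lemma lsc_fam_approx:
  assumes H: "lsc_fam H X" and \<mu>: "\<mu> \<in> borel_probs X"
    and f: "lsc_on X f" "\<And>y. y \<in> topspace X \<Longrightarrow> 0 \<le> f y" "\<And>y. y \<in> topspace X \<Longrightarrow> f y \<le> B"
    and a: "a < (\<integral>y. f y \<partial>\<mu>)"
  shows "\<exists>h\<in>H. (\<forall>y\<in>topspace X. h y \<le> f y) \<and> a < (\<integral>y. h y \<partial>\<mu>)"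
proof -
  interpret prob_space \<mu> using borel_probs_D(1)[OF \<mu>] .
  define K where "K = {h \<in> H. \<forall>y\<in>topspace X. h y \<le> f y}"
  have K: "countable K" "K \<noteq> {}" 
    using lsc_fam_D2(1,2)[OF H] f(2) unfolding K_def by auto
  define e where "e = from_nat_into K"
  have eK: "e n \<in> K" for n unfolding e_def using from_nat_into[OF K(2)] .
  define g where "g = rec_nat (e 0) (\<lambda>n g y. max (g y) (e (Suc n) y))"
  have g: "g 0 = e 0" "g (Suc n) = (\<lambda>y. max (g n y) (e (Suc n) y))" for n
    by (simp_all add: g_def)
  have gK: "g n \<in> K" for n
  proof (induction n)
    case (Suc n)
    then show ?case using eK[of "Suc n"] lsc_fam_D2(3)[OF H, of "g n" "e (Suc n)"]
      unfolding g K_def by simp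
  qed (simp add: g eK)
  have mono: "g m y \<le> g n y" if "m \<le> n" for m n y
    by (rule lift_Suc_mono_le[of "\<lambda>n. g n y", OF _ that]) (simp add: g)
  have ge: "e n y \<le> g n y" for n y by (cases n) (auto simp: g)
  have lim: "(\<lambda>n. g n y) \<longlonglongrightarrow> f y" if y: "y \<in> topspace X" for y
  proof (rule increasing_tendsto)
    show "\<forall>\<^sub>F n in sequentially. g n y \<le> f y" using gK y by (auto simp: K_def)
    fix b assume "b < f y"
    obtain h where h: "h \<in> H" "\<forall>y\<in>topspace X. h y \<le> f y" "b < h y"
      using lsc_fam_D3[OF H f(1,2) y \<open>b < f y\<close>] by blast
    then have "h \<in> K" by (simp add: K_def)
    then obtain n where "h = e n" unfolding e_def using from_nat_into_surj[OF K(1), of h] by blast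
    then have "b < g m y" if "n \<le> m" for m
      using h(3) ge[of n y] mono[OF that, of y] by simp
    then show "\<forall>\<^sub>F n in sequentially. b < g n y" by (auto simp: eventually_sequentially)
  qed
  have "(\<lambda>n. \<integral>y. g n y \<partial>\<mu>) \<longlonglongrightarrow> (\<integral>y. f y \<partial>\<mu>)"
  proof (rule integral_dominated_convergence[where w = "\<lambda>_. B"])
    show "f \<in> borel_measurable \<mu>" using borel_probs_D(4)[OF \<mu> f(1)] .
    show "g n \<in> borel_measurable \<mu>" for n
      using borel_probs_D(4)[OF \<mu>] lsc_fam_D(1)[OF H] gK[of n] by (auto simp: K_def)
    show "AE y in \<mu>. (\<lambda>n. g n y) \<longlonglongrightarrow> f y"
      using lim borel_probs_D(2)[OF \<mu>] by auto
    show "AE y in \<mu>. norm (g n y) \<le> B" for n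
    proof (rule AE_I2)
      fix y assume "y \<in> space \<mu>"
      then have y: "y \<in> topspace X" using borel_probs_D(2)[OF \<mu>] by simp
      have "g n y \<le> f y" "g n \<in> H" using gK[of n] y by (auto simp: K_def)
      then show "norm (g n y) \<le> B"
        using f(3)[OF y] lsc_fam_D(3)[OF H, of "g n" y] by simp
    qed
  qed simp
  then have "\<forall>\<^sub>F n in sequentially. a < (\<integral>y. g n y \<partial>\<mu>)" using a by (rule order_tendstoD)
  then obtain n where "a < (\<integral>y. g n y \<partial>\<mu>)" by (auto simp: eventually_sequentially)
  then show ?thesis using gK[of n] by (auto simp: K_def)
qed

lemma lsc_fam_le:
  assumes H: "lsc_fam H X" and \<mu>: "\<mu> \<in> borel_probs X" and h: "h \<in> H"
    and f: "lsc_on X f" "\<And>y. y \<in> topspace X \<Longrightarrow> 0 \<le> f y" "\<And>y. y \<in> topspace X \<Longrightarrow> f y \<le> B"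
    and le: "\<forall>y\<in>topspace X. h y \<le> f y"
  shows "(\<integral>y. h y \<partial>\<mu>) \<le> (\<integral>y. f y \<partial>\<mu>)"
proof (rule integral_mono)
  obtain C where "\<forall>y\<in>topspace X. \<bar>h y\<bar> \<le> C" using lsc_fam_D(2)[OF H h] by blast
  then show "integrable \<mu> h" using integrable_lsc[OF \<mu> lsc_fam_D(1)[OF H h]] by blast
  have "\<bar>f y\<bar> \<le> B" if "y \<in> topspace X" for y using f(2,3)[OF that] by simp
  then show "integrable \<mu> f" by (rule integrable_lsc[OF \<mu> f(1)])
  show "h y \<le> f y" if "y \<in> space \<mu>" for y using that le borel_probs_D(2)[OF \<mu>] by simp
qed

lemma lsc_fam_separates:
  assumes H: "lsc_fam H X" and \<mu>: "\<mu> \<in> borel_probs X" and \<nu>: "\<nu> \<in> borel_probs X"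
    and eq: "\<And>h. h \<in> H \<Longrightarrow> (\<integral>y. h y \<partial>\<mu>) = (\<integral>y. h y \<partial>\<nu>)"
  shows "\<mu> = \<nu>"
proof -
  have le: "measure \<nu> U \<le> measure \<mu> U" if U: "openin X U" and \<mu>: "\<mu> \<in> borel_probs X"
    and \<nu>: "\<nu> \<in> borel_probs X" and eq: "\<And>h. h \<in> H \<Longrightarrow> (\<integral>y. h y \<partial>\<mu>) = (\<integral>y. h y \<partial>\<nu>)" for U \<mu> \<nu>
  proof (rule ccontr)
    assume *: "\<not> ?thesis"
    let ?f = "indicator U :: _ \<Rightarrow> real"
    have sub: "U \<subseteq> topspace X" using U openin_subset by blast
    have lsc: "lsc_on X ?f"
      unfolding lsc_on_def
    proof
      fix c :: real
      have "{y \<in> topspace X. c < ?f y} = (if c < 0 then topspace X else if c < 1 then U else {})"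
        using sub by (auto simp: indicator_def split: if_splits)
      then show "openin X {y \<in> topspace X. c < ?f y}" using U by auto
    qed
    have m: "(\<integral>y. ?f y \<partial>\<mu>) = measure \<mu> U" "(\<integral>y. ?f y \<partial>\<nu>) = measure \<nu> U"
      using sub borel_probs_D(2)[OF \<mu>] borel_probs_D(2)[OF \<nu>] by (simp_all add: Int_absorb2)
    have "measure \<mu> U < (\<integral>y. ?f y \<partial>\<nu>)" using * m by simp
    then obtain h where h: "h \<in> H" "\<forall>y\<in>topspace X. h y \<le> ?f y" "measure \<mu> U < (\<integral>y. h y \<partial>\<nu>)"
      using lsc_fam_approx[OF H \<nu> lsc, of 1] by (auto simp: indicator_def)
    have "(\<integral>y. h y \<partial>\<mu>) \<le> (\<integral>y. ?f y \<partial>\<mu>)"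
      by (rule lsc_fam_le[OF H \<mu> h(1) lsc, of 1]) (use h(2) in \<open>auto simp: indicator_def\<close>)
    then show False using h eq m by simp
  qed
  interpret \<mu>: prob_space \<mu> using borel_probs_D(1)[OF \<mu>] .
  interpret \<nu>: prob_space \<nu> using borel_probs_D(1)[OF \<nu>] .
  show ?thesis
  proof (rule measure_eqI_generator_eq[where E = "{U. openin X U}" and \<Omega> = "topspace X"
        and A = "\<lambda>_. topspace X"])
    show "Int_stable {U. openin X U}" by (auto simp: Int_stable_def)
    show "{U. openin X U} \<subseteq> Pow (topspace X)" by (auto dest: openin_subset)
    show "emeasure \<mu> U = emeasure \<nu> U" if "U \<in> {U. openin X U}" for U
      using le[of U \<mu> \<nu>] le[of U \<nu> \<mu>] that \<mu> \<nu> eq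
      by (simp add: \<mu>.emeasure_eq_measure \<nu>.emeasure_eq_measure)
  qed (use borel_probs_D(3)[OF \<mu>] borel_probs_D(3)[OF \<nu>] in auto)
qed

lemma topspace_weak_topology: "topspace (weak_topology X) = borel_probs X"
proof -
  let ?S = "{{\<mu> \<in> borel_probs X. (\<integral>x. f x \<partial>\<mu>) \<in> U} | f U.
        continuous_map X euclideanreal f \<and> bounded (f ` topspace X) \<and> open U}"
  have "bounded ((\<lambda>_. 0::real) ` topspace X)"
    by (rule boundedI[of _ 0]) auto
  then have "{\<mu> \<in> borel_probs X. (\<integral>x. 0 \<partial>\<mu>) \<in> (UNIV :: real set)} \<in> ?S"
    by (intro CollectI exI[of _ "\<lambda>_. 0::real"] exI[of _ "UNIV :: real set"] conjI refl) auto
  then have "borel_probs X \<in> ?S" by simp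
  then have "borel_probs X \<subseteq> \<Union>?S" by (rule Union_upper)
  moreover have "\<Union>?S \<subseteq> borel_probs X" by (rule Union_least) auto
  ultimately show ?thesis unfolding weak_topology_def topology_generated_by_topspace by (rule equalityI[rotated])
qed

lemma continuous_map_weak_integral:
  assumes "continuous_map X euclideanreal f" "bounded (f ` topspace X)"
  shows "continuous_map (weak_topology X) euclideanreal (\<lambda>\<mu>. \<integral>x. f x \<partial>\<mu>)"
  unfolding continuous_map_alt
proof (intro conjI strip)
  fix U :: "real set" assume "openin euclideanreal U"
  then have "openin (weak_topology X) {\<mu> \<in> borel_probs X. (\<integral>x. f x \<partial>\<mu>) \<in> U}"
    unfolding weak_topology_def using assms by (intro topology_generated_by_Basis) auto
  moreover have "{\<mu> \<in> borel_probs X. (\<integral>x. f x \<partial>\<mu>) \<in> U} =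
      (\<lambda>\<mu>. \<integral>x. f x \<partial>\<mu>) -` U \<inter> topspace (weak_topology X)"
    by (auto simp: topspace_weak_topology)
  ultimately show "openin (weak_topology X) ((\<lambda>\<mu>. \<integral>x. f x \<partial>\<mu>) -` U \<inter> topspace (weak_topology X))"
    by simp
qed auto

lemma sum_abs_less_D:
  fixes a b c d e :: real
  assumes "\<bar>a - b\<bar> + \<bar>c - d\<bar> < e" shows "b - a < e" "d - c < e"
  using assms by linarith+

lemma embeddable_weak:
  assumes "embeddable X" shows "embeddable (weak_topology X)"
proof -
  obtain H where H: "lsc_fam H X" using embeddable_lsc_fam[OF assms] .
  define G where "G = (\<lambda>h \<mu>. \<integral>x. h x \<partial>\<mu>) ` H"
  have basic: "nbd G (weak_topology X) \<mu> {\<mu> \<in> borel_probs X. (\<integral>x. f x \<partial>\<mu>) \<in> U}"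
    if f: "continuous_map X euclideanreal f" "bounded (f ` topspace X)" and U: "open U"
      and \<mu>: "\<mu> \<in> borel_probs X" "(\<integral>x. f x \<partial>\<mu>) \<in> U" for f U \<mu>
  proof -
    obtain \<epsilon> where \<epsilon>: "\<epsilon> > 0" "\<And>t. \<bar>t - (\<integral>x. f x \<partial>\<mu>)\<bar> < \<epsilon> \<Longrightarrow> t \<in> U"
      using U \<mu>(2) unfolding open_dist dist_real_def by blast
    obtain B where B: "\<And>y. y \<in> topspace X \<Longrightarrow> \<bar>f y\<bar> \<le> B"
      using f(2) by (auto simp: bounded_iff)
    define p where "p = (\<lambda>y. f y + B)"
    define n where "n = (\<lambda>y. B - f y)"
    have p: "lsc_on X p" "\<And>y. y \<in> topspace X \<Longrightarrow> 0 \<le> p y" "\<And>y. y \<in> topspace X \<Longrightarrow> p y \<le> 2 * B"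
      and n: "lsc_on X n" "\<And>y. y \<in> topspace X \<Longrightarrow> 0 \<le> n y" "\<And>y. y \<in> topspace X \<Longrightarrow> n y \<le> 2 * B"
      using B f(1) unfolding p_def n_def
      by (fastforce intro!: lsc_on_continuous continuous_intros simp: abs_le_iff)+
    have int: "(\<integral>y. p y \<partial>\<nu>) = (\<integral>y. f y \<partial>\<nu>) + B" "(\<integral>y. n y \<partial>\<nu>) = B - (\<integral>y. f y \<partial>\<nu>)"
      if \<nu>: "\<nu> \<in> borel_probs X" for \<nu>
    proof -
      interpret prob_space \<nu> using borel_probs_D(1)[OF \<nu>] .
      have "integrable \<nu> f" using integrable_lsc[OF \<nu> lsc_on_continuous[OF f(1)] B] by blast
      then show "(\<integral>y. p y \<partial>\<nu>) = (\<integral>y. f y \<partial>\<nu>) + B" "(\<integral>y. n y \<partial>\<nu>) = B - (\<integral>y. f y \<partial>\<nu>)"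
        unfolding p_def n_def by (simp_all add: prob_space)
    qed
    obtain h1 where h1: "h1 \<in> H" "\<forall>y\<in>topspace X. h1 y \<le> p y" "(\<integral>y. p y \<partial>\<mu>) - \<epsilon> / 2 < (\<integral>y. h1 y \<partial>\<mu>)"
      using lsc_fam_approx[OF H \<mu>(1) p, of "(\<integral>y. p y \<partial>\<mu>) - \<epsilon> / 2"] \<epsilon>(1) by auto
    obtain h2 where h2: "h2 \<in> H" "\<forall>y\<in>topspace X. h2 y \<le> n y" "(\<integral>y. n y \<partial>\<mu>) - \<epsilon> / 2 < (\<integral>y. h2 y \<partial>\<mu>)"
      using lsc_fam_approx[OF H \<mu>(1) n, of "(\<integral>y. n y \<partial>\<mu>) - \<epsilon> / 2"] \<epsilon>(1) by auto
    let ?L = "[\<lambda>\<mu>. \<integral>y. h1 y \<partial>\<mu>, \<lambda>\<mu>. \<integral>y. h2 y \<partial>\<mu>]"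
    have "(\<integral>x. f x \<partial>\<nu>) \<in> U" if \<nu>: "\<nu> \<in> borel_probs X"
      and d: "(\<Sum>\<phi>\<leftarrow>?L. \<bar>\<phi> \<nu> - \<phi> \<mu>\<bar>) < \<epsilon> / 2" for \<nu>
    proof (rule \<epsilon>(2))
      have "(\<integral>y. h1 y \<partial>\<nu>) \<le> (\<integral>y. p y \<partial>\<nu>)" "(\<integral>y. h2 y \<partial>\<nu>) \<le> (\<integral>y. n y \<partial>\<nu>)"
        using lsc_fam_le[OF H \<nu> h1(1) p h1(2)] lsc_fam_le[OF H \<nu> h2(1) n h2(2)] by auto
      moreover have "(\<integral>y. h1 y \<partial>\<mu>) - (\<integral>y. h1 y \<partial>\<nu>) < \<epsilon> / 2"
        "(\<integral>y. h2 y \<partial>\<mu>) - (\<integral>y. h2 y \<partial>\<nu>) < \<epsilon> / 2"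
        by (rule sum_abs_less_D, use d in simp)+
      ultimately have "(\<integral>x. f x \<partial>\<nu>) - (\<integral>x. f x \<partial>\<mu>) < \<epsilon>"
        "(\<integral>x. f x \<partial>\<mu>) - (\<integral>x. f x \<partial>\<nu>) < \<epsilon>"
        using h1(3) h2(3) int[OF \<mu>(1)] int[OF \<nu>] by linarith+
      then show "\<bar>(\<integral>x. f x \<partial>\<nu>) - (\<integral>x. f x \<partial>\<mu>)\<bar> < \<epsilon>"
        by (simp add: abs_less_iff)
    qed
    moreover have "set ?L \<subseteq> G" using h1(1) h2(1) by (auto simp: G_def)
    ultimately show ?thesis unfolding nbd_def topspace_weak_topology using \<epsilon>(1)
      by (intro exI[of _ ?L] exI[of _ "\<epsilon> / 2"]) auto
  qed
  have "gen_fam G (weak_topology X)"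
    unfolding gen_fam_def
  proof (intro conjI ballI allI impI)
    show "countable G" unfolding G_def using H by (simp add: lsc_fam_def)
  next
    fix \<psi> assume "\<psi> \<in> G"
    then show "continuous_map (weak_topology X) euclideanreal \<psi>"
      unfolding G_def using lsc_fam_D(4,5)[OF H] by (auto intro: continuous_map_weak_integral)
  next
    fix \<mu> \<nu> assume "\<mu> \<in> topspace (weak_topology X)" "\<nu> \<in> topspace (weak_topology X)"
      "\<forall>\<psi>\<in>G. \<psi> \<mu> = \<psi> \<nu>"
    then show "\<mu> = \<nu>" unfolding topspace_weak_topology G_def
      by (intro lsc_fam_separates[OF H]) auto
  next
    fix U \<mu> assume "openin (weak_topology X) U" "\<mu> \<in> U"
    then have "generate_topology_on {{\<mu> \<in> borel_probs X. (\<integral>x. f x \<partial>\<mu>) \<in> U} | f U.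
        continuous_map X euclideanreal f \<and> bounded (f ` topspace X) \<and> open U} U"
      unfolding weak_topology_def by (simp add: openin_topology_generated_by)
    then show "nbd G (weak_topology X) \<mu> U" using \<open>\<mu> \<in> U\<close>
    proof (induction arbitrary: \<mu>)
      case (Int a b) then show ?case by (auto intro: nbd_Int)
    next
      case (UN K) then show ?case by (meson UnionE Union_upper nbd_mono)
    next
      case (Basis s) then show ?case using basic by blast
    qed simp
  qed
  then show ?thesis unfolding embeddable_def by blast
qed

lemma embeddable_init_space: "embeddable (init_space k r)"
  unfolding init_space_def
  by (intro embeddable_prod embeddable_product embeddable_real countable_finite)
    (auto simp: pairs_def)

lemma embeddable_wl_P: "embeddable (wl_P k r s)"
proof (induction s rule: less_induct)
  case (less s)
  show ?case
  proof (cases s)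
    case 0
    then show ?thesis by (simp add: embeddable_recode embeddable_init_space)
  next
    case (Suc t)
    have "embeddable (wl_M k r t)" unfolding wl_M_def
      by (intro embeddable_product less) (auto simp: Suc)
    then show ?thesis unfolding Suc wl_P_Suc refine_space_def
      by (intro embeddable_recode embeddable_product embeddable_weak) auto
  qed
qed

lemma embeddable_wl_M: "embeddable (wl_M k r s)"
  unfolding wl_M_def by (intro embeddable_product embeddable_wl_P) auto

lemma embeddable_refine_space: "embeddable (refine_space k (wl_M k r s))"
  unfolding refine_space_def by (intro embeddable_product embeddable_weak embeddable_wl_M) auto

lemma homeomorphic_wl_P_0:
  "homeomorphic_map (init_space k r) (wl_P k r 0) (code (init_space k r))"
  using homeomorphic_map_recode[OF embeddable_init_space] by simp

lemma homeomorphic_wl_P_Suc: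
  "homeomorphic_map (refine_space k (wl_M k r s)) (wl_P k r (Suc s))
     (code (refine_space k (wl_M k r s)))"
  unfolding wl_P_Suc by (rule homeomorphic_map_recode[OF embeddable_refine_space])

end

(*
  Every k-WL color determines the values of all terms built from the functions W(x_i, x_j) and
  f(x_j) on [0,1]^k by multiplication and by integrating out one of the k variables: an integral is
  read off the measure component of the next level.  Conversely the terms generate the Borel
  sigma-algebra of the color space.  By induction on the level, the terms of level <= s form a
  multiplicative family of bounded functions that generates the sigma-algebra, so by Weierstrass and
  Dynkin a measure on colors depends measurably on its integrals over these terms.  Hence, terms
  being closed under products, the k-WL distribution is determined by the integrals of the terms.

  These integrals are precisely the densities of multigraphs of treewidth < k.  A term is a graph
  glued together along bags of k labelled vertices, where integrating out a variable moves its label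
  to a fresh vertex.  Conversely, colour the vertices of a graph of treewidth < k with k colors that
  are distinct on every bag and integrate out vertices one at a time, each time pushing the result
  into the parent bag.
*)
theory Submission
  imports Defs
begin

section \<open>Borel \<sigma>-algebras of embeddable spaces\<close>

text \<open>The color space is a full product: its points need not be colors of any graphon-signal,
  and the measures that such a point stores at different levels need not be compatible. An integral
  read off at level 1 and the same integral read off at level 2 are then different functions on the
  space, although they agree on actual colors. Terms therefore carry a padding number that selects
  the level, and only with all paddings do they generate the Borel sigma-algebra. As a color of
  level s + 1 is itself a tuple of measures, uniqueness of a measure with given integrals is too
  weak for the induction; measurable dependence is needed, so the Weierstrass-Dynkin argument is
  carried out for kernels. There is a further circle: the pushforward \<open>distr\<close> is the
  intended measure only if the color map of the previous level is measurable, which in turn is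
  deduced from its observables being values of terms. Both facts are proved together, level by
  level. Signals are bounded only almost everywhere, whereas values of terms have to match colors at
  every point; hence all work is done for clipped signals.\<close>

lemma lsc_on_indicator:
  assumes U: "openin X U" shows "lsc_on X (indicator U)"
  unfolding lsc_on_def
proof
  fix c :: real
  have "{y \<in> topspace X. c < indicator U y} = (if c < 0 then topspace X else if c < 1 then U else {})"
    using openin_subset[OF U] by (auto simp: indicator_def split: if_splits)
  then show "openin X {y \<in> topspace X. c < indicator U y}" using U by auto
qed

text \<open>Below the indicator of an open set, the countable family \<open>H\<close> has a function
  that is positive at any prescribed point of that set. So the sets where members of
  \<open>H\<close> are positive form a base.\<close>

lemma second_countable_embeddable:
  assumes "embeddable X" shows "second_countable X"
proof -
  obtain H where H: "lsc_fam H X" using embeddable_lsc_fam[OF assms] .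
  define B where "B = (\<lambda>h. {y \<in> topspace X. 0 < h y}) ` H"
  have "\<exists>V\<in>B. x \<in> V \<and> V \<subseteq> U" if U: "openin X U" and x: "x \<in> U" for U x
  proof -
    have sub: "U \<subseteq> topspace X" using U openin_subset by blast
    obtain h where h: "h \<in> H" "\<forall>y\<in>topspace X. h y \<le> indicator U y" "0 < h x"
      using lsc_fam_D3[OF H lsc_on_indicator[OF U], of x 0] x sub by (auto simp: indicator_def)
    have "y \<in> U" if "y \<in> topspace X" "0 < h y" for y
      using bspec[OF h(2) that(1)] that(2) by (cases "y \<in> U") auto
    then have "{y \<in> topspace X. 0 < h y} \<subseteq> U" by blast
    moreover have "x \<in> {y \<in> topspace X. 0 < h y}" using h(3) x sub by auto
    moreover have "{y \<in> topspace X. 0 < h y} \<in> B" unfolding B_def using h(1) by (rule imageI)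
    ultimately show ?thesis by metis
  qed
  moreover have "countable B" unfolding B_def using lsc_fam_D2(1)[OF H] by simp
  moreover have "openin X V" if "V \<in> B" for V
    using that lsc_fam_D(1)[OF H] unfolding B_def lsc_on_def by auto
  ultimately show ?thesis unfolding second_countable_def by blast
qed

text \<open>Second countability makes a local check suffice: \<open>U\<close> is covered by the
  countably many basic sets that fit into some neighbourhood \<open>C\<close> with measurable
  preimage. Arbitrary unions in a generated topology then cause no trouble.\<close>

lemma measurable_borel_ofI:
  assumes X: "embeddable X" and G: "G \<in> space N \<rightarrow> topspace X"
    and nb: "\<And>U x. openin X U \<Longrightarrow> x \<in> U \<Longrightarrow>
      \<exists>C. openin X C \<and> C \<subseteq> U \<and> x \<in> C \<and> G -` C \<inter> space N \<in> sets N"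
  shows "G \<in> N \<rightarrow>\<^sub>M borel_of X"
proof -
  obtain B where B: "countable B" "\<And>U x. openin X U \<Longrightarrow> x \<in> U \<Longrightarrow> \<exists>V\<in>B. x \<in> V \<and> V \<subseteq> U"
    using second_countable_embeddable[OF X] unfolding second_countable_def by metis
  have "G -` U \<inter> space N \<in> sets N" if U: "openin X U" for U
  proof -
    let ?ok = "\<lambda>V C. V \<subseteq> C \<and> C \<subseteq> U \<and> G -` C \<inter> space N \<in> sets N"
    \<comment> \<open>Nothing is known about preimages of the basic sets themselves; each serves
      only as an index for a good set \<open>C\<close> around it.\<close>
    define B' where "B' = {V \<in> B. \<exists>C. ?ok V C}"
    have "\<exists>c. \<forall>V\<in>B'. ?ok V (c V)" unfolding B'_def by (intro bchoice) auto
    then obtain c where c: "\<And>V. V \<in> B' \<Longrightarrow> ?ok V (c V)" by blast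
    have "\<exists>V\<in>B'. x \<in> V" if x: "x \<in> U" for x
    proof -
      obtain C where C: "openin X C" "C \<subseteq> U" "x \<in> C" "G -` C \<inter> space N \<in> sets N"
        using nb[OF U x] by blast
      obtain V where "V \<in> B" "x \<in> V" "V \<subseteq> C" using B(2)[OF C(1,3)] by blast
      then show ?thesis using C unfolding B'_def by blast
    qed
    then have "G -` U \<inter> space N = (\<Union>V\<in>B'. G -` c V \<inter> space N)"
      using c by (intro equalityI subsetI) (fastforce, auto)
    moreover have "countable B'" unfolding B'_def using B(1) by simp
    moreover have "(\<Union>V\<in>B'. G -` c V \<inter> space N) \<in> sets N"
      using c \<open>countable B'\<close> by (intro sets.countable_UN'') simp_all
    ultimately show ?thesis by simp
  qed
  moreover have "{U. openin X U} \<subseteq> Pow (topspace X)" by (auto dest: openin_subset)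
  ultimately show ?thesis unfolding borel_of_def using G by (intro measurable_measure_of) simp_all
qed

section \<open>Borel measurability of maps into products and subspaces\<close>

lemma measurable_borel_of_continuous:
  assumes "continuous_map X Y \<phi>" shows "\<phi> \<in> borel_of X \<rightarrow>\<^sub>M borel_of Y"
  unfolding borel_of_def[of Y]
proof (rule measurable_measure_of)
  show "{U. openin Y U} \<subseteq> Pow (topspace Y)" using openin_subset by blast
  show "\<phi> \<in> space (borel_of X) \<rightarrow> topspace Y"
    using continuous_map_funspace[OF assms] by (simp add: borel_of_simps)
  fix U assume "U \<in> {U. openin Y U}"
  then have "openin X {x \<in> topspace X. \<phi> x \<in> U}"
    using openin_continuous_map_preimage[OF assms] by simp
  then show "\<phi> -` U \<inter> space (borel_of X) \<in> sets (borel_of X)"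
    by (auto simp: borel_of_simps vimage_def Int_def conj_commute intro: sigma_sets.Basic)
qed

lemma borel_of_euclideanreal: "borel_of euclideanreal = borel"
  by (simp add: borel_of_def borel_def)

lemma borel_measurable_borel_of_continuous:
  "continuous_map X euclideanreal \<phi> \<Longrightarrow> \<phi> \<in> borel_measurable (borel_of X)"
  using measurable_borel_of_continuous[of X euclideanreal \<phi>] by (simp add: borel_of_euclideanreal)

lemma openin_sets_borel_of: "openin X U \<Longrightarrow> U \<in> sets (borel_of X)"
  by (auto simp: borel_of_simps intro: sigma_sets.Basic)

lemma measurable_vimage_open:
  "G \<in> N \<rightarrow>\<^sub>M borel_of X \<Longrightarrow> openin X U \<Longrightarrow> G -` U \<inter> space N \<in> sets N"
  by (rule measurable_sets[OF _ openin_sets_borel_of])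

text \<open>A basic box restricts only finitely many coordinates, so its preimage is a finite
  intersection of measurable sets, and boxes suffice by the local criterion.\<close>

lemma measurable_borel_of_product:
  assumes I: "countable I" "\<And>i. i \<in> I \<Longrightarrow> embeddable (X i)"
    and G: "G \<in> space N \<rightarrow> topspace (product_topology X I)"
    and Gi: "\<And>i. i \<in> I \<Longrightarrow> (\<lambda>x. G x i) \<in> N \<rightarrow>\<^sub>M borel_of (X i)"
  shows "G \<in> N \<rightarrow>\<^sub>M borel_of (product_topology X I)"
proof (rule measurable_borel_ofI[OF embeddable_product[OF I] G])
  fix U x assume U: "openin (product_topology X I) U" "x \<in> U"
  obtain A where A: "x \<in> (\<Pi>\<^sub>E i\<in>I. A i)" "\<And>i. openin (X i) (A i)"
      "finite {i. A i \<noteq> topspace (X i)}" "(\<Pi>\<^sub>E i\<in>I. A i) \<subseteq> U"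
    using product_topology_open_contains_basis[OF U] by blast
  define J where "J = {i\<in>I. A i \<noteq> topspace (X i)}"
  have "finite J" unfolding J_def by (rule finite_subset[OF _ A(3)]) auto
  have AA: "G x i \<in> A i \<longleftrightarrow> G x i \<in> topspace (X i)" if "i \<in> I - J" for i x
    using that by (auto simp: J_def)
  have "G -` (\<Pi>\<^sub>E i\<in>I. A i) \<inter> space N = {x \<in> space N. \<forall>i\<in>J. G x i \<in> A i}"
  proof (intro equalityI subsetI)
    fix y assume "y \<in> {x \<in> space N. \<forall>i\<in>J. G x i \<in> A i}"
    then have y: "y \<in> space N" "\<And>i. i \<in> J \<Longrightarrow> G y i \<in> A i" by auto
    have "G y \<in> topspace (product_topology X I)" using G y by blast
    then have *: "G y \<in> (\<Pi>\<^sub>E i\<in>I. topspace (X i))" by simp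
    have "G y i \<in> A i" if i: "i \<in> I" for i
      using y(2)[of i] AA[of i y] PiE_mem[OF * i] i by blast
    then show "y \<in> G -` (\<Pi>\<^sub>E i\<in>I. A i) \<inter> space N" using y(1) * by (auto simp: PiE_iff)
  qed (auto simp: J_def)
  moreover have "{x \<in> space N. \<forall>i\<in>J. G x i \<in> A i} \<in> sets N"
  proof (rule sets.sets_Collect_finite_All[OF _ \<open>finite J\<close>])
    fix i assume "i \<in> J"
    then have "(\<lambda>x. G x i) -` A i \<inter> space N \<in> sets N"
      by (intro measurable_vimage_open[OF Gi A(2)]) (simp add: J_def)
    then show "{x \<in> space N. G x i \<in> A i} \<in> sets N" by (simp add: vimage_def Int_def conj_commute)
  qed
  moreover have "openin (product_topology X I) (\<Pi>\<^sub>E i\<in>I. A i)"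
    using A(2) \<open>finite J\<close> unfolding openin_PiE_gen J_def by simp
  ultimately show "\<exists>C. openin (product_topology X I) C \<and> C \<subseteq> U \<and> x \<in> C \<and> G -` C \<inter> space N \<in> sets N"
    using A(1,4) by metis
qed

lemma measurable_borel_of_prod:
  assumes "embeddable X" "embeddable Y"
    and fst: "(\<lambda>x. fst (G x)) \<in> N \<rightarrow>\<^sub>M borel_of X" and snd: "(\<lambda>x. snd (G x)) \<in> N \<rightarrow>\<^sub>M borel_of Y"
  shows "G \<in> N \<rightarrow>\<^sub>M borel_of (prod_topology X Y)"
proof (rule measurable_borel_ofI[OF embeddable_prod[OF assms(1,2)]])
  show "G \<in> space N \<rightarrow> topspace (prod_topology X Y)"
    using measurable_space[OF fst] measurable_space[OF snd]
    by (auto simp: borel_of_simps mem_Times_iff)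
  fix U x assume U: "openin (prod_topology X Y) U" "x \<in> U"
  obtain A B where AB: "openin X A" "openin Y B" "fst x \<in> A" "snd x \<in> B" "A \<times> B \<subseteq> U"
    using U(1)[unfolded openin_prod_topology_alt, rule_format, of "fst x" "snd x"] U(2) by auto
  have "G -` (A \<times> B) \<inter> space N =
      ((\<lambda>x. fst (G x)) -` A \<inter> space N) \<inter> ((\<lambda>x. snd (G x)) -` B \<inter> space N)"
    by (auto simp: mem_Times_iff)
  then have "G -` (A \<times> B) \<inter> space N \<in> sets N"
    using measurable_vimage_open[OF fst AB(1)] measurable_vimage_open[OF snd AB(2)] by auto
  moreover have "openin (prod_topology X Y) (A \<times> B)"
    using AB by (simp add: openin_prod_Times_iff)
  ultimately show "\<exists>C. openin (prod_topology X Y) C \<and> C \<subseteq> U \<and> x \<in> C \<and> G -` C \<inter> space N \<in> sets N"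
    using AB by (intro exI[of _ "A \<times> B"]) (auto simp: mem_Times_iff)
qed

lemma measurable_borel_of_subspace:
  fixes G :: "'a \<Rightarrow> real"
  assumes "G \<in> borel_measurable N" "\<And>x. x \<in> space N \<Longrightarrow> G x \<in> S"
  shows "G \<in> N \<rightarrow>\<^sub>M borel_of (top_of_set S)"
  unfolding borel_of_def
proof (rule measurable_measure_of)
  show "{U. openin (top_of_set S) U} \<subseteq> Pow (topspace (top_of_set S))" using openin_subset by blast
  show "G \<in> space N \<rightarrow> topspace (top_of_set S)" using assms(2) by auto
  fix U assume "U \<in> {U. openin (top_of_set S) U}"
  then obtain T where T: "open T" "U = S \<inter> T" by (auto simp: openin_open)
  have "G -` U \<inter> space N = G -` T \<inter> space N" using assms(2) T by auto
  then show "G -` U \<inter> space N \<in> sets N" using assms(1) T(1) by (simp add: measurable_sets_borel[OF _ borel_open] measurable_sets)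
qed

section \<open>The weak topology and the Giry sigma-algebra\<close>

lemma space_prob_algebra_borel_of: "space (prob_algebra (borel_of X)) = borel_probs X"
  by (auto simp: space_prob_algebra borel_probs_def)

text \<open>Integration of a bounded continuous function is measurable on
  \<open>prob_algebra\<close>, so subbasic sets have measurable preimages. Together with
  \<open>measurable_weak_prob_algebra\<close> this identifies the Borel sets of the weak topology
  with the measurable sets of \<open>prob_algebra\<close>.\<close>

lemma measurable_borel_of_weak:
  assumes X: "embeddable X" and G: "G \<in> N \<rightarrow>\<^sub>M prob_algebra (borel_of X)"
  shows "G \<in> N \<rightarrow>\<^sub>M borel_of (weak_topology X)"
proof (rule measurable_borel_ofI[OF embeddable_weak[OF X]])
  have sp: "G \<in> space N \<rightarrow> borel_probs X"
    using measurable_space[OF G] by (auto simp: space_prob_algebra_borel_of)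
  then show "G \<in> space N \<rightarrow> topspace (weak_topology X)" by (simp add: topspace_weak_topology)
  let ?S = "{{\<mu> \<in> borel_probs X. (\<integral>x. f x \<partial>\<mu>) \<in> U} | f U.
      continuous_map X euclideanreal f \<and> bounded (f ` topspace X) \<and> open U}"
  fix U \<mu> assume U: "openin (weak_topology X) U" "\<mu> \<in> U"
  then have "generate_topology_on ?S U"
    unfolding weak_topology_def by (simp add: openin_topology_generated_by)
  then show "\<exists>C. openin (weak_topology X) C \<and> C \<subseteq> U \<and> \<mu> \<in> C \<and> G -` C \<inter> space N \<in> sets N"
    using U(2)
  proof (induction arbitrary: \<mu>)
    case (Int a b)
    from Int.IH(1)[of \<mu>] Int.prems obtain C where C: "openin (weak_topology X) C" "C \<subseteq> a" "\<mu> \<in> C"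
      "G -` C \<inter> space N \<in> sets N" by blast
    from Int.IH(2)[of \<mu>] Int.prems obtain D where D: "openin (weak_topology X) D" "D \<subseteq> b" "\<mu> \<in> D"
      "G -` D \<inter> space N \<in> sets N" by blast
    have "G -` (C \<inter> D) \<inter> space N = (G -` C \<inter> space N) \<inter> (G -` D \<inter> space N)" by auto
    with C D show ?case by (intro exI[of _ "C \<inter> D"]) auto
  next
    case (UN K) then show ?case by (meson UnionE Union_upper subset_trans)
  next
    case (Basis s)
    then obtain f U where f: "continuous_map X euclideanreal f" "bounded (f ` topspace X)" "open U"
      "s = {\<mu> \<in> borel_probs X. (\<integral>x. f x \<partial>\<mu>) \<in> U}" by blast
    have "(\<lambda>\<mu>. \<integral>x. f x \<partial>\<mu>) \<in> borel_measurable (subprob_algebra (borel_of X))"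
      by (rule integral_measurable_subprob_algebra[OF borel_measurable_borel_of_continuous[OF f(1)]])
    then have "(\<lambda>x. \<integral>y. f y \<partial>G x) \<in> borel_measurable N"
      using measurable_prob_algebraD[OF G] by (rule measurable_compose[rotated])
    then have "(\<lambda>x. \<integral>y. f y \<partial>G x) -` U \<inter> space N \<in> sets N" using f(3) by (simp add: measurable_sets)
    moreover have "(\<lambda>x. \<integral>y. f y \<partial>G x) -` U \<inter> space N = G -` s \<inter> space N" using sp f(4) by auto
    moreover have "openin (weak_topology X) s"
      unfolding weak_topology_def using Basis by (intro topology_generated_by_Basis)
    ultimately show ?case using Basis by (intro exI[of _ s]) auto
  qed auto
qed

text \<open>A portmanteau argument: for open \<open>U\<close>, the mass of \<open>U\<close> is the
  supremum of the weakly continuous integrals of those functions of \<open>H\<close> that lie below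
  the indicator, hence lower semicontinuous in the measure. Open sets are stable under intersection,
  so it is enough to evaluate at them.\<close>

lemma measurable_weak_prob_algebra:
  assumes X: "embeddable X"
  shows "(\<lambda>\<mu>. \<mu>) \<in> borel_of (weak_topology X) \<rightarrow>\<^sub>M prob_algebra (borel_of X)"
proof (rule measurable_prob_algebra_generated[OF borel_of_simps(2)])
  show "Int_stable {U. openin X U}" by (auto simp: Int_stable_def)
  show "{U. openin X U} \<subseteq> Pow (topspace X)" by (auto dest: openin_subset)
  fix \<mu> assume "\<mu> \<in> space (borel_of (weak_topology X))"
  then have \<mu>: "\<mu> \<in> borel_probs X" by (simp add: borel_of_simps topspace_weak_topology)
  show "prob_space \<mu>" "sets \<mu> = sets (borel_of X)" using \<mu> by (auto simp: borel_probs_def)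
next
  obtain H where H: "lsc_fam H X" using embeddable_lsc_fam[OF X] .
  fix U assume "U \<in> {U. openin X U}"
  then have U: "openin X U" by simp
  let ?f = "indicator U :: _ \<Rightarrow> real"
  have sub: "U \<subseteq> topspace X" using U openin_subset by blast
  have lsc: "lsc_on X ?f" by (rule lsc_on_indicator[OF U])
  have m: "(\<integral>y. ?f y \<partial>\<mu>) = measure \<mu> U" if "\<mu> \<in> borel_probs X" for \<mu>
    using sub borel_probs_D(2)[OF that] by (simp add: Int_absorb2)
  define K where "K = {h \<in> H. \<forall>y\<in>topspace X. h y \<le> ?f y}"
  have "(\<lambda>\<mu>. measure \<mu> U) \<in> borel_measurable (borel_of (weak_topology X))"
  proof (rule borel_measurableI_greater)
    fix a :: real
    have "{\<mu> \<in> borel_probs X. a < measure \<mu> U} =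
        (\<Union>h\<in>K. {\<mu> \<in> borel_probs X. a < (\<integral>y. h y \<partial>\<mu>)})" (is "?L = ?R")
    proof (intro equalityI subsetI)
      fix \<mu> assume "\<mu> \<in> ?L"
      then have \<mu>: "\<mu> \<in> borel_probs X" "a < (\<integral>y. ?f y \<partial>\<mu>)" using m by auto
      then show "\<mu> \<in> ?R"
        using lsc_fam_approx[OF H \<mu>(1) lsc, of 1 a] by (auto simp: K_def)
    next
      fix \<mu> assume "\<mu> \<in> ?R"
      then obtain h where h: "h \<in> K" "\<mu> \<in> borel_probs X" "a < (\<integral>y. h y \<partial>\<mu>)" by auto
      then have "(\<integral>y. h y \<partial>\<mu>) \<le> (\<integral>y. ?f y \<partial>\<mu>)"
        by (intro lsc_fam_le[OF H h(2) _ lsc, of h 1]) (auto simp: K_def indicator_def)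
      then show "\<mu> \<in> ?L" using h m by auto
    qed
    moreover have "openin (weak_topology X) ?R"
    proof (rule openin_Union)
      fix S assume "S \<in> (\<lambda>h. {\<mu> \<in> borel_probs X. a < (\<integral>y. h y \<partial>\<mu>)}) ` K"
      then obtain h where h: "h \<in> K" and S: "S = {\<mu> \<in> borel_probs X. a < (\<integral>y. h y \<partial>\<mu>)}" by blast
      have "continuous_map (weak_topology X) euclideanreal (\<lambda>\<mu>. \<integral>y. h y \<partial>\<mu>)"
        using h by (intro continuous_map_weak_integral lsc_fam_D(4,5)[OF H]) (auto simp: K_def)
      from openin_continuous_map_preimage[OF this, of "{a<..}"]
      show "openin (weak_topology X) S"
        by (simp add: topspace_weak_topology S)
    qed
    ultimately show "{\<mu> \<in> space (borel_of (weak_topology X)). a < measure \<mu> U}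
        \<in> sets (borel_of (weak_topology X))"
      by (simp add: borel_of_simps(1) topspace_weak_topology openin_sets_borel_of)
  qed
  then have "(\<lambda>\<mu>. ennreal (measure \<mu> U)) \<in> borel_measurable (borel_of (weak_topology X))" by measurable
  moreover have "emeasure \<mu> U = ennreal (measure \<mu> U)"
    if "\<mu> \<in> space (borel_of (weak_topology X))" for \<mu>
  proof -
    interpret prob_space \<mu>
      using that by (auto simp: borel_of_simps(1) topspace_weak_topology borel_probs_def)
    show ?thesis by (rule emeasure_eq_measure)
  qed
  ultimately show "(\<lambda>\<mu>. emeasure \<mu> U) \<in> borel_measurable (borel_of (weak_topology X))"
    by (subst measurable_cong) auto
qed


section \<open>Multiplicative families of functions\<close>

lemma power_mult_mem:
  assumes "\<And>g h. g \<in> H \<Longrightarrow> h \<in> H \<Longrightarrow> (\<lambda>x. g x * h x :: real) \<in> H" "g \<in> H" "h \<in> H"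
  shows "(\<lambda>x. g x * h x ^ i) \<in> H"
proof (induction i)
  case (Suc i)
  have "(\<lambda>x. (g x * h x ^ i) * h x) \<in> H" using Suc assms(1,3) by blast
  then show ?case by (simp add: mult_ac)
qed (use assms(2) in simp)

text \<open>Integrals of polynomials in \<open>h\<close> reduce to integrals of members of a
  multiplicative family, which indicators do not belong to in general. The bound 2 is 1 for the ramp
  plus 1 for the Weierstrass error; it is uniform in \<open>n\<close>, as dominated convergence
  requires.\<close>

lemma indicator_limit_polynomials:
  fixes c B :: real
  obtains a :: "nat \<Rightarrow> nat \<Rightarrow> real" and d :: "nat \<Rightarrow> nat" where
    "\<And>n t. \<bar>t\<bar> \<le> B \<Longrightarrow> \<bar>\<Sum>i\<le>d n. a n i * t ^ i\<bar> \<le> 2"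
    "\<And>t. \<bar>t\<bar> \<le> B \<Longrightarrow> (\<lambda>n. \<Sum>i\<le>d n. a n i * t ^ i) \<longlonglongrightarrow> indicator {c<..} t"
proof -
  \<comment> \<open>For \<open>n > 0\<close> this is a ramp from 0 at \<open>c\<close> to 1 at
    \<open>c + 1/n\<close>. It vanishes at \<open>c\<close> for every \<open>n\<close>, so the limit
    is the indicator of the open ray.\<close>
  define \<psi> where "\<psi> n t = max 0 (min 1 (real n * (t - c)))" for n t
  have "\<exists>a d. \<forall>t\<in>{-B..B}. \<bar>\<psi> n t - (\<Sum>i\<le>d. a i * t ^ i)\<bar> < 1 / real (Suc n)" for n
  proof -
    have "continuous_on {-B..B} (\<psi> n)" unfolding \<psi>_def by (intro continuous_intros)
    then obtain g where g: "real_polynomial_function g"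
        "\<And>t. t \<in> {-B..B} \<Longrightarrow> \<bar>\<psi> n t - g t\<bar> < 1 / real (Suc n)"
      using Stone_Weierstrass_real_polynomial_function[of "{-B..B}" "\<psi> n" "1 / real (Suc n)"] by auto
    then show ?thesis unfolding real_polynomial_function_iff_sum by blast
  qed
  then obtain a d where ad: "\<And>n t. t \<in> {-B..B} \<Longrightarrow>
      \<bar>\<psi> n t - (\<Sum>i\<le>d n. a n i * t ^ i)\<bar> < 1 / real (Suc n)" by metis
  show ?thesis
  proof (rule that)
    fix n t assume "\<bar>t\<bar> \<le> B"
    then have "\<bar>\<psi> n t - (\<Sum>i\<le>d n. a n i * t ^ i)\<bar> < 1 / real (Suc n)" by (intro ad) auto
    moreover have "1 / real (Suc n) \<le> 1" "0 \<le> \<psi> n t" "\<psi> n t \<le> 1" by (auto simp: \<psi>_def)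
    ultimately show "\<bar>\<Sum>i\<le>d n. a n i * t ^ i\<bar> \<le> 2" by linarith
  next
    fix t assume t: "\<bar>t\<bar> \<le> B"
    have "(\<lambda>n. \<psi> n t) \<longlonglongrightarrow> indicator {c<..} t"
    proof (cases "t > c")
      case True
      obtain N :: nat where N: "1 / (t - c) < N" using reals_Archimedean2 by blast
      have "\<psi> n t = 1" if "n \<ge> N" for n
      proof -
        have "1 / (t - c) \<le> n" using N that by linarith
        then have "1 \<le> real n * (t - c)" using True by (simp add: field_simps)
        then show ?thesis by (simp add: \<psi>_def)
      qed
      then have "\<forall>\<^sub>F n in sequentially. \<psi> n t = indicator {c<..} t"
        using True by (auto simp: eventually_sequentially)
      then show ?thesis by (rule tendsto_eventually)
    next
      case False
      then have "min 1 (real n * (t - c)) \<le> 0" for n by (intro min.coboundedI2) (simp add: mult_nonneg_nonpos)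
      then have "\<psi> n t = 0" for n unfolding \<psi>_def by (simp add: max_absorb1)
      then show ?thesis using False by simp
    qed
    moreover have "(\<lambda>n. (\<Sum>i\<le>d n. a n i * t ^ i) - \<psi> n t) \<longlonglongrightarrow> 0"
    proof (rule Lim_null_comparison)
      show "\<forall>\<^sub>F n in sequentially. norm ((\<Sum>i\<le>d n. a n i * t ^ i) - \<psi> n t) \<le> 1 / real (Suc n)"
      proof (rule always_eventually, rule allI)
        fix n
        have "\<bar>\<psi> n t - (\<Sum>i\<le>d n. a n i * t ^ i)\<bar> < 1 / real (Suc n)" using t by (intro ad) auto
        then show "norm ((\<Sum>i\<le>d n. a n i * t ^ i) - \<psi> n t) \<le> 1 / real (Suc n)"
          by (simp add: abs_minus_commute)
      qed
      show "(\<lambda>n. 1 / real (Suc n)) \<longlonglongrightarrow> 0"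
        using LIMSEQ_inverse_real_of_nat by (simp add: inverse_eq_divide)
    qed
    ultimately show "(\<lambda>n. \<Sum>i\<le>d n. a n i * t ^ i) \<longlonglongrightarrow> indicator {c<..} t"
      using tendsto_add by fastforce
  qed
qed

text \<open>The indicator of \<open>c < h\<close> is a bounded limit of polynomials in
  \<open>h\<close>. So integrals of finite products of such indicators are limits of linear
  combinations of integrals of members of \<open>H\<close>, hence measurable in \<open>x\<close>.
  Finite intersections of these sets form a pi-system that generates \<open>M\<close>.\<close>

lemma measurable_kernel_multiplicative:
  fixes H :: "('a \<Rightarrow> real) set"
  assumes meas: "\<And>h. h \<in> H \<Longrightarrow> h \<in> borel_measurable M"
    and bdd: "\<And>h. h \<in> H \<Longrightarrow> \<exists>B. \<forall>x\<in>space M. \<bar>h x\<bar> \<le> B"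
    and one: "(\<lambda>_. 1) \<in> H"
    and mult: "\<And>g h. g \<in> H \<Longrightarrow> h \<in> H \<Longrightarrow> (\<lambda>x. g x * h x) \<in> H"
    and gen: "sets M \<subseteq> sigma_sets (space M) {{x \<in> space M. c < h x} | c h. h \<in> H}"
    and K: "\<And>x. x \<in> space N \<Longrightarrow> K x \<in> space (prob_algebra M)"
    and KH: "\<And>h. h \<in> H \<Longrightarrow> (\<lambda>x. \<integral>y. h y \<partial>K x) \<in> borel_measurable N"
  shows "K \<in> N \<rightarrow>\<^sub>M prob_algebra M"
proof -
  have Ks: "prob_space (K x)" "sets (K x) = sets M" "space (K x) = space M" if "x \<in> space N" for x
    using K[OF that] sets_eq_imp_space_eq[of "K x" M] by (auto simp: space_prob_algebra)
  have Kint: "integrable (K x) \<phi>" if "x \<in> space N" "\<phi> \<in> borel_measurable M"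
    "\<And>y. y \<in> space M \<Longrightarrow> \<bar>\<phi> y\<bar> \<le> B" for x B and \<phi> :: "'a \<Rightarrow> real"
  proof -
    interpret prob_space "K x" using Ks(1)[OF that(1)] .
    show ?thesis using that Ks[OF that(1)] 
      by (intro integrable_const_bound[of _ B]) (auto cong: measurable_cong_sets)
  qed
  define ind where "ind l y = (\<Prod>(h, c)\<leftarrow>l. indicator {c<..} (h y) :: real)"
    for l :: "(('a \<Rightarrow> real) \<times> real) list" and y
  have ind_bd: "0 \<le> ind l y \<and> ind l y \<le> 1" for l y
    unfolding ind_def by (induction l) (auto simp: indicator_def)
  have ind_meas: "ind l \<in> borel_measurable M" if "set l \<subseteq> H \<times> UNIV" for l
    using that
  proof (induction l)
    case Nil then show ?case by (simp add: ind_def)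
  next
    case (Cons p l)
    obtain h c where p: "p = (h, c)" by (cases p)
    have [measurable]: "h \<in> borel_measurable M" "ind l \<in> borel_measurable M"
      using Cons p by (auto intro: meas)
    have "ind (p # l) = (\<lambda>y. indicator {c<..} (h y) * ind l y)" by (auto simp: ind_def p)
    then show ?case by simp
  qed
  \<comment> \<open>The factor \<open>g\<close> is carried along because the induction step trades
    one indicator for powers of \<open>h\<close>, which \<open>g\<close> absorbs within
    \<open>H\<close>. The case \<open>g = 1\<close> is the one wanted.\<close>
  have main: "(\<lambda>x. \<integral>y. g y * ind l y \<partial>K x) \<in> borel_measurable N"
    if "set l \<subseteq> H \<times> UNIV" "g \<in> H" for l g
    using that
  proof (induction l arbitrary: g)
    case Nil
    then show ?case using KH by (simp add: ind_def)
  next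
    case (Cons p l)
    obtain h c where p: "p = (h, c)" by (cases p)
    have h: "h \<in> H" and l: "set l \<subseteq> H \<times> UNIV" and g: "g \<in> H" using Cons.prems p by auto
    obtain B where B: "\<And>y. y \<in> space M \<Longrightarrow> \<bar>h y\<bar> \<le> B" using bdd[OF h] by blast
    obtain C where C: "\<And>y. y \<in> space M \<Longrightarrow> \<bar>g y\<bar> \<le> C" using bdd[OF g] by blast
    obtain a d where ad: "\<And>n t. \<bar>t\<bar> \<le> B \<Longrightarrow> \<bar>\<Sum>i\<le>d n. a n i * t ^ i\<bar> \<le> 2"
      "\<And>t. \<bar>t\<bar> \<le> B \<Longrightarrow> (\<lambda>n. \<Sum>i\<le>(d n :: nat). a n i * t ^ i) \<longlonglongrightarrow> indicator {c<..} t"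
      by (rule indicator_limit_polynomials[of B c], rule that)
    have [measurable]: "h \<in> borel_measurable M" "g \<in> borel_measurable M" "ind l \<in> borel_measurable M"
      by (rule meas[OF h], rule meas[OF g], rule ind_meas[OF l])
    let ?p = "\<lambda>n y. (\<Sum>i\<le>d n. a n i * h y ^ i) * (g y * ind l y)"
    have gl: "\<bar>g y * ind l y\<bar> \<le> C" if "y \<in> space M" for y
      using C[OF that] ind_bd[of l y] by (auto simp: abs_mult intro: order_trans[OF mult_right_le_one_le])
    have "(\<lambda>n. \<integral>y. ?p n y \<partial>K x) \<longlonglongrightarrow> (\<integral>y. g y * ind (p # l) y \<partial>K x)" if x: "x \<in> space N" for x
    proof (rule integral_dominated_convergence[where w = "\<lambda>_. 2 * C"])
      interpret prob_space "K x" using Ks(1)[OF x] .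
      show "integrable (K x) (\<lambda>_. 2 * C)" by simp
      show "(\<lambda>y. g y * ind (p # l) y) \<in> borel_measurable (K x)"
        using ind_meas[of "p # l"] Cons.prems
        by (auto simp: Ks(2)[OF x] cong: measurable_cong_sets)
      show "?p n \<in> borel_measurable (K x)" for n
        using Ks(2)[OF x] by (auto cong: measurable_cong_sets)
      show "AE y in K x. (\<lambda>n. ?p n y) \<longlonglongrightarrow> g y * ind (p # l) y"
      proof (rule AE_I2)
        fix y assume "y \<in> space (K x)"
        then have "\<bar>h y\<bar> \<le> B" using B Ks(3)[OF x] by simp
        from tendsto_mult[OF ad(2)[OF this] tendsto_const[of "g y * ind l y"]]
        show "(\<lambda>n. ?p n y) \<longlonglongrightarrow> g y * ind (p # l) y" by (simp add: ind_def p mult_ac)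
      qed
      show "AE y in K x. norm (?p n y) \<le> 2 * C" for n
      proof (rule AE_I2)
        fix y assume "y \<in> space (K x)"
        then have y: "y \<in> space M" using Ks(3)[OF x] by simp
        show "norm (?p n y) \<le> 2 * C"
          using ad(1)[OF B[OF y], of n] gl[OF y] by (simp only: real_norm_def abs_mult[of "\<Sum>i\<le>d n. a n i * h y ^ i"]) (intro mult_mono, auto)
      qed
    qed
    moreover have "(\<lambda>x. \<integral>y. ?p n y \<partial>K x) \<in> borel_measurable N" for n
    proof -
      have "(\<integral>y. ?p n y \<partial>K x) = (\<Sum>i\<le>d n. a n i * (\<integral>y. (g y * h y ^ i) * ind l y \<partial>K x))"
        if x: "x \<in> space N" for x
      proof -
        have "?p n = (\<lambda>y. \<Sum>i\<le>d n. a n i * ((g y * h y ^ i) * ind l y))"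
          by (rule ext, simp only: sum_distrib_right, simp only: mult_ac)
        moreover have "integrable (K x) (\<lambda>y. (g y * h y ^ i) * ind l y)" for i
        proof (rule Kint[OF x, where B = "C * B ^ i"])
          fix y assume y: "y \<in> space M"
          have "0 \<le> C" using C[OF y] by linarith
          moreover have "\<bar>h y\<bar> ^ i \<le> B ^ i" by (rule power_mono[OF B[OF y]]) simp
          ultimately have "\<bar>g y * ind l y\<bar> * \<bar>h y\<bar> ^ i \<le> C * B ^ i"
            by (intro mult_mono[OF gl[OF y]]) simp_all
          then show "\<bar>(g y * h y ^ i) * ind l y\<bar> \<le> C * B ^ i"
            by (simp add: abs_mult power_abs mult_ac)
        qed simp
        ultimately show ?thesis by (simp only: Bochner_Integration.integral_sum integrable_mult_right integral_mult_right_zero)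
      qed
      moreover have "(\<lambda>x. \<Sum>i\<le>d n. a n i * (\<integral>y. (g y * h y ^ i) * ind l y \<partial>K x)) \<in> borel_measurable N"
        by (intro borel_measurable_sum borel_measurable_times borel_measurable_const
            Cons.IH[OF l power_mult_mem[OF mult g h]])
      ultimately show ?thesis by (simp cong: measurable_cong)
    qed
    ultimately show ?case by (rule borel_measurable_LIMSEQ_real)
  qed
  let ?E = "\<lambda>l. {x \<in> space M. \<forall>(h, c)\<in>set l. c < h x}"
  define E where "E = {?E l | l. set l \<subseteq> H \<times> UNIV}"
  have E_ind: "indicator (?E l) y = ind l y" if "y \<in> space M" for l y
  proof (induction l)
    case Nil
    then show ?case using that by (simp add: ind_def)
  next
    case (Cons p l)
    obtain h c where p: "p = (h, c)" by (cases p)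
    have "indicator (?E (p # l)) y = (indicator {c<..} (h y) * indicator (?E l) y :: real)"
      by (auto simp: indicator_def p)
    also have "\<dots> = ind (p # l) y" by (simp only: Cons.IH) (simp add: ind_def p)
    finally show ?case .
  qed
  have EM: "?E l \<in> sets M" if "set l \<subseteq> H \<times> UNIV" for l
  proof -
    have "{x \<in> space M. \<forall>p\<in>set l. snd p < fst p x} \<in> sets M"
    proof (rule sets.sets_Collect_finite_All)
      fix p assume "p \<in> set l"
      then have [measurable]: "fst p \<in> borel_measurable M" using that by (intro meas) auto
      show "{x \<in> space M. snd p < fst p x} \<in> sets M" by measurable
    qed simp
    then show ?thesis by (simp add: case_prod_beta)
  qed
  show ?thesis
  proof (rule measurable_prob_algebra_generated[where \<Omega> = "space M" and G = E])
    show "sets M = sigma_sets (space M) E"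
    proof
      have "{{x \<in> space M. c < h x} | c h. h \<in> H} \<subseteq> E"
      proof clarify
        fix c h assume "h \<in> H"
        then show "{x \<in> space M. c < h x} \<in> E" unfolding E_def by (intro CollectI exI[of _ "[(h, c)]"]) auto
      qed
      from gen sigma_sets_mono'[OF this] show "sets M \<subseteq> sigma_sets (space M) E" by (rule order_trans)
      have "E \<subseteq> sets M" using EM unfolding E_def by blast
      then show "sigma_sets (space M) E \<subseteq> sets M" by (rule sets.sigma_sets_subset)
    qed
    show "Int_stable E"
      unfolding Int_stable_def E_def
    proof clarify
      fix l l' :: "(('a \<Rightarrow> real) \<times> real) list" assume "set l \<subseteq> H \<times> UNIV" "set l' \<subseteq> H \<times> UNIV"
      then show "\<exists>m. ?E l \<inter> ?E l' = ?E m \<and> set m \<subseteq> H \<times> UNIV"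
        by (intro exI[of _ "l @ l'"] conjI) (auto simp: ball_Un)
    qed
    show "E \<subseteq> Pow (space M)" by (auto simp: E_def)
    show "prob_space (K x)" "sets (K x) = sets M" if "x \<in> space N" for x using Ks[OF that] by auto
    fix A assume "A \<in> E"
    then obtain l where l: "A = ?E l" "set l \<subseteq> H \<times> UNIV" by (auto simp: E_def)
    have "emeasure (K x) A = ennreal (\<integral>y. 1 * ind l y \<partial>K x)" if x: "x \<in> space N" for x
    proof -
      interpret prob_space "K x" using Ks(1)[OF x] .
      have "(\<integral>y. 1 * ind l y \<partial>K x) = (\<integral>y. indicator A y \<partial>K x)"
        using E_ind[of _ l] Ks(3)[OF x] by (intro Bochner_Integration.integral_cong) (simp_all add: l(1))
      also have "\<dots> = measure (K x) A" using sets.sets_into_space[OF EM[OF l(2)]] Ks(3)[OF x] by (simp add: l(1) Int_absorb2)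
      finally show ?thesis by (simp add: emeasure_eq_measure)
    qed
    moreover have "(\<lambda>x. ennreal (\<integral>y. 1 * ind l y \<partial>K x)) \<in> borel_measurable N"
      by (rule measurable_compose[OF main[OF l(2) one] measurable_ennreal])
    ultimately show "(\<lambda>x. emeasure (K x) A) \<in> borel_measurable N" by (simp cong: measurable_cong)
  qed
qed

text \<open>A map that is measurable with respect to the trivial \<open>\<sigma>\<close>-algebra is constant.\<close>

lemma prob_measure_eqI_multiplicative:
  fixes H :: "('a \<Rightarrow> real) set"
  assumes "\<And>h. h \<in> H \<Longrightarrow> h \<in> borel_measurable M"
    and "\<And>h. h \<in> H \<Longrightarrow> \<exists>B. \<forall>x\<in>space M. \<bar>h x\<bar> \<le> B"
    and "(\<lambda>_. 1) \<in> H"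
    and "\<And>g h. g \<in> H \<Longrightarrow> h \<in> H \<Longrightarrow> (\<lambda>x. g x * h x) \<in> H"
    and "sets M \<subseteq> sigma_sets (space M) {{x \<in> space M. c < h x} | c h. h \<in> H}"
    and \<mu>: "\<mu> \<in> space (prob_algebra M)" and \<nu>: "\<nu> \<in> space (prob_algebra M)"
    and eq: "\<And>h. h \<in> H \<Longrightarrow> (\<integral>y. h y \<partial>\<mu>) = (\<integral>y. h y \<partial>\<nu>)"
  shows "\<mu> = \<nu>"
proof -
  define N where "N = sigma (UNIV :: bool set) {}"
  have setsN: "sets N = {{}, UNIV}" "space N = UNIV"
    unfolding N_def by (simp_all add: sigma_sets_empty_eq)
  define K where "K b = (if b then \<mu> else \<nu>)" for b
  have "K \<in> N \<rightarrow>\<^sub>M prob_algebra M"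
  proof (rule measurable_kernel_multiplicative[OF assms(1-5)])
    show "K x \<in> space (prob_algebra M)" for x using \<mu> \<nu> by (simp add: K_def)
    show "(\<lambda>x. \<integral>y. h y \<partial>K x) \<in> borel_measurable N" if "h \<in> H" for h
    proof -
      have "(\<lambda>x. \<integral>y. h y \<partial>K x) = (\<lambda>_. \<integral>y. h y \<partial>\<nu>)" using eq[OF that] by (auto simp: K_def)
      then show ?thesis by simp
    qed
  qed
  show ?thesis
  proof (rule measure_eqI)
    show s: "sets \<mu> = sets \<nu>" using \<mu> \<nu> by (simp add: space_prob_algebra)
    fix A assume "A \<in> sets \<mu>"
    then have "A \<in> sets M" using \<mu> by (simp add: space_prob_algebra)
    then have "(\<lambda>x. emeasure (K x) A) \<in> borel_measurable N"
      using measurable_prob_algebraD[OF \<open>K \<in> N \<rightarrow>\<^sub>M prob_algebra M\<close>] by simp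
    then have "(\<lambda>x. emeasure (K x) A) -` {emeasure \<mu> A} \<inter> space N \<in> sets N"
      by (rule measurable_sets) simp
    moreover have "True \<in> (\<lambda>x. emeasure (K x) A) -` {emeasure \<mu> A}" by (simp add: K_def)
    ultimately have "(\<lambda>x. emeasure (K x) A) -` {emeasure \<mu> A} = UNIV"
      by (auto simp: setsN)
    then have "False \<in> (\<lambda>x. emeasure (K x) A) -` {emeasure \<mu> A}" by blast
    then show "emeasure \<mu> A = emeasure \<nu> A" by (simp add: K_def)
  qed
qed

section \<open>Terms\<close>

abbreviation cube :: "nat set \<Rightarrow> (nat \<Rightarrow> real) measure" where
  "cube J \<equiv> \<Pi>\<^sub>M i\<in>J. unit_lebesgue"

lemma space_unit_lebesgue [simp]: "space unit_lebesgue = {0..1}"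
  by (simp add: unit_lebesgue_def)

lemma prob_space_unit_lebesgue: "prob_space unit_lebesgue"
  by (intro prob_spaceI) (simp add: unit_lebesgue_def emeasure_restrict_space)

interpretation unit_lebesgue: prob_space unit_lebesgue
  by (rule prob_space_unit_lebesgue)

interpretation cube: product_sigma_finite "\<lambda>_ :: nat. unit_lebesgue"
  by (intro product_sigma_finite.intro) (rule unit_lebesgue.sigma_finite_measure_axioms)

lemma prob_space_cube: "prob_space (cube J)"
  by (rule prob_space_PiM) (rule prob_space_unit_lebesgue)

lemma space_cube: "space (cube J) = J \<rightarrow>\<^sub>E {0..1}"
  by (simp add: space_PiM)

text \<open>If \<open>\<phi>\<close> is not integrable, its integral is 0 by convention, which obeys
  the bound because a probability space has a point and so \<open>B\<close> is nonnegative.\<close>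

lemma abs_integral_le_const:
  fixes \<phi> :: "'a \<Rightarrow> real"
  assumes "prob_space M" "\<And>y. y \<in> space M \<Longrightarrow> \<bar>\<phi> y\<bar> \<le> B"
  shows "\<bar>\<integral>y. \<phi> y \<partial>M\<bar> \<le> B"
proof -
  interpret prob_space M by fact
  obtain y where "y \<in> space M" using not_empty by blast
  then have B: "0 \<le> B" using assms(2)[of y] by linarith
  show ?thesis
  proof (cases "integrable M \<phi>")
    case True
    have "\<bar>\<integral>y. \<phi> y \<partial>M\<bar> \<le> (\<integral>y. \<bar>\<phi> y\<bar> \<partial>M)" by (rule integral_abs_bound)
    also have "\<dots> \<le> B" using True assms(2) by (intro integral_le_const) auto
    finally show ?thesis .
  qed (use B in \<open>simp add: not_integrable_integral_eq\<close>)
qed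

text \<open>
  The number \<open>n\<close> in \<open>Integ n j t\<close> has no influence on the value of the term, but it selects the
  level \<open>n + lev t + 1\<close> of the color from which this value is read off.
\<close>

datatype tm = One | Sig nat | Edge nat nat | Mul tm tm | Integ nat nat tm

primrec sem :: "tm \<Rightarrow> (real \<Rightarrow> real \<Rightarrow> real) \<Rightarrow> (real \<Rightarrow> real) \<Rightarrow> (nat \<Rightarrow> real) \<Rightarrow> real" where
  "sem One W f x = 1"
| "sem (Sig j) W f x = f (x j)"
| "sem (Edge i j) W f x = W (x i) (x j)"
| "sem (Mul t u) W f x = sem t W f x * sem u W f x"
| "sem (Integ n j t) W f x = (\<integral>y. sem t W f (x(j := y)) \<partial>unit_lebesgue)"

primrec lev :: "tm \<Rightarrow> nat" where
  "lev One = 0"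
| "lev (Sig j) = 0"
| "lev (Edge i j) = 0"
| "lev (Mul t u) = max (lev t) (lev u)"
| "lev (Integ n j t) = Suc (n + lev t)"

primrec fv :: "tm \<Rightarrow> nat set" where
  "fv One = {}"
| "fv (Sig j) = {j}"
| "fv (Edge i j) = {i, j}"
| "fv (Mul t u) = fv t \<union> fv u"
| "fv (Integ n j t) = fv t - {j}"

primrec wf_tm :: "nat \<Rightarrow> tm \<Rightarrow> bool" where
  "wf_tm k One \<longleftrightarrow> True"
| "wf_tm k (Sig j) \<longleftrightarrow> j < k"
| "wf_tm k (Edge i j) \<longleftrightarrow> i < k \<and> j < k \<and> i \<noteq> j"
| "wf_tm k (Mul t u) \<longleftrightarrow> wf_tm k t \<and> wf_tm k u"
| "wf_tm k (Integ n j t) \<longleftrightarrow> j < k \<and> wf_tm k t"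

primrec bd :: "real \<Rightarrow> tm \<Rightarrow> real" where
  "bd r One = 1"
| "bd r (Sig j) = r"
| "bd r (Edge i j) = 1"
| "bd r (Mul t u) = bd r t * bd r u"
| "bd r (Integ n j t) = bd r t"

text \<open>The bound is required at every point, so that the clipping in the initial color changes
  nothing and values of terms agree with colors everywhere rather than almost everywhere.\<close>

definition bounded_signal :: "real \<Rightarrow> (real \<Rightarrow> real \<Rightarrow> real) \<Rightarrow> (real \<Rightarrow> real) \<Rightarrow> bool" where
  "bounded_signal r W f \<longleftrightarrow> graphon W \<and> f \<in> borel_measurable unit_lebesgue \<and>
     (\<forall>x\<in>{0..1}. \<bar>f x\<bar> \<le> r)"

lemma bounded_signalD:
  assumes "bounded_signal r W f"
  shows "(\<lambda>(x, y). W x y) \<in> borel_measurable (unit_lebesgue \<Otimes>\<^sub>M unit_lebesgue)"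
    "f \<in> borel_measurable unit_lebesgue"
    "x \<in> {0..1} \<Longrightarrow> \<bar>f x\<bar> \<le> r"
    "x \<in> {0..1} \<Longrightarrow> y \<in> {0..1} \<Longrightarrow> W x y = W y x"
    "x \<in> {0..1} \<Longrightarrow> y \<in> {0..1} \<Longrightarrow> W x y \<in> {0..1}"
  using assms unfolding bounded_signal_def graphon_def by auto

lemma wf_tm_fv: "wf_tm k t \<Longrightarrow> fv t \<subseteq> {..<k}"
  by (induction t) auto

lemma sem_cong: "(\<And>a. a \<in> fv t \<Longrightarrow> x a = y a) \<Longrightarrow> sem t W f x = sem t W f y"
proof (induction t arbitrary: x y)
  case (Mul t u)
  from Mul.prems have "sem t W f x = sem t W f y" "sem u W f x = sem u W f y"
    by (auto intro!: Mul.IH)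
  then show ?case by simp
next
  case (Integ n j t)
  from Integ.prems have "sem t W f (x(j := z)) = sem t W f (y(j := z))" for z
    by (intro Integ.IH) auto
  then show ?case by simp
qed auto

lemma sem_bound:
  assumes S: "bounded_signal r W f" and "r > 0"
  shows "(\<And>a. a \<in> fv t \<Longrightarrow> x a \<in> {0..1}) \<Longrightarrow> \<bar>sem t W f x\<bar> \<le> bd r t"
proof (induction t arbitrary: x)
  case (Sig j)
  then show ?case using bounded_signalD(3)[OF S, of "x j"] by simp
next
  case (Edge i j)
  then show ?case using bounded_signalD(5)[OF S, of "x i" "x j"] by auto
next
  case (Mul t u)
  have "\<bar>sem t W f x\<bar> \<le> bd r t" "\<bar>sem u W f x\<bar> \<le> bd r u" using Mul by auto
  then show ?case unfolding sem.simps bd.simps abs_mult by (intro mult_mono) auto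
next
  case (Integ n j t)
  show ?case unfolding sem.simps bd.simps
  proof (rule abs_integral_le_const[OF prob_space_unit_lebesgue])
    fix y assume "y \<in> space unit_lebesgue"
    then show "\<bar>sem t W f (x(j := y))\<bar> \<le> bd r t" using Integ.prems by (intro Integ.IH) auto
  qed
qed auto

lemma sem_One: "sem One W f = (\<lambda>_. 1)"
  by (rule ext) simp

text \<open>The index set \<open>J\<close> varies in the induction because integrating out
  \<open>j\<close> leads from \<open>J\<close> to \<open>insert j J\<close>, whether or not
  \<open>j\<close> belongs to \<open>J\<close>.\<close>

lemma sem_measurable:
  assumes S: "bounded_signal r W f"
  shows "fv t \<subseteq> J \<Longrightarrow> sem t W f \<in> borel_measurable (cube J)"
proof (induction t arbitrary: J)
  case (Sig j)
  have "(\<lambda>x. x j) \<in> cube J \<rightarrow>\<^sub>M unit_lebesgue" using Sig by (intro measurable_component_singleton) auto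
  from measurable_compose[OF this bounded_signalD(2)[OF S]] show ?case by simp
next
  case (Edge i j)
  have "(\<lambda>x. (x i, x j)) \<in> cube J \<rightarrow>\<^sub>M unit_lebesgue \<Otimes>\<^sub>M unit_lebesgue"
    using Edge by (intro measurable_Pair measurable_component_singleton) auto
  from measurable_compose[OF this bounded_signalD(1)[OF S]] show ?case by simp
next
  case (Mul t u)
  have "sem t W f \<in> borel_measurable (cube J)" "sem u W f \<in> borel_measurable (cube J)"
    using Mul by auto
  then show ?case by simp
next
  case (Integ n j t)
  have "sem t W f \<in> borel_measurable (cube (insert j J))" using Integ by (intro Integ.IH) auto
  moreover have "(\<lambda>(x, y). x(j := y)) \<in> cube J \<Otimes>\<^sub>M unit_lebesgue \<rightarrow>\<^sub>M cube (insert j J)"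
    by (rule measurable_add_dim)
  ultimately have "(\<lambda>p. sem t W f ((\<lambda>(x, y). x(j := y)) p)) \<in>
      borel_measurable (cube J \<Otimes>\<^sub>M unit_lebesgue)"
    by (rule measurable_compose[rotated])
  then have "(\<lambda>(x, y). sem t W f (x(j := y))) \<in> borel_measurable (cube J \<Otimes>\<^sub>M unit_lebesgue)"
    by (simp add: case_prod_beta)
  then show ?case unfolding sem.simps by (rule unit_lebesgue.borel_measurable_lebesgue_integral)
qed (simp add: sem_One)


section \<open>Reading off the values of terms from colors\<close>

declare wl_P.simps [simp del]

definition decode_0 :: "nat \<Rightarrow> real \<Rightarrow> (nat \<Rightarrow> real) \<Rightarrow> (nat set \<Rightarrow> real) \<times> (nat \<Rightarrow> real)" where
  "decode_0 k r = inv_into (topspace (init_space k r)) (code (init_space k r))"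

definition decode_Suc :: "nat \<Rightarrow> real \<Rightarrow> nat \<Rightarrow> (nat \<Rightarrow> real) \<Rightarrow> nat \<Rightarrow> (nat \<Rightarrow> nat \<Rightarrow> real) measure" where
  "decode_Suc k r s = inv_into (topspace (refine_space k (wl_M k r s))) (code (refine_space k (wl_M k r s)))"

lemma continuous_map_inv_code:
  assumes "embeddable X"
  shows "continuous_map (recode X) X (inv_into (topspace X) (code X))"
proof -
  have "continuous_map (recode X) X (id \<circ> inv_into (topspace X) (code X))"
    unfolding recode_def by (rule continuous_map_pullback) simp
  then show ?thesis by simp
qed

lemma continuous_map_decode_0: "continuous_map (wl_P k r 0) (init_space k r) (decode_0 k r)"
  unfolding decode_0_def wl_P.simps by (rule continuous_map_inv_code[OF embeddable_init_space])

lemma continuous_map_decode_Suc: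
  "continuous_map (wl_P k r (Suc s)) (refine_space k (wl_M k r s)) (decode_Suc k r s)"
  unfolding decode_Suc_def wl_P_Suc by (rule continuous_map_inv_code[OF embeddable_refine_space])

lemma code_decode_0: "z \<in> topspace (wl_P k r 0) \<Longrightarrow> code (init_space k r) (decode_0 k r z) = z"
  unfolding decode_0_def by (simp add: wl_P.simps topspace_recode f_inv_into_f)

lemma code_decode_Suc:
  "z \<in> topspace (wl_P k r (Suc s)) \<Longrightarrow> code (refine_space k (wl_M k r s)) (decode_Suc k r s z) = z"
  unfolding decode_Suc_def wl_P_Suc by (simp add: topspace_recode f_inv_into_f)

lemma decode_code_0: "z \<in> topspace (init_space k r) \<Longrightarrow> decode_0 k r (code (init_space k r) z) = z"
  unfolding decode_0_def by (intro inv_into_f_f inj_code embeddable_init_space)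

lemma decode_code_Suc:
  "z \<in> topspace (refine_space k (wl_M k r s)) \<Longrightarrow>
    decode_Suc k r s (code (refine_space k (wl_M k r s)) z) = z"
  unfolding decode_Suc_def by (intro inv_into_f_f inj_code embeddable_refine_space)

lemma continuous_map_code:
  "embeddable X \<Longrightarrow> continuous_map X (recode X) (code X)"
  using homeomorphic_map_recode homeomorphic_imp_continuous_map by blast

lemma topspace_refine_space: "topspace (refine_space k X) = {..<k} \<rightarrow>\<^sub>E borel_probs X"
  by (simp add: refine_space_def topspace_weak_topology)

lemma topspace_init_space:
  "topspace (init_space k r) = (pairs k \<rightarrow>\<^sub>E {0..1}) \<times> ({..<k} \<rightarrow>\<^sub>E {-r..r})"
  by (simp add: init_space_def)

lemma topspace_wl_M: "topspace (wl_M k r s) = (\<Pi>\<^sub>E i\<in>{..s}. topspace (wl_P k r i))"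
  by (simp add: wl_M_def)

text \<open>The counterpart of \<open>sem\<close> on the color space. It refers to no
  graphon-signal, since the observables have to generate a sigma-algebra on the whole space,
  including points that are no colors.\<close>

primrec obs :: "nat \<Rightarrow> real \<Rightarrow> tm \<Rightarrow> (nat \<Rightarrow> nat \<Rightarrow> real) \<Rightarrow> real" where
  "obs k r One c = 1"
| "obs k r (Sig j) c = snd (decode_0 k r (c 0)) j"
| "obs k r (Edge i j) c = fst (decode_0 k r (c 0)) {i, j}"
| "obs k r (Mul t u) c = obs k r t c * obs k r u c"
| "obs k r (Integ n j t) c =
     (\<integral>c'. obs k r t c' \<partial>decode_Suc k r (n + lev t) (c (Suc (n + lev t))) j)"

lemma obs_One: "obs k r One = (\<lambda>_. 1)"
  and obs_Sig: "obs k r (Sig j) = (\<lambda>c. snd (decode_0 k r (c 0)) j)"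
  and obs_Edge: "obs k r (Edge i j) = (\<lambda>c. fst (decode_0 k r (c 0)) {i, j})"
  and obs_Integ: "obs k r (Integ n j t) =
    (\<lambda>c. \<integral>c'. obs k r t c' \<partial>decode_Suc k r (n + lev t) (c (Suc (n + lev t))) j)"
  by (rule ext, simp)+

lemma obs_cong: "(\<And>i. i \<le> lev t \<Longrightarrow> c i = c' i) \<Longrightarrow> obs k r t c = obs k r t c'"
  by (induction t) auto

lemma decode_Suc_mem:
  assumes "z \<in> topspace (wl_P k r (Suc s))" "j < k"
  shows "decode_Suc k r s z j \<in> borel_probs (wl_M k r s)"
proof -
  have "decode_Suc k r s z \<in> topspace (refine_space k (wl_M k r s))"
    using continuous_map_funspace[OF continuous_map_decode_Suc] assms(1) by blast
  then show ?thesis using assms(2) by (auto simp: topspace_refine_space)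
qed

lemma decode_0_mem:
  assumes "z \<in> topspace (wl_P k r 0)"
  shows "fst (decode_0 k r z) \<in> pairs k \<rightarrow>\<^sub>E {0..1}" "snd (decode_0 k r z) \<in> {..<k} \<rightarrow>\<^sub>E {-r..r}"
proof -
  have "decode_0 k r z \<in> topspace (init_space k r)"
    using continuous_map_funspace[OF continuous_map_decode_0] assms(1) by blast
  then show "fst (decode_0 k r z) \<in> pairs k \<rightarrow>\<^sub>E {0..1}" "snd (decode_0 k r z) \<in> {..<k} \<rightarrow>\<^sub>E {-r..r}"
    by (auto simp: topspace_init_space)
qed

lemma countable_pairs [simp]: "countable (pairs k)"
  by (rule countable_finite) (auto simp: pairs_def)

lemma pairsE:
  assumes "e \<in> pairs k" obtains i j where "e = {i, j}" "i \<noteq> j" "i < k" "j < k"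
proof -
  have "card e = 2" and sub: "e \<subseteq> {..<k}" using assms by (simp_all add: pairs_def)
  then obtain i j where "e = {i, j}" "i \<noteq> j" unfolding card_2_iff by blast
  then show ?thesis using sub by (intro that[of i j]) auto
qed

lemma doubleton_in_pairs: "i < k \<Longrightarrow> j < k \<Longrightarrow> i \<noteq> j \<Longrightarrow> {i, j} \<in> pairs k"
  by (auto simp: pairs_def)

lemma obs_bound:
  assumes "r > 0"
  shows "wf_tm k t \<Longrightarrow> (\<And>i. i \<le> lev t \<Longrightarrow> c i \<in> topspace (wl_P k r i)) \<Longrightarrow> \<bar>obs k r t c\<bar> \<le> bd r t"
proof (induction t arbitrary: c)
  case (Sig j)
  have "c 0 \<in> topspace (wl_P k r 0)" using Sig.prems(2) by simp
  from PiE_mem[OF decode_0_mem(2)[OF this], of j] Sig.prems(1) show ?case by (simp add: abs_le_iff)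
next
  case (Edge i j)
  have "c 0 \<in> topspace (wl_P k r 0)" using Edge.prems(2) by simp
  from PiE_mem[OF decode_0_mem(1)[OF this] doubleton_in_pairs, of i j] Edge.prems(1)
  show ?case by simp
next
  case (Mul t u)
  have "\<bar>obs k r t c\<bar> \<le> bd r t" "\<bar>obs k r u c\<bar> \<le> bd r u" using Mul by auto
  then show ?case unfolding obs.simps bd.simps abs_mult by (intro mult_mono) auto
next
  case (Integ n j t)
  let ?m = "n + lev t"
  have mem: "decode_Suc k r ?m (c (Suc ?m)) j \<in> borel_probs (wl_M k r ?m)"
    using Integ.prems by (intro decode_Suc_mem) auto
  show ?case unfolding obs.simps bd.simps
  proof (rule abs_integral_le_const[OF borel_probs_D(1)[OF mem]])
    fix c' assume "c' \<in> space (decode_Suc k r ?m (c (Suc ?m)) j)"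
    then have "c' \<in> topspace (wl_M k r ?m)" using borel_probs_D(2)[OF mem] by simp
    then have "c' i \<in> topspace (wl_P k r i)" if "i \<le> lev t" for i
      using that by (auto simp: topspace_wl_M)
    then show "\<bar>obs k r t c'\<bar> \<le> bd r t" using Integ.prems by (intro Integ.IH) auto
  qed
qed auto

lemma continuous_map_proj: "i \<in> I \<Longrightarrow> continuous_map (product_topology X I) (X i) (\<lambda>c. c i)"
  by (rule continuous_map_product_projection)

lemma obs_measurable:
  "wf_tm k t \<Longrightarrow> {..lev t} \<subseteq> I \<Longrightarrow>
    obs k r t \<in> borel_measurable (borel_of (product_topology (wl_P k r) I))"
proof (induction t arbitrary: I)
  case (Sig j)
  have "continuous_map (init_space k r) (top_of_set {-r..r}) ((\<lambda>x. x j) \<circ> snd)"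
    unfolding init_space_def using Sig
    by (intro continuous_map_compose[OF continuous_map_snd] continuous_map_product_projection) auto
  then have "continuous_map (wl_P k r 0) (top_of_set {-r..r}) (((\<lambda>x. x j) \<circ> snd) \<circ> decode_0 k r)"
    by (rule continuous_map_compose[OF continuous_map_decode_0])
  then have "continuous_map (product_topology (wl_P k r) I) (top_of_set {-r..r})
      ((((\<lambda>x. x j) \<circ> snd) \<circ> decode_0 k r) \<circ> (\<lambda>c. c 0))"
    by (rule continuous_map_compose[OF continuous_map_proj[of 0], rotated]) (use Sig in auto)
  then have "continuous_map (product_topology (wl_P k r) I) euclideanreal (obs k r (Sig j))"
    by (auto simp: o_def continuous_map_in_subtopology obs_Sig obs_Edge)
  then show ?case by (rule borel_measurable_borel_of_continuous)
next
  case (Edge i j)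
  have "continuous_map (init_space k r) (top_of_set {0..1}) ((\<lambda>x. x {i, j}) \<circ> fst)"
    unfolding init_space_def using Edge doubleton_in_pairs
    by (intro continuous_map_compose[OF continuous_map_fst] continuous_map_product_projection) auto
  then have "continuous_map (wl_P k r 0) (top_of_set {0..1}) (((\<lambda>x. x {i, j}) \<circ> fst) \<circ> decode_0 k r)"
    by (rule continuous_map_compose[OF continuous_map_decode_0])
  then have "continuous_map (product_topology (wl_P k r) I) (top_of_set {0..1})
      ((((\<lambda>x. x {i, j}) \<circ> fst) \<circ> decode_0 k r) \<circ> (\<lambda>c. c 0))"
    by (rule continuous_map_compose[OF continuous_map_proj[of 0], rotated]) (use Edge in auto)
  then have "continuous_map (product_topology (wl_P k r) I) euclideanreal (obs k r (Edge i j))"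
    by (auto simp: o_def continuous_map_in_subtopology obs_Sig obs_Edge)
  then show ?case by (rule borel_measurable_borel_of_continuous)
next
  case (Mul t u)
  then have "obs k r t \<in> borel_measurable (borel_of (product_topology (wl_P k r) I))"
    "obs k r u \<in> borel_measurable (borel_of (product_topology (wl_P k r) I))"
    by (auto simp: subset_iff le_max_iff_disj)
  then show ?case by simp
next
  case (Integ n j t)
  let ?m = "n + lev t"
  have "obs k r t \<in> borel_measurable (borel_of (wl_M k r ?m))"
    unfolding wl_M_def using Integ.prems by (intro Integ.IH) auto
  then have "(\<lambda>\<mu>. \<integral>c. obs k r t c \<partial>\<mu>) \<in> borel_measurable (subprob_algebra (borel_of (wl_M k r ?m)))"
    by (rule integral_measurable_subprob_algebra)
  \<comment> \<open>The measure stored in a color depends continuously on it in the weak topology,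
    whereas integration is measurable on \<open>prob_algebra\<close>;
    \<open>measurable_weak_prob_algebra\<close> joins the two.\<close>
  then have 1: "(\<lambda>\<mu>. \<integral>c. obs k r t c \<partial>\<mu>) \<in> borel_measurable (borel_of (weak_topology (wl_M k r ?m)))"
    by (rule measurable_compose[OF measurable_prob_algebraD[OF measurable_weak_prob_algebra[OF embeddable_wl_M]]])
  have "continuous_map (refine_space k (wl_M k r ?m)) (weak_topology (wl_M k r ?m)) (\<lambda>x. x j)"
    unfolding refine_space_def using Integ.prems by (intro continuous_map_product_projection) auto
  then have "continuous_map (wl_P k r (Suc ?m)) (weak_topology (wl_M k r ?m)) ((\<lambda>x. x j) \<circ> decode_Suc k r ?m)"
    by (rule continuous_map_compose[OF continuous_map_decode_Suc])
  then have "continuous_map (product_topology (wl_P k r) I) (weak_topology (wl_M k r ?m))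
      (((\<lambda>x. x j) \<circ> decode_Suc k r ?m) \<circ> (\<lambda>c. c (Suc ?m)))"
    by (rule continuous_map_compose[OF continuous_map_proj[of "Suc ?m"], rotated]) (use Integ in auto)
  then have "((\<lambda>x. x j) \<circ> decode_Suc k r ?m) \<circ> (\<lambda>c. c (Suc ?m)) \<in>
      borel_of (product_topology (wl_P k r) I) \<rightarrow>\<^sub>M borel_of (weak_topology (wl_M k r ?m))"
    by (rule measurable_borel_of_continuous)
  from measurable_compose[OF this 1] show ?case by (simp add: o_def)
qed (simp add: obs_One)

section \<open>The sigma-algebra generated by the observables\<close>

definition obs_sets :: "nat \<Rightarrow> real \<Rightarrow> nat set \<Rightarrow> (nat \<Rightarrow> nat \<Rightarrow> real) set set" where
  "obs_sets k r I = {{c \<in> topspace (product_topology (wl_P k r) I). a < h c} | a h.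
     h \<in> obs k r ` {t. wf_tm k t \<and> {..lev t} \<subseteq> I}}"

text \<open>The index set \<open>I\<close> is \<open>{..s}\<close> inside the induction on levels
  and \<open>UNIV\<close> at the end. The condition \<open>{..lev t} \<subseteq> I\<close> ensures
  that the term reads only coordinates in \<open>I\<close>.\<close>

definition obs_algebra :: "nat \<Rightarrow> real \<Rightarrow> nat set \<Rightarrow> (nat \<Rightarrow> nat \<Rightarrow> real) measure" where
  "obs_algebra k r I = sigma (topspace (product_topology (wl_P k r) I)) (obs_sets k r I)"

lemma obs_algebra_simps:
  "space (obs_algebra k r I) = topspace (product_topology (wl_P k r) I)"
  "sets (obs_algebra k r I) = sigma_sets (topspace (product_topology (wl_P k r) I)) (obs_sets k r I)"
proof -
  have "obs_sets k r I \<subseteq> Pow (topspace (product_topology (wl_P k r) I))"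
    by (auto simp: obs_sets_def)
  then show "space (obs_algebra k r I) = topspace (product_topology (wl_P k r) I)"
    "sets (obs_algebra k r I) = sigma_sets (topspace (product_topology (wl_P k r) I)) (obs_sets k r I)"
    unfolding obs_algebra_def by (simp_all add: space_measure_of sets_measure_of)
qed

lemma obs_measurable_obs_algebra:
  assumes "wf_tm k t" "{..lev t} \<subseteq> I"
  shows "obs k r t \<in> borel_measurable (obs_algebra k r I)"
proof (rule borel_measurableI_greater)
  fix a
  have "{c \<in> space (obs_algebra k r I). a < obs k r t c} \<in> obs_sets k r I"
    unfolding obs_sets_def obs_algebra_simps using assms by blast
  then show "{c \<in> space (obs_algebra k r I). a < obs k r t c} \<in> sets (obs_algebra k r I)"
    unfolding obs_algebra_simps(2) by (rule sigma_sets.Basic)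
qed

text \<open>Measurable coordinates make the identity map measurable into the Borel space of the
  product; preimages under the identity then give the inclusion.\<close>

lemma obs_generate_of_coordinates:
  assumes "\<And>i. i \<in> I \<Longrightarrow> (\<lambda>c. c i) \<in> obs_algebra k r I \<rightarrow>\<^sub>M borel_of (wl_P k r i)"
  shows "sets (borel_of (product_topology (wl_P k r) I)) \<subseteq> sets (obs_algebra k r I)"
proof
  have "(\<lambda>c. c) \<in> obs_algebra k r I \<rightarrow>\<^sub>M borel_of (product_topology (wl_P k r) I)"
    using assms by (intro measurable_borel_of_product embeddable_wl_P) (auto simp: obs_algebra_simps)
  note * = measurable_sets[OF this]
  fix A assume A: "A \<in> sets (borel_of (product_topology (wl_P k r) I))"
  then have "A \<subseteq> topspace (product_topology (wl_P k r) I)"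
    using sets.sets_into_space[OF A] by (simp add: borel_of_simps)
  then show "A \<in> sets (obs_algebra k r I)" using *[OF A] by (simp add: obs_algebra_simps(1) Int_absorb2)
qed

lemma obs_family_mult_closed:
  assumes "g \<in> obs k r ` {t. wf_tm k t \<and> {..lev t} \<subseteq> I}" "h \<in> obs k r ` {t. wf_tm k t \<and> {..lev t} \<subseteq> I}"
  shows "(\<lambda>c. g c * h c) \<in> obs k r ` {t. wf_tm k t \<and> {..lev t} \<subseteq> I}"
proof -
  obtain t u where t: "wf_tm k t" "{..lev t} \<subseteq> I" "g = obs k r t"
    and u: "wf_tm k u" "{..lev u} \<subseteq> I" "h = obs k r u" using assms by blast
  have "(\<lambda>c. g c * h c) = obs k r (Mul t u)" unfolding t(3) u(3) by (rule ext) simp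
  moreover have "wf_tm k (Mul t u)" "{..lev (Mul t u)} \<subseteq> I" using t u by (auto simp: max_def)
  ultimately show ?thesis by blast
qed

text \<open>Strong induction on the level. A color of level \<open>Suc s\<close> is a tuple of
  measures on \<open>wl_M k r s\<close>, whose Borel sets are by induction generated by the terms of
  level at most \<open>s\<close>. The integrals of these terms are observables again, so the kernel
  lemma makes every component measurable, and the continuous renaming carries this over to the
  color.\<close>

lemma coordinate_measurable_obs_algebra:
  assumes r: "r > 0"
  shows "{..i} \<subseteq> I \<Longrightarrow> (\<lambda>c. c i) \<in> obs_algebra k r I \<rightarrow>\<^sub>M borel_of (wl_P k r i)"
proof (induction i arbitrary: I rule: less_induct)
  case (less i)
  have top: "c l \<in> topspace (wl_P k r l)" if "c \<in> space (obs_algebra k r I)" "l \<le> i" for c l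
    using that less.prems by (auto simp: obs_algebra_simps)
  show ?case
  proof (cases i)
    case 0
    have "(\<lambda>c. decode_0 k r (c 0)) \<in> obs_algebra k r I \<rightarrow>\<^sub>M borel_of (init_space k r)"
      unfolding init_space_def
    proof (intro measurable_borel_of_prod embeddable_product embeddable_real measurable_borel_of_product)
      show "(\<lambda>c. fst (decode_0 k r (c 0))) \<in> space (obs_algebra k r I) \<rightarrow>
          topspace (product_topology (\<lambda>_. top_of_set {0..1}) (pairs k))"
        using decode_0_mem(1) top 0 by auto
      show "(\<lambda>c. snd (decode_0 k r (c 0))) \<in> space (obs_algebra k r I) \<rightarrow>
          topspace (product_topology (\<lambda>_. top_of_set {-r..r}) {..<k})"
        using decode_0_mem(2) top 0 by auto
    next
      fix e assume e: "e \<in> pairs k"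
      then obtain i' j where ij: "e = {i', j}" "i' \<noteq> j" "i' < k" "j < k" by (rule pairsE)
      show "(\<lambda>c. fst (decode_0 k r (c 0)) e) \<in> obs_algebra k r I \<rightarrow>\<^sub>M borel_of (top_of_set {0..1})"
      proof (rule measurable_borel_of_subspace)
        show "(\<lambda>c. fst (decode_0 k r (c 0)) e) \<in> borel_measurable (obs_algebra k r I)"
          using obs_measurable_obs_algebra[of k "Edge i' j" I r] ij less.prems 0 by (simp add: obs_Edge)
        show "fst (decode_0 k r (c 0)) e \<in> {0..1}" if "c \<in> space (obs_algebra k r I)" for c
          using PiE_mem[OF decode_0_mem(1)[OF top[OF that, of 0, simplified]] e] .
      qed
    next
      fix j assume j: "j \<in> {..<k}"
      show "(\<lambda>c. snd (decode_0 k r (c 0)) j) \<in> obs_algebra k r I \<rightarrow>\<^sub>M borel_of (top_of_set {-r..r})"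
      proof (rule measurable_borel_of_subspace)
        show "(\<lambda>c. snd (decode_0 k r (c 0)) j) \<in> borel_measurable (obs_algebra k r I)"
          using obs_measurable_obs_algebra[of k "Sig j" I r] j less.prems 0 by (simp add: obs_Sig)
        show "snd (decode_0 k r (c 0)) j \<in> {-r..r}" if "c \<in> space (obs_algebra k r I)" for c
          using PiE_mem[OF decode_0_mem(2)[OF top[OF that, of 0, simplified]] j] .
      qed
    qed auto
    from measurable_compose[OF this measurable_borel_of_continuous[OF continuous_map_code[OF embeddable_init_space]]]
    have "(\<lambda>c. code (init_space k r) (decode_0 k r (c 0))) \<in> obs_algebra k r I \<rightarrow>\<^sub>M borel_of (wl_P k r 0)"
      unfolding wl_P.simps .
    moreover have "code (init_space k r) (decode_0 k r (c 0)) = c 0"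
      if "c \<in> space (obs_algebra k r I)" for c using that by (intro code_decode_0 top) auto
    ultimately show ?thesis unfolding 0 by (simp only: cong: measurable_cong)
  next
    case (Suc s)
    have gen: "sets (borel_of (wl_M k r s)) \<subseteq> sets (obs_algebra k r {..s})"
      unfolding wl_M_def by (rule obs_generate_of_coordinates, rule less.IH) (auto simp: Suc)
    have "(\<lambda>c. decode_Suc k r s (c (Suc s))) \<in> obs_algebra k r I \<rightarrow>\<^sub>M borel_of (refine_space k (wl_M k r s))"
      unfolding refine_space_def
    proof (intro measurable_borel_of_product embeddable_weak embeddable_wl_M)
      show "(\<lambda>c. decode_Suc k r s (c (Suc s))) \<in> space (obs_algebra k r I) \<rightarrow>
          topspace (product_topology (\<lambda>_. weak_topology (wl_M k r s)) {..<k})"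
        using continuous_map_funspace[OF continuous_map_decode_Suc[of k r s]] top Suc
        by (auto simp: refine_space_def)
      fix j assume j: "j \<in> {..<k}"
      show "(\<lambda>c. decode_Suc k r s (c (Suc s)) j) \<in> obs_algebra k r I \<rightarrow>\<^sub>M borel_of (weak_topology (wl_M k r s))"
      proof (rule measurable_borel_of_weak[OF embeddable_wl_M])
        show "(\<lambda>c. decode_Suc k r s (c (Suc s)) j) \<in> obs_algebra k r I \<rightarrow>\<^sub>M prob_algebra (borel_of (wl_M k r s))"
        proof (rule measurable_kernel_multiplicative[where H = "obs k r ` {t. wf_tm k t \<and> {..lev t} \<subseteq> {..s}}"])
          show "(\<lambda>c. g c * h c) \<in> obs k r ` {t. wf_tm k t \<and> {..lev t} \<subseteq> {..s}}"
            if "g \<in> obs k r ` {t. wf_tm k t \<and> {..lev t} \<subseteq> {..s}}"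
              "h \<in> obs k r ` {t. wf_tm k t \<and> {..lev t} \<subseteq> {..s}}" for g h
            using that by (rule obs_family_mult_closed)
          have "obs k r One \<in> obs k r ` {t. wf_tm k t \<and> {..lev t} \<subseteq> {..s}}" by (intro imageI) simp
          then show "(\<lambda>_. 1) \<in> obs k r ` {t. wf_tm k t \<and> {..lev t} \<subseteq> {..s}}" by (simp only: obs_One)
          show "sets (borel_of (wl_M k r s)) \<subseteq> sigma_sets (space (borel_of (wl_M k r s)))
            {{c \<in> space (borel_of (wl_M k r s)). a < h c} | a h. h \<in> obs k r ` {t. wf_tm k t \<and> {..lev t} \<subseteq> {..s}}}"
            using gen unfolding obs_algebra_simps(2) obs_sets_def borel_of_simps(1) wl_M_def .
          show "decode_Suc k r s (c (Suc s)) j \<in> space (prob_algebra (borel_of (wl_M k r s)))"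
            if "c \<in> space (obs_algebra k r I)" for c
            unfolding space_prob_algebra_borel_of using that j top Suc by (intro decode_Suc_mem) auto
          fix h assume "h \<in> obs k r ` {t. wf_tm k t \<and> {..lev t} \<subseteq> {..s}}"
          then obtain t where t: "wf_tm k t" "lev t \<le> s" "h = obs k r t" by auto
          show "h \<in> borel_measurable (borel_of (wl_M k r s))"
            unfolding t(3) wl_M_def using t by (intro obs_measurable) auto
          show "\<exists>B. \<forall>c\<in>space (borel_of (wl_M k r s)). \<bar>h c\<bar> \<le> B"
            unfolding t(3) using t by (intro exI[of _ "bd r t"] ballI obs_bound r) (auto simp: borel_of_simps topspace_wl_M)
          \<comment> \<open>The padding \<open>s - lev t\<close> lifts the integral of a term of any
            level up to \<open>s\<close> to level exactly \<open>Suc s\<close>, where the measure in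
            question is stored.\<close>
          have "obs k r (Integ (s - lev t) j t) \<in> borel_measurable (obs_algebra k r I)"
            using t j less.prems Suc by (intro obs_measurable_obs_algebra) auto
          then show "(\<lambda>c. \<integral>c'. h c' \<partial>decode_Suc k r s (c (Suc s)) j) \<in> borel_measurable (obs_algebra k r I)"
            using t by (simp add: obs_Integ)
        qed
      qed
    qed auto
    from measurable_compose[OF this measurable_borel_of_continuous[OF continuous_map_code[OF embeddable_refine_space]]]
    have "(\<lambda>c. code (refine_space k (wl_M k r s)) (decode_Suc k r s (c (Suc s)))) \<in>
        obs_algebra k r I \<rightarrow>\<^sub>M borel_of (wl_P k r (Suc s))"
      unfolding wl_P_Suc .
    moreover have "code (refine_space k (wl_M k r s)) (decode_Suc k r s (c (Suc s))) = c (Suc s)"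
      if "c \<in> space (obs_algebra k r I)" for c using that Suc by (intro code_decode_Suc top) auto
    ultimately show ?thesis unfolding Suc by (simp only: cong: measurable_cong)
  qed
qed

lemma obs_generate:
  assumes "r > 0" "\<And>i. i \<in> I \<Longrightarrow> {..i} \<subseteq> I"
  shows "sets (borel_of (product_topology (wl_P k r) I)) \<subseteq>
    sigma_sets (topspace (product_topology (wl_P k r) I)) (obs_sets k r I)"
  using obs_generate_of_coordinates[OF coordinate_measurable_obs_algebra[OF assms]]
  unfolding obs_algebra_simps .

text \<open>Observables generate the Borel sets, so it is enough to test a map against them. This is
  how the colorings themselves are shown to be measurable.\<close>

lemma measurable_into_colors:
  assumes "r > 0" "\<And>i. i \<in> I \<Longrightarrow> {..i} \<subseteq> I"
    and G: "G \<in> space N \<rightarrow> topspace (product_topology (wl_P k r) I)"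
    and obs: "\<And>t. wf_tm k t \<Longrightarrow> {..lev t} \<subseteq> I \<Longrightarrow> (\<lambda>x. obs k r t (G x)) \<in> borel_measurable N"
  shows "G \<in> N \<rightarrow>\<^sub>M borel_of (product_topology (wl_P k r) I)"
proof -
  have "G \<in> N \<rightarrow>\<^sub>M obs_algebra k r I"
    unfolding obs_algebra_def
  proof (rule measurable_measure_of)
    show "obs_sets k r I \<subseteq> Pow (topspace (product_topology (wl_P k r) I))" by (auto simp: obs_sets_def)
    fix A assume "A \<in> obs_sets k r I"
    then obtain a t where t: "wf_tm k t" "{..lev t} \<subseteq> I"
      "A = {c \<in> topspace (product_topology (wl_P k r) I). a < obs k r t c}"
      unfolding obs_sets_def by blast
    have "G -` A \<inter> space N = {x \<in> space N. a < obs k r t (G x)}" using G unfolding t(3) by blast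
    also have "\<dots> \<in> sets N" using obs[OF t(1,2)] by simp
    finally show "G -` A \<inter> space N \<in> sets N" .
  qed fact
  moreover have "(\<lambda>c. c) \<in> obs_algebra k r I \<rightarrow>\<^sub>M borel_of (product_topology (wl_P k r) I)"
  proof (rule measurableI)
    fix A assume A: "A \<in> sets (borel_of (product_topology (wl_P k r) I))"
    then have "A \<subseteq> topspace (product_topology (wl_P k r) I)"
      using sets.sets_into_space[OF A] by (simp add: borel_of_simps)
    then show "(\<lambda>c. c) -` A \<inter> space (obs_algebra k r I) \<in> sets (obs_algebra k r I)"
      using obs_generate[OF assms(1,2)] A by (auto simp: obs_algebra_simps Int_absorb2)
  qed (simp add: obs_algebra_simps borel_of_simps)
  ultimately show ?thesis by (rule measurable_compose)
qed

section \<open>The colors of a graphon-signal\<close>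

lemma clip_id: "\<bar>t\<bar> \<le> r \<Longrightarrow> clip r t = t"
  by (auto simp: clip_def)

lemma clip_bound: "r > 0 \<Longrightarrow> \<bar>clip r t\<bar> \<le> r"
  by (auto simp: clip_def)

lemma edge_value_doubleton:
  assumes "graphon W" "x i \<in> {0..1}" "x j \<in> {0..1}" "i \<noteq> j"
  shows "edge_value W x {i, j} = W (x i) (x j)"
proof -
  have "W (x i) (x j) = W (x j) (x i)" using assms unfolding graphon_def by blast
  moreover have "{Min {i, j}, Max {i, j}} = {i, j}" "Min {i, j} = min i j" "Max {i, j} = max i j"
    by (auto simp: min_def max_def)
  ultimately show ?thesis by (auto simp: edge_value_def min_def max_def)
qed

lemma measurable_fun_upd_cube:
  assumes "x \<in> J \<rightarrow>\<^sub>E {0..1}" "j \<in> J"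
  shows "(\<lambda>y. x(j := y)) \<in> unit_lebesgue \<rightarrow>\<^sub>M cube J"
proof (rule measurable_PiM_single')
  show "(\<lambda>y. (x(j := y)) i) \<in> unit_lebesgue \<rightarrow>\<^sub>M unit_lebesgue" if "i \<in> J" for i
    using assms PiE_mem[OF assms(1) that] by (cases "i = j") auto
  show "(\<lambda>y. x(j := y)) \<in> space unit_lebesgue \<rightarrow> (\<Pi>\<^sub>E i\<in>J. space unit_lebesgue)"
    using assms by (auto simp: PiE_iff extensional_def)
qed

lemma fun_upd_cube: "x \<in> J \<rightarrow>\<^sub>E {0..1} \<Longrightarrow> j \<in> J \<Longrightarrow> y \<in> {0..1::real} \<Longrightarrow> x(j := y) \<in> J \<rightarrow>\<^sub>E {0..1}"
  by (auto simp: PiE_iff extensional_def)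

lemma wl_color_coordinate: "i \<le> s \<Longrightarrow> wl_color k r W f s x i = wl_color k r W f i x i"
  by (induction s) (auto simp: le_Suc_eq)

lemma code_mem: "embeddable X \<Longrightarrow> z \<in> topspace X \<Longrightarrow> code X z \<in> topspace (recode X)"
  by (simp add: topspace_recode)

lemma measurable_of_obs_eq_sem:
  assumes S: "bounded_signal r W f" and r: "r > 0" and I: "\<And>i. i \<in> I \<Longrightarrow> {..i} \<subseteq> I"
    and G: "\<And>x. x \<in> {..<k} \<rightarrow>\<^sub>E {0..1} \<Longrightarrow> G x \<in> topspace (product_topology (wl_P k r) I)"
    and obs: "\<And>t x. wf_tm k t \<Longrightarrow> {..lev t} \<subseteq> I \<Longrightarrow> x \<in> {..<k} \<rightarrow>\<^sub>E {0..1} \<Longrightarrow>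
      obs k r t (G x) = sem t W f x"
  shows "G \<in> cube {..<k} \<rightarrow>\<^sub>M borel_of (product_topology (wl_P k r) I)"
proof (rule measurable_into_colors[OF r I])
  show "G \<in> space (cube {..<k}) \<rightarrow> topspace (product_topology (wl_P k r) I)"
    using G unfolding space_cube by blast
  fix t assume t: "wf_tm k t" "{..lev t} \<subseteq> I"
  have "sem t W f \<in> borel_measurable (cube {..<k})" by (rule sem_measurable[OF S wf_tm_fv[OF t(1)]])
  moreover have "obs k r t (G x) = sem t W f x" if "x \<in> space (cube {..<k})" for x
    using that unfolding space_cube by (rule obs[OF t])
  ultimately show "(\<lambda>x. obs k r t (G x)) \<in> borel_measurable (cube {..<k})"
    by (simp only: cong: measurable_cong)
qed

text \<open>The two claims support each other. Measurability at level \<open>s\<close> turns an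
  integral against the pushforward into an integral over the moved variable, which gives the values
  of the terms at level \<open>Suc s\<close>; these are measurable by \<open>sem_measurable\<close>,
  which gives measurability at level \<open>Suc s\<close>.\<close>

lemma wl_color_correct:
  assumes S: "bounded_signal r W f" and r: "r > 0"
  shows "wl_color k r W f s \<in> cube {..<k} \<rightarrow>\<^sub>M borel_of (wl_M k r s) \<and>
    (\<forall>t x. wf_tm k t \<longrightarrow> lev t \<le> s \<longrightarrow> x \<in> {..<k} \<rightarrow>\<^sub>E {0..1} \<longrightarrow>
      obs k r t (wl_color k r W f s x) = sem t W f x)"
proof (induction s)
  case 0
  have init: "(\<lambda>e\<in>pairs k. edge_value W x e, \<lambda>j\<in>{..<k}. clip r (f (x j))) \<in> topspace (init_space k r)"
    if x: "x \<in> {..<k} \<rightarrow>\<^sub>E {0..1}" for x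
  proof -
    have "edge_value W x e \<in> {0..1}" if e: "e \<in> pairs k" for e
    proof -
      obtain i j where ij: "e = {i, j}" "i \<noteq> j" "i < k" "j < k"
        using pairsE[OF e] .
      have x': "x i \<in> {0..1}" "x j \<in> {0..1}" by (rule PiE_mem[OF x], use ij in simp)+
      have "graphon W" using S by (simp add: bounded_signal_def)
      from edge_value_doubleton[OF this x' ij(2)] bounded_signalD(5)[OF S x']
      show ?thesis by (simp add: ij(1))
    qed
    moreover have "clip r (f (x j)) \<in> {-r..r}" for j using clip_bound[OF r, of "f (x j)"] by auto
    ultimately show ?thesis by (auto simp: topspace_init_space)
  qed
  have obs: "obs k r t (wl_color k r W f 0 x) = sem t W f x"
    if "wf_tm k t" "lev t \<le> 0" "x \<in> {..<k} \<rightarrow>\<^sub>E {0..1}" for t x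
    using that
  proof (induction t)
    case (Sig j)
    have "\<bar>f (x j)\<bar> \<le> r"
      by (rule bounded_signalD(3)[OF S PiE_mem[OF Sig.prems(3)]]) (use Sig.prems(1) in simp)
    then show ?case using Sig decode_code_0[OF init[of x]] by (simp add: clip_id)
  next
    case (Edge i j)
    have x': "x i \<in> {0..1}" "x j \<in> {0..1}"
      by (rule PiE_mem[OF Edge.prems(3)], use Edge.prems(1) in simp)+
    have "graphon W" using S by (simp add: bounded_signal_def)
    then have "edge_value W x {i, j} = W (x i) (x j)"
      using Edge.prems(1) by (intro edge_value_doubleton x') auto
    then show ?case
      using Edge.prems decode_code_0[OF init[of x]] doubleton_in_pairs[of i k j] by simp
  qed auto
  have "wl_color k r W f 0 x \<in> topspace (product_topology (wl_P k r) {..0})"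
    if "x \<in> {..<k} \<rightarrow>\<^sub>E {0..1}" for x
    using code_mem[OF embeddable_init_space init[OF that]] by (simp add: wl_P.simps)
  then have "wl_color k r W f 0 \<in> cube {..<k} \<rightarrow>\<^sub>M borel_of (wl_M k r 0)"
    unfolding wl_M_def using obs by (intro measurable_of_obs_eq_sem[OF S r]) auto
  then show ?case using obs by blast
next
  case (Suc s)
  then have meas: "wl_color k r W f s \<in> cube {..<k} \<rightarrow>\<^sub>M borel_of (wl_M k r s)" 
    and IH: "\<And>t x. wf_tm k t \<Longrightarrow> lev t \<le> s \<Longrightarrow> x \<in> {..<k} \<rightarrow>\<^sub>E {0..1} \<Longrightarrow>
      obs k r t (wl_color k r W f s x) = sem t W f x" by blast+
  have upd: "(\<lambda>y. wl_color k r W f s (x(j := y))) \<in> unit_lebesgue \<rightarrow>\<^sub>M borel_of (wl_M k r s)"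
    if "x \<in> {..<k} \<rightarrow>\<^sub>E {0..1}" "j < k" for x j
    using measurable_compose[OF measurable_fun_upd_cube meas] that by auto
  define D where "D x = (\<lambda>j\<in>{..<k}. distr unit_lebesgue (borel_of (wl_M k r s))
           (\<lambda>y. wl_color k r W f s (x(j := y))))" for x
  have D: "D x \<in> topspace (refine_space k (wl_M k r s))" if x: "x \<in> {..<k} \<rightarrow>\<^sub>E {0..1}" for x
    unfolding topspace_refine_space D_def borel_probs_def
    using upd[OF x] unit_lebesgue.prob_space_distr by auto
  have color: "wl_color k r W f (Suc s) x =
      (wl_color k r W f s x)(Suc s := code (refine_space k (wl_M k r s)) (D x))" for x
    by (simp add: D_def)
  \<comment> \<open>Observables of level at most \<open>s\<close> do not read the coordinate added
    at this level.\<close>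
  have obs_s: "obs k r t (wl_color k r W f (Suc s) x) = sem t W f x"
    if "wf_tm k t" "lev t \<le> s" "x \<in> {..<k} \<rightarrow>\<^sub>E {0..1}" for t x
  proof -
    have "obs k r t (wl_color k r W f (Suc s) x) = obs k r t (wl_color k r W f s x)"
      by (rule obs_cong) (use that in simp)
    then show ?thesis using IH that by simp
  qed
  have obs: "obs k r t (wl_color k r W f (Suc s) x) = sem t W f x"
    if "wf_tm k t" "lev t \<le> Suc s" "x \<in> {..<k} \<rightarrow>\<^sub>E {0..1}" for t x
    using that
  proof (induction t)
    case (Integ n j t)
    show ?case
    proof (cases "n + lev t = s")
      case False
      then show ?thesis using Integ.prems by (intro obs_s) auto
    next
      \<comment> \<open>Here the new coordinate is read: its \<open>j\<close>-th measure is the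
        pushforward of the coloring along variable \<open>j\<close>.\<close>
      case True
      have j: "j < k" and t: "wf_tm k t" "lev t \<le> s" using Integ.prems True by auto
      have "obs k r (Integ n j t) (wl_color k r W f (Suc s) x) =
          (\<integral>c. obs k r t c \<partial>decode_Suc k r s (wl_color k r W f (Suc s) x (Suc s)) j)"
        by (simp only: obs.simps True)
      also have "decode_Suc k r s (wl_color k r W f (Suc s) x (Suc s)) j =
          distr unit_lebesgue (borel_of (wl_M k r s)) (\<lambda>y. wl_color k r W f s (x(j := y)))"
        using j unfolding color fun_upd_same decode_code_Suc[OF D[OF Integ.prems(3)]] by (simp add: D_def)
      also have "(\<integral>c. obs k r t c \<partial>\<dots>) = (\<integral>y. obs k r t (wl_color k r W f s (x(j := y))) \<partial>unit_lebesgue)"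
        using obs_measurable[of k t "{..s}" r] t
        by (intro integral_distr upd Integ.prems j) (auto simp: wl_M_def)
      also have "\<dots> = (\<integral>y. sem t W f (x(j := y)) \<partial>unit_lebesgue)"
        using Integ.prems j t
        by (intro Bochner_Integration.integral_cong refl IH fun_upd_cube) auto
      finally show ?thesis by simp
    qed
  next
    case (Mul t u)
    then show ?case by (simp del: wl_color.simps)
  qed (rule obs_s; simp)+
  have "wl_color k r W f (Suc s) x \<in> topspace (product_topology (wl_P k r) {..Suc s})"
    if x: "x \<in> {..<k} \<rightarrow>\<^sub>E {0..1}" for x
  proof -
    have "wl_color k r W f s x \<in> (\<Pi>\<^sub>E i\<in>{..s}. topspace (wl_P k r i))"
      using measurable_space[OF meas, of x] x unfolding borel_of_simps space_cube topspace_wl_M .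
    moreover have "code (refine_space k (wl_M k r s)) (D x) \<in> topspace (wl_P k r (Suc s))"
      unfolding wl_P_Suc by (rule code_mem[OF embeddable_refine_space D[OF x]])
    ultimately show ?thesis
      unfolding color by (auto simp: PiE_iff extensional_def le_Suc_eq)
  qed
  then have "wl_color k r W f (Suc s) \<in> cube {..<k} \<rightarrow>\<^sub>M borel_of (wl_M k r (Suc s))"
    unfolding wl_M_def using obs by (intro measurable_of_obs_eq_sem[OF S r]) auto
  then show ?case using obs by blast
qed

lemma wl_color_all_correct:
  assumes S: "bounded_signal r W f" and r: "r > 0"
  shows "wl_color_all k r W f \<in> cube {..<k} \<rightarrow>\<^sub>M borel_of (wl_M_all k r)"
    and "wf_tm k t \<Longrightarrow> x \<in> {..<k} \<rightarrow>\<^sub>E {0..1} \<Longrightarrow> obs k r t (wl_color_all k r W f x) = sem t W f x"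
proof -
  have obs: "obs k r t (wl_color_all k r W f x) = sem t W f x"
    if "wf_tm k t" "x \<in> {..<k} \<rightarrow>\<^sub>E {0..1}" for t x
  proof -
    \<comment> \<open>Colorings of different levels share their common coordinates, so level
      \<open>lev t\<close> already contains everything that the term reads.\<close>
    have "obs k r t (wl_color_all k r W f x) = obs k r t (wl_color k r W f (lev t) x)"
      unfolding wl_color_all_def by (rule obs_cong) (rule wl_color_coordinate[symmetric])
    then show ?thesis using wl_color_correct[OF S r, of k "lev t"] that by simp
  qed
  then show "wf_tm k t \<Longrightarrow> x \<in> {..<k} \<rightarrow>\<^sub>E {0..1} \<Longrightarrow> obs k r t (wl_color_all k r W f x) = sem t W f x" .
  have "wl_color_all k r W f x \<in> topspace (product_topology (wl_P k r) UNIV)"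
    if "x \<in> {..<k} \<rightarrow>\<^sub>E {0..1}" for x
  proof -
    have "wl_color k r W f s x \<in> (\<Pi>\<^sub>E i\<in>{..s}. topspace (wl_P k r i))" for s
      using measurable_space[OF conjunct1[OF wl_color_correct[OF S r, of k s]], of x] that
      unfolding borel_of_simps space_cube topspace_wl_M .
    then have "wl_color k r W f s x s \<in> topspace (wl_P k r s)" for s by (rule PiE_mem) simp
    then show ?thesis by (simp add: wl_color_all_def PiE_iff)
  qed
  then show "wl_color_all k r W f \<in> cube {..<k} \<rightarrow>\<^sub>M borel_of (wl_M_all k r)"
    unfolding wl_M_all_def using obs by (intro measurable_of_obs_eq_sem[OF S r]) auto
qed

text \<open>Integrating an observable against the distribution means integrating its term over the
  cube. The observables are bounded, closed under products and generate the Borel sets, so these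
  numbers determine the distribution.\<close>

lemma wl_distribution_eq_iff_terms:
  assumes W: "bounded_signal r W f" and V: "bounded_signal r V g" and r: "r > 0"
  shows "wl_distribution k r W f = wl_distribution k r V g \<longleftrightarrow>
    (\<forall>t. wf_tm k t \<longrightarrow> (\<integral>x. sem t W f x \<partial>cube {..<k}) = (\<integral>x. sem t V g x \<partial>cube {..<k}))"
proof -
  let ?H = "obs k r ` {t. wf_tm k t \<and> {..lev t} \<subseteq> UNIV}"
  have meas: "obs k r t \<in> borel_measurable (borel_of (wl_M_all k r))" if "wf_tm k t" for t
    unfolding wl_M_all_def using that by (intro obs_measurable) auto
  have int: "(\<integral>c. obs k r t c \<partial>wl_distribution k r W f) = (\<integral>x. sem t W f x \<partial>cube {..<k})"
    if S: "bounded_signal r W f" and t: "wf_tm k t" for t W f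
  proof -
    have "(\<integral>c. obs k r t c \<partial>wl_distribution k r W f) =
        (\<integral>x. obs k r t (wl_color_all k r W f x) \<partial>cube {..<k})"
      unfolding wl_distribution_def
      by (rule integral_distr[OF wl_color_all_correct(1)[OF S r] meas[OF t]])
    also have "\<dots> = (\<integral>x. sem t W f x \<partial>cube {..<k})"
      by (intro Bochner_Integration.integral_cong refl wl_color_all_correct(2)[OF S r t]) (simp add: space_cube)
    finally show ?thesis .
  qed
  have prob: "wl_distribution k r W f \<in> space (prob_algebra (borel_of (wl_M_all k r)))"
    if S: "bounded_signal r W f" for W f
    unfolding wl_distribution_def
    using prob_space.prob_space_distr[OF prob_space_cube wl_color_all_correct(1)[OF S r]]
    by (simp add: space_prob_algebra)
  show ?thesis
  proof
    assume "wl_distribution k r W f = wl_distribution k r V g"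
    then show "\<forall>t. wf_tm k t \<longrightarrow> (\<integral>x. sem t W f x \<partial>cube {..<k}) = (\<integral>x. sem t V g x \<partial>cube {..<k})"
      using int[OF W] int[OF V] by metis
  next
    assume eq: "\<forall>t. wf_tm k t \<longrightarrow> (\<integral>x. sem t W f x \<partial>cube {..<k}) = (\<integral>x. sem t V g x \<partial>cube {..<k})"
    show "wl_distribution k r W f = wl_distribution k r V g"
    proof (rule prob_measure_eqI_multiplicative[where H = ?H])
      show "(\<lambda>c. g c * h c) \<in> ?H" if "g \<in> ?H" "h \<in> ?H" for g h
        using that by (rule obs_family_mult_closed)
      have "obs k r One \<in> ?H" by (intro imageI) simp
      then show "(\<lambda>_. 1) \<in> ?H" by (simp only: obs_One)
      show "sets (borel_of (wl_M_all k r)) \<subseteq> sigma_sets (space (borel_of (wl_M_all k r)))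
          {{c \<in> space (borel_of (wl_M_all k r)). a < h c} | a h. h \<in> ?H}"
        using obs_generate[OF r, of UNIV k] unfolding obs_sets_def borel_of_simps(1) wl_M_all_def by simp
      show "wl_distribution k r W f \<in> space (prob_algebra (borel_of (wl_M_all k r)))"
        "wl_distribution k r V g \<in> space (prob_algebra (borel_of (wl_M_all k r)))"
        using prob W V by auto
      fix h assume "h \<in> ?H"
      then obtain t where t: "wf_tm k t" "h = obs k r t" by auto
      show "h \<in> borel_measurable (borel_of (wl_M_all k r))" unfolding t(2) by (rule meas[OF t(1)])
      show "\<exists>B. \<forall>c\<in>space (borel_of (wl_M_all k r)). \<bar>h c\<bar> \<le> B"
        unfolding t(2) using t(1)
        by (intro exI[of _ "bd r t"] ballI obs_bound r) (auto simp: borel_of_simps wl_M_all_def)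
      show "(\<integral>c. h c \<partial>wl_distribution k r W f) = (\<integral>c. h c \<partial>wl_distribution k r V g)"
        unfolding t(2) int[OF W t(1)] int[OF V t(1)] using eq t(1) by blast
    qed
  qed
qed

text \<open>The signal enters the colors only through \<open>clip r\<close>, which is
  idempotent.\<close>

lemma wl_distribution_clip:
  assumes "r > 0"
  shows "wl_distribution k r W (\<lambda>x. clip r (f x)) = wl_distribution k r W f"
proof -
  have "clip r (clip r t) = clip r t" for t using assms by (intro clip_id clip_bound)
  then have "wl_color k r W (\<lambda>x. clip r (f x)) s x = wl_color k r W f s x" for s x
    by (induction s arbitrary: x) auto
  then show ?thesis by (simp add: wl_distribution_def wl_color_all_def[abs_def])
qed

section \<open>Adding vertices to a tree decomposition one at a time\<close>

text \<open>
  \<open>kext k V\<^sub>0 B\<^sub>0 V B\<close>: vertex set \<open>V\<close> and bags \<open>B\<close> arise from \<open>V\<^sub>0\<close>, \<open>B\<^sub>0\<close> by successively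
  adding a new vertex together with a bag that consists of it and of fewer than \<open>k\<close> vertices of
  an existing bag.  A graph has treewidth \<open>\<le> k - 1\<close> iff its edges lie in such bags.
\<close>

inductive kext :: "nat \<Rightarrow> 'v set \<Rightarrow> 'v set set \<Rightarrow> 'v set \<Rightarrow> 'v set set \<Rightarrow> bool" for k V\<^sub>0 B\<^sub>0 where
  kext_refl: "kext k V\<^sub>0 B\<^sub>0 V\<^sub>0 B\<^sub>0"
| kext_step: "kext k V\<^sub>0 B\<^sub>0 V B \<Longrightarrow> b \<in> B \<Longrightarrow> S \<subseteq> b \<Longrightarrow> v \<notin> V \<Longrightarrow> card S < k \<Longrightarrow>
    kext k V\<^sub>0 B\<^sub>0 (insert v V) (insert (insert v S) B)"

lemma kext_trans:
  assumes "kext k V\<^sub>1 B\<^sub>1 V\<^sub>2 B\<^sub>2" "kext k V\<^sub>0 B\<^sub>0 V\<^sub>1 B\<^sub>1" shows "kext k V\<^sub>0 B\<^sub>0 V\<^sub>2 B\<^sub>2"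
  using assms by (induction rule: kext.induct) (auto intro: kext_step)

lemma kext_subset: "kext k V\<^sub>0 B\<^sub>0 V B \<Longrightarrow> V\<^sub>0 \<subseteq> V \<and> B\<^sub>0 \<subseteq> B"
  by (induction rule: kext.induct) auto

lemma kext_bags:
  assumes "kext k V\<^sub>0 B\<^sub>0 V B" "\<And>b. b \<in> B\<^sub>0 \<Longrightarrow> finite b \<and> b \<subseteq> V\<^sub>0" "b \<in> B"
  shows "finite b \<and> b \<subseteq> V"
  using assms(1,3)
proof (induction arbitrary: b rule: kext.induct)
  case (kext_step V B b' S v)
  then have "finite b'" "b' \<subseteq> V" by blast+
  then have "finite S" "S \<subseteq> V" using kext_step.hyps finite_subset by auto
  then show ?case using kext_step.IH[of b] kext_step.prems by auto
qed (use assms(2) in blast)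

lemma kext_finite: "kext k V\<^sub>0 B\<^sub>0 V B \<Longrightarrow> finite V\<^sub>0 \<Longrightarrow> finite B\<^sub>0 \<Longrightarrow> finite V \<and> finite B"
  by (induction rule: kext.induct) auto

text \<open>Each step refers only to a bag that is already present, so the steps can be replayed
  from a larger start as long as the added vertices are still new there. This glues two graphs along
  a common part.\<close>

lemma kext_mono:
  assumes "kext k V\<^sub>0 B\<^sub>0 V B" "V\<^sub>0 \<subseteq> V'" "B\<^sub>0 \<subseteq> B'" "(V - V\<^sub>0) \<inter> V' = {}"
  shows "kext k V' B' (V' \<union> V) (B' \<union> B)"
  using assms(1,4)
proof (induction rule: kext.induct)
  case kext_refl
  then show ?case using assms(2,3) kext.kext_refl[of k V' B'] by (simp add: Un_absorb2)
next
  case (kext_step V B b S v)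
  have "v \<notin> V'" using kext_step.prems kext_step.hyps kext_subset[OF kext_step.hyps(1)] by auto
  moreover have "kext k V' B' (V' \<union> V) (B' \<union> B)" using kext_step.prems by (intro kext_step.IH) auto
  ultimately have "kext k V' B' (insert v (V' \<union> V)) (insert (insert v S) (B' \<union> B))"
    using kext_step.hyps by (intro kext.kext_step[of k V' B' _ _ b]) auto
  then show ?case by simp
qed

text \<open>The vertices of \<open>Q\<close> are attached one by one, each to all of
  \<open>S\<close> and to the earlier ones. What is carried over has fewer than \<open>k\<close>
  elements at every step because the final set has at most \<open>k\<close>.\<close>

lemma kext_add_vertices:
  assumes "finite Q" "b \<in> B" "S \<subseteq> b" "finite S" "Q \<inter> V = {}" "card (S \<union> Q) \<le> k" "S \<inter> Q = {}"
  shows "\<exists>B'. kext k V B (V \<union> Q) B' \<and> (\<exists>b'\<in>B'. S \<union> Q \<subseteq> b')"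
  using assms(1,5-)
proof (induction Q rule: finite_induct)
  case empty
  then show ?case using assms(2,3) kext_refl[of k V B] by auto
next
  case (insert q Q)
  have c: "card (S \<union> insert q Q) = Suc (card (S \<union> Q))" using insert.hyps insert.prems assms(4) by simp
  have "\<exists>B'. kext k V B (V \<union> Q) B' \<and> (\<exists>b'\<in>B'. S \<union> Q \<subseteq> b')"
    using insert.prems c by (intro insert.IH) auto
  then obtain B' b' where B': "kext k V B (V \<union> Q) B'" "b' \<in> B'" "S \<union> Q \<subseteq> b'" by blast
  have "kext k V B (insert q (V \<union> Q)) (insert (insert q (S \<union> Q)) B')"
    using insert.hyps insert.prems c by (intro kext_step[OF B'(1,2,3)]) auto
  then show ?case by (intro exI[of _ "insert (insert q (S \<union> Q)) B'"]) auto
qed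


section \<open>Iterated integrals\<close>

text \<open>Compared with an integral over \<open>cube\<close>, this keeps the remaining coordinates
  of \<open>x\<close> as parameters, namely the values at the labelled vertices, and works with
  total instead of extensional functions. The head of the list is the outermost variable.\<close>

primrec iter :: "nat list \<Rightarrow> ((nat \<Rightarrow> real) \<Rightarrow> real) \<Rightarrow> (nat \<Rightarrow> real) \<Rightarrow> real" where
  "iter [] \<Phi> x = \<Phi> x"
| "iter (v # vs) \<Phi> x = (\<integral>y. iter vs \<Phi> (x(v := y)) \<partial>unit_lebesgue)"

lemma iter_append: "iter (us @ vs) \<Phi> x = iter us (iter vs \<Phi>) x"
  by (induction us arbitrary: x) auto

lemma iter_cong:
  "(\<And>z. (\<And>v. v \<in> set vs \<Longrightarrow> z v \<in> {0..1}) \<Longrightarrow> (\<And>v. v \<notin> set vs \<Longrightarrow> z v = x v) \<Longrightarrow> \<Phi> z = \<Psi> z) \<Longrightarrow>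
    iter vs \<Phi> x = iter vs \<Psi> x"
proof (induction vs arbitrary: x)
  case (Cons v vs)
  have "iter vs \<Phi> (x(v := y)) = iter vs \<Psi> (x(v := y))" if y: "y \<in> {0..1}" for y
  proof (rule Cons.IH)
    fix z assume z: "\<And>u. u \<in> set vs \<Longrightarrow> z u \<in> {0..1}" "\<And>u. u \<notin> set vs \<Longrightarrow> z u = (x(v := y)) u"
    show "\<Phi> z = \<Psi> z"
    proof (rule Cons.prems)
      show "z u \<in> {0..1}" if "u \<in> set (v # vs)" for u
        using z(1)[of u] z(2)[of u] that y by (cases "u \<in> set vs") auto
      show "z u = x u" if "u \<notin> set (v # vs)" for u using z(2)[of u] that by auto
    qed
  qed
  then show ?case by (auto intro!: Bochner_Integration.integral_cong)
qed simp

definition indep_of :: "nat \<Rightarrow> ((nat \<Rightarrow> real) \<Rightarrow> real) \<Rightarrow> bool" where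
  "indep_of v \<Phi> \<longleftrightarrow> (\<forall>x y. \<Phi> (x(v := y)) = \<Phi> x)"

lemma iter_indep: "indep_of v \<Phi> \<Longrightarrow> v \<notin> set vs \<Longrightarrow> iter vs \<Phi> (x(v := y)) = iter vs \<Phi> x"
proof (induction vs arbitrary: x)
  case (Cons u vs)
  have "iter vs \<Phi> ((x(v := y))(u := z)) = iter vs \<Phi> (x(u := z))" for z
  proof -
    have tw: "(x(v := y))(u := z) = (x(u := z))(v := y)" using Cons.prems by (intro fun_upd_twist) auto
    show ?thesis unfolding tw by (rule Cons.IH) (use Cons.prems in auto)
  qed
  then show ?case by (simp only: iter.simps)
qed (simp add: indep_of_def)

lemma iter_mult_left:
  "(\<And>v. v \<in> set vs \<Longrightarrow> indep_of v \<Phi>) \<Longrightarrow> \<Phi> x * iter vs \<Psi> x = iter vs (\<lambda>x. \<Phi> x * \<Psi> x) x"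
proof (induction vs arbitrary: x)
  case (Cons v vs)
  have eq: "\<Phi> (x(v := y)) = \<Phi> x" for y using Cons.prems[of v] by (simp add: indep_of_def)
  have "\<Phi> (x(v := y)) * iter vs \<Psi> (x(v := y)) = iter vs (\<lambda>x. \<Phi> x * \<Psi> x) (x(v := y))" for y
    by (rule Cons.IH) (use Cons.prems in auto)
  then have "\<Phi> x * iter vs \<Psi> (x(v := y)) = iter vs (\<lambda>x. \<Phi> x * \<Psi> x) (x(v := y))" for y
    unfolding eq .
  then show ?case by (simp flip: integral_mult_right_zero)
qed simp

text \<open>The variables separate, so each factor is a constant for the integrals of the other.
  Pulling a constant out of a Bochner integral is an identity that also respects the default value 0
  of non-integrable functions.\<close>

lemma iter_mult:
  assumes "\<And>v. v \<in> set vs \<Longrightarrow> indep_of v \<Phi>" "\<And>u. u \<in> set us \<Longrightarrow> indep_of u \<Psi>" "set us \<inter> set vs = {}"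
  shows "iter us \<Phi> x * iter vs \<Psi> x = iter (us @ vs) (\<lambda>x. \<Phi> x * \<Psi> x) x"
  using assms(2,3)
proof (induction us arbitrary: x)
  case Nil
  then show ?case using iter_mult_left[OF assms(1)] by simp
next
  case (Cons u us)
  have eq: "iter vs \<Psi> (x(u := y)) = iter vs \<Psi> x" for y using Cons.prems by (intro iter_indep) auto
  have "iter us \<Phi> (x(u := y)) * iter vs \<Psi> (x(u := y)) = iter (us @ vs) (\<lambda>x. \<Phi> x * \<Psi> x) (x(u := y))" for y
    by (rule Cons.IH) (use Cons.prems in auto)
  then have "iter us \<Phi> (x(u := y)) * iter vs \<Psi> x = iter (us @ vs) (\<lambda>x. \<Phi> x * \<Psi> x) (x(u := y))" for y
    unfolding eq .
  then show ?case by (simp flip: integral_mult_left_zero)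
qed

section \<open>Iterated integrals and the product measure\<close>

lemma integrable_cube_bounded:
  fixes \<Phi> :: "(nat \<Rightarrow> real) \<Rightarrow> real"
  assumes "\<Phi> \<in> borel_measurable (cube J)" "\<And>x. x \<in> J \<rightarrow>\<^sub>E {0..1} \<Longrightarrow> \<bar>\<Phi> x\<bar> \<le> B"
  shows "integrable (cube J) \<Phi>"
proof -
  interpret prob_space "cube J" by (rule prob_space_cube)
  show ?thesis
  proof (rule integrable_const_bound[OF AE_I2 assms(1)])
    show "norm (\<Phi> x) \<le> B" if "x \<in> space (cube J)" for x using assms(2) that by (simp add: space_cube)
  qed
qed

text \<open>The induction removes the last variable of the list, since its integral is the innermost
  one and \<open>product_integral_insert\<close> places the inserted variable there. The start
  \<open>\<lambda>_. undefined\<close> is the only point of the empty product.\<close>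

lemma integral_cube_iter:
  assumes "distinct vs" "\<Phi> \<in> borel_measurable (cube (set vs))"
    "\<And>x. x \<in> set vs \<rightarrow>\<^sub>E {0..1} \<Longrightarrow> \<bar>\<Phi> x\<bar> \<le> B"
  shows "(\<integral>x. \<Phi> x \<partial>cube (set vs)) = iter vs \<Phi> (\<lambda>_. undefined)"
  using assms
proof (induction vs arbitrary: \<Phi> rule: rev_induct)
  case Nil
  then show ?case by (simp add: PiM_empty lebesgue_integral_count_space_finite)
next
  case (snoc v vs)
  let ?\<Psi> = "\<lambda>x. \<integral>y. \<Phi> (x(v := y)) \<partial>unit_lebesgue"
  have set: "set (vs @ [v]) = insert v (set vs)" by simp
  have "(\<integral>x. \<Phi> x \<partial>cube (insert v (set vs))) = (\<integral>x. ?\<Psi> x \<partial>cube (set vs))"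
    using snoc.prems unfolding set by (intro cube.product_integral_insert integrable_cube_bounded[where B = B]) auto
  also have "\<dots> = iter vs ?\<Psi> (\<lambda>_. undefined)"
  proof (rule snoc.IH)
    have "(\<lambda>(x, y). x(v := y)) \<in> cube (set vs) \<Otimes>\<^sub>M unit_lebesgue \<rightarrow>\<^sub>M cube (insert v (set vs))"
      by (rule measurable_add_dim)
    then have "(\<lambda>p. \<Phi> ((\<lambda>(x, y). x(v := y)) p)) \<in> borel_measurable (cube (set vs) \<Otimes>\<^sub>M unit_lebesgue)"
      using snoc.prems(2) unfolding set by (rule measurable_compose)
    then have "(\<lambda>(x, y). \<Phi> (x(v := y))) \<in> borel_measurable (cube (set vs) \<Otimes>\<^sub>M unit_lebesgue)"
      by (simp add: case_prod_beta)
    then show "?\<Psi> \<in> borel_measurable (cube (set vs))"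
      by (rule unit_lebesgue.borel_measurable_lebesgue_integral)
    show "\<bar>?\<Psi> x\<bar> \<le> B" if x: "x \<in> set vs \<rightarrow>\<^sub>E {0..1}" for x
    proof (rule abs_integral_le_const[OF prob_space_unit_lebesgue])
      fix y assume "y \<in> space unit_lebesgue"
      then have "x(v := y) \<in> set (vs @ [v]) \<rightarrow>\<^sub>E {0..1}"
        using x by (auto simp: PiE_iff extensional_def)
      then show "\<bar>\<Phi> (x(v := y))\<bar> \<le> B" by (rule snoc.prems(3))
    qed
  qed (use snoc.prems(1) in simp)
  also have "?\<Psi> = iter [v] \<Phi>" by (rule ext) (simp only: iter.simps)
  finally show ?case unfolding iter_append set .
qed


section \<open>From terms to graphs\<close>

definition gval :: "nat \<Rightarrow> nat set multiset \<Rightarrow> (nat \<Rightarrow> nat) \<Rightarrow> (real \<Rightarrow> real \<Rightarrow> real) \<Rightarrow> (real \<Rightarrow> real)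
    \<Rightarrow> (nat \<Rightarrow> real) \<Rightarrow> real" where
  "gval m E d W f x = (\<Prod>i<m. f (x i) ^ d i) * (\<Prod>e\<in>#E. edge_value W x e)"

lemma hom_density_gval: "hom_density m E d W f = (\<integral>x. gval m E d W f x \<partial>cube {..<m})"
  by (simp add: hom_density_def gval_def)

lemma gval_add: "gval m (E + E') (\<lambda>v. d v + d' v) W f x = gval m E d W f x * gval m E' d' W f x"
  by (simp add: gval_def power_add prod.distrib)

lemma Min_Max_in_edge:
  assumes "card e = 2" shows "Min e \<in> e" "Max e \<in> e"
proof -
  have "finite e" "e \<noteq> {}" using assms by (auto intro: card_ge_0_finite)
  then show "Min e \<in> e" "Max e \<in> e" by auto
qed

lemma gval_indep:
  assumes "d v = 0" "\<And>e. e \<in># E \<Longrightarrow> card e = 2 \<and> v \<notin> e"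
  shows "indep_of v (gval m E d W f)"
  unfolding indep_of_def
proof (intro allI)
  fix x y
  have "(\<Prod>i<m. f ((x(v := y)) i) ^ d i) = (\<Prod>i<m. f (x i) ^ d i)"
    by (rule prod.cong) (use assms(1) in auto)
  moreover have "edge_value W (x(v := y)) e = edge_value W x e" if "e \<in># E" for e
  proof -
    have "Min e \<noteq> v" "Max e \<noteq> v" using Min_Max_in_edge[of e] assms(2)[OF that] by auto
    then show ?thesis by (simp add: edge_value_def)
  qed
  then have "image_mset (edge_value W (x(v := y))) E = image_mset (edge_value W x) E"
    by (intro image_mset_cong)
  ultimately show "gval m E d W f (x(v := y)) = gval m E d W f x" by (simp add: gval_def)
qed

lemma gval_measurable:
  assumes W: "graphon W" and f: "f \<in> borel_measurable unit_lebesgue" and E: "multigraph m E"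
  shows "gval m E d W f \<in> borel_measurable (cube {..<m})"
proof -
  have "(\<lambda>x. f (x i)) \<in> borel_measurable (cube {..<m})" if "i < m" for i
  proof -
    have "(\<lambda>x. x i) \<in> cube {..<m} \<rightarrow>\<^sub>M unit_lebesgue" using that by (intro measurable_component_singleton) auto
    from measurable_compose[OF this f] show ?thesis .
  qed
  then have "(\<lambda>x. \<Prod>i<m. f (x i) ^ d i) \<in> borel_measurable (cube {..<m})"
    by (intro borel_measurable_prod borel_measurable_power) auto
  moreover have "(\<lambda>x. \<Prod>e\<in>#E. edge_value W x e) \<in> borel_measurable (cube {..<m})"
    using E
  proof (induction E)
    case (add e E)
    then have e: "e \<in> pairs m" and E: "multigraph m E" by (auto simp: multigraph_def)
    then have "card e = 2" "e \<subseteq> {..<m}" by (auto simp: pairs_def)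
    then have "Min e \<in> {..<m}" "Max e \<in> {..<m}" using Min_Max_in_edge[of e] by auto
    then have "(\<lambda>x. (x (Min e), x (Max e))) \<in> cube {..<m} \<rightarrow>\<^sub>M unit_lebesgue \<Otimes>\<^sub>M unit_lebesgue"
      by (intro measurable_Pair measurable_component_singleton)
    moreover have "(\<lambda>(x, y). W x y) \<in> borel_measurable (unit_lebesgue \<Otimes>\<^sub>M unit_lebesgue)"
      using W by (simp add: graphon_def)
    ultimately have "(\<lambda>x. case (x (Min e), x (Max e)) of (x, y) \<Rightarrow> W x y) \<in> borel_measurable (cube {..<m})"
      by (rule measurable_compose)
    then have "(\<lambda>x. edge_value W x e) \<in> borel_measurable (cube {..<m})" by (simp add: edge_value_def)
    then show ?case using add.IH[OF E] by simp
  qed simp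
  ultimately have "(\<lambda>x. (\<Prod>i<m. f (x i) ^ d i) * (\<Prod>e\<in>#E. edge_value W x e)) \<in> borel_measurable (cube {..<m})"
    by (rule borel_measurable_times)
  then show ?thesis by (simp add: gval_def[abs_def])
qed

lemma edge_value_bound:
  assumes S: "bounded_signal r W f" and e: "e \<in> pairs m" and x: "x \<in> {..<m} \<rightarrow>\<^sub>E {0..1}"
  shows "0 \<le> edge_value W x e" "edge_value W x e \<le> 1"
proof -
  have "card e = 2" "e \<subseteq> {..<m}" using e by (auto simp: pairs_def)
  then have "Min e \<in> {..<m}" "Max e \<in> {..<m}" using Min_Max_in_edge[of e] by auto
  from bounded_signalD(5)[OF S PiE_mem[OF x this(1)] PiE_mem[OF x this(2)]]
  show "0 \<le> edge_value W x e" "edge_value W x e \<le> 1" by (auto simp: edge_value_def)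
qed

lemma gval_bound:
  assumes S: "bounded_signal r W f" and E: "multigraph m E" and x: "x \<in> {..<m} \<rightarrow>\<^sub>E {0..1}"
  shows "\<bar>gval m E d W f x\<bar> \<le> (\<Prod>i<m. r ^ d i)"
proof -
  have "\<bar>\<Prod>i<m. f (x i) ^ d i\<bar> \<le> (\<Prod>i<m. r ^ d i)"
    unfolding abs_prod power_abs
  proof (intro prod_mono conjI power_mono)
    show "\<bar>f (x i)\<bar> \<le> r" if "i \<in> {..<m}" for i using bounded_signalD(3)[OF S PiE_mem[OF x that]] .
  qed auto
  moreover have "0 \<le> (\<Prod>e\<in>#E. edge_value W x e) \<and> (\<Prod>e\<in>#E. edge_value W x e) \<le> 1"
    using E
  proof (induction E)
    case (add e E)
    then have e: "e \<in> pairs m" and E: "multigraph m E" by (auto simp: multigraph_def)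
    then show ?case using add.IH[OF E] edge_value_bound[OF S e x] by (auto intro: mult_le_one)
  qed simp
  then have "\<bar>\<Prod>e\<in>#E. edge_value W x e\<bar> \<le> 1" by linarith
  ultimately have "\<bar>\<Prod>i<m. f (x i) ^ d i\<bar> * \<bar>\<Prod>e\<in>#E. edge_value W x e\<bar> \<le> (\<Prod>i<m. r ^ d i) * 1"
    by (intro mult_mono) auto
  then show ?thesis by (simp add: gval_def abs_mult)
qed

lemma hom_density_iter:
  assumes "bounded_signal r W f" "multigraph m E"
  shows "hom_density m E d W f = iter [0..<m] (gval m E d W f) (\<lambda>_. undefined)"
  using integral_cube_iter[of "[0..<m]" "gval m E d W f" "\<Prod>i<m. r ^ d i"] gval_measurable[OF _ _ assms(2)]
    gval_bound[OF assms] assms(1)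
  by (simp add: bounded_signal_def hom_density_gval atLeast0LessThan)

text \<open>Label \<open>a\<close> sits at vertex \<open>l a\<close>, and the integrated vertices
  form an interval starting at \<open>n\<close>, so graphs built one after the other have disjoint
  ones. Both \<open>l\<close> and \<open>n\<close> vary because integrating out a variable moves its
  label to the fresh vertex \<open>n\<close>. A larger \<open>m\<close> is harmless, as vertices
  from \<open>n'\<close> on have exponent 0 and lie on no edge.\<close>

lemma term_to_labelled_graph:
  "wf_tm k t \<Longrightarrow> inj_on l {..<k} \<Longrightarrow> (\<And>a. a < k \<Longrightarrow> l a < n) \<Longrightarrow>
    \<exists>n'\<ge>n. \<exists>E d B. kext k (l ` {..<k}) {l ` {..<k}} (l ` {..<k} \<union> {n..<n'}) B \<and>
      (\<forall>e\<in>#E. card e = 2 \<and> (\<exists>b\<in>B. e \<subseteq> b)) \<and> (\<forall>v. v \<notin> l ` {..<k} \<union> {n..<n'} \<longrightarrow> d v = 0) \<and>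
      (\<forall>m W f x. n' \<le> m \<longrightarrow> graphon W \<longrightarrow> (\<forall>a<k. x (l a) \<in> {0..1}) \<longrightarrow>
         sem t W f (x \<circ> l) = iter [n..<n'] (gval m E d W f) x)"
proof (induction t arbitrary: l n)
  case One
  show ?case
    by (rule exI[of _ n], rule conjI[OF order_refl], rule exI[of _ "{#}"], rule exI[of _ "\<lambda>_. 0"],
        rule exI[of _ "{l ` {..<k}}"]) (simp add: kext_refl gval_def)
next
  case (Sig j)
  let ?d = "\<lambda>v. if v = l j then 1 else 0"
  have *: "gval m {#} ?d W f x = f (x (l j))" if "n \<le> m" for m W f x
  proof -
    have "l j < m" using Sig.prems that by fastforce
    have "(\<Prod>i<m. f (x i) ^ ?d i) = (\<Prod>i<m. if i = l j then f (x i) else 1)" by (intro prod.cong) auto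
    then show ?thesis using \<open>l j < m\<close> by (simp add: gval_def)
  qed
  show ?case
    by (rule exI[of _ n], rule conjI[OF order_refl], rule exI[of _ "{#}"], rule exI[of _ ?d],
        rule exI[of _ "{l ` {..<k}}"]) (use Sig * in \<open>auto simp: kext_refl\<close>)
next
  case (Edge i j)
  let ?E = "{#{l i, l j}#}"
  have ij: "l i \<noteq> l j" using Edge.prems by (auto simp: inj_on_def)
  have *: "gval m ?E (\<lambda>_. 0) W f x = W (x (l i)) (x (l j))"
    if "graphon W" "\<forall>a<k. x (l a) \<in> {0..1}" for m W f x
    using edge_value_doubleton[of W x "l i" "l j"] ij that Edge.prems(1) by (simp add: gval_def)
  show ?case
    by (rule exI[of _ n], rule conjI[OF order_refl], rule exI[of _ ?E], rule exI[of _ "\<lambda>_. 0"],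
        rule exI[of _ "{l ` {..<k}}"]) (use Edge.prems(1) ij * in \<open>auto simp: kext_refl\<close>)
next
  case (Mul t u)
  let ?L = "l ` {..<k}"
  have wf: "wf_tm k t" "wf_tm k u" using Mul.prems by auto
  obtain n' E d B where 1: "n \<le> n'" "kext k ?L {?L} (?L \<union> {n..<n'}) B"
      "\<forall>e\<in>#E. card e = 2 \<and> (\<exists>b\<in>B. e \<subseteq> b)" "\<forall>v. v \<notin> ?L \<union> {n..<n'} \<longrightarrow> d v = 0"
      "\<And>m W f x. n' \<le> m \<Longrightarrow> graphon W \<Longrightarrow> \<forall>a<k. x (l a) \<in> {0..1} \<Longrightarrow>
         sem t W f (x \<circ> l) = iter [n..<n'] (gval m E d W f) x"
    using Mul.IH(1)[OF wf(1) Mul.prems(2,3)] by blast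
  have ln': "l a < n'" if "a < k" for a using Mul.prems(3)[OF that] 1(1) by simp
  \<comment> \<open>Starting the second graph at \<open>n'\<close> keeps its integrated vertices
    apart from those of the first; only the labelled bag is shared.\<close>
  obtain n'' E' d' B' where 2: "n' \<le> n''" "kext k ?L {?L} (?L \<union> {n'..<n''}) B'"
      "\<forall>e\<in>#E'. card e = 2 \<and> (\<exists>b\<in>B'. e \<subseteq> b)" "\<forall>v. v \<notin> ?L \<union> {n'..<n''} \<longrightarrow> d' v = 0"
      "\<And>m W f x. n'' \<le> m \<Longrightarrow> graphon W \<Longrightarrow> \<forall>a<k. x (l a) \<in> {0..1} \<Longrightarrow>
         sem u W f (x \<circ> l) = iter [n'..<n''] (gval m E' d' W f) x"
    using Mul.IH(2)[OF wf(2) Mul.prems(2) ln'] by blast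
  have L: "v < n" if "v \<in> ?L" for v using that Mul.prems(3) by auto
  have "kext k (?L \<union> {n..<n'}) B ((?L \<union> {n..<n'}) \<union> (?L \<union> {n'..<n''})) (B \<union> B')"
    by (rule kext_mono[OF 2(2)]) (use kext_subset[OF 1(2)] L 1(1) in \<open>fastforce+\<close>)
  moreover have "(?L \<union> {n..<n'}) \<union> (?L \<union> {n'..<n''}) = ?L \<union> {n..<n''}" using 1(1) 2(1) by auto
  ultimately have "kext k (?L \<union> {n..<n'}) B (?L \<union> {n..<n''}) (B \<union> B')" by simp
  then have kext: "kext k ?L {?L} (?L \<union> {n..<n''}) (B \<union> B')" using 1(2) by (rule kext_trans)
  have bags: "b \<subseteq> ?L \<union> {n..<n'}" if "b \<in> B" for b using kext_bags[OF 1(2) _ that] by auto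
  have bags': "b \<subseteq> ?L \<union> {n'..<n''}" if "b \<in> B'" for b using kext_bags[OF 2(2) _ that] by auto
  have sem: "sem (Mul t u) W f (x \<circ> l) = iter [n..<n''] (gval m (E + E') (\<lambda>v. d v + d' v) W f) x"
    if "n'' \<le> m" "graphon W" "\<forall>a<k. x (l a) \<in> {0..1}" for m W f x
  proof -
    have "iter [n..<n'] (gval m E d W f) x * iter [n'..<n''] (gval m E' d' W f) x =
        iter ([n..<n'] @ [n'..<n'']) (\<lambda>x. gval m E d W f x * gval m E' d' W f x) x"
    proof (rule iter_mult)
      fix v assume v: "v \<in> set [n'..<n'']"
      then have v': "v \<notin> ?L \<union> {n..<n'}" using L[of v] 1(1) by fastforce
      show "indep_of v (gval m E d W f)"
      proof (rule gval_indep)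
        show "d v = 0" using v' 1(4) by blast
        show "card e = 2 \<and> v \<notin> e" if "e \<in># E" for e
          using 1(3) that bags v' by blast
      qed
    next
      fix v assume v: "v \<in> set [n..<n']"
      then have v': "v \<notin> ?L \<union> {n'..<n''}" using L[of v] by fastforce
      show "indep_of v (gval m E' d' W f)"
      proof (rule gval_indep)
        show "d' v = 0" using v' 2(4) by blast
        show "card e = 2 \<and> v \<notin> e" if "e \<in># E'" for e
          using 2(3) that bags' v' by blast
      qed
    qed auto
    moreover have "[n..<n'] @ [n'..<n''] = [n..<n'']"
      using 1(1) 2(1) by (metis le_add_diff_inverse upt_add_eq_append)
    moreover have "(\<lambda>x. gval m E d W f x * gval m E' d' W f x) = gval m (E + E') (\<lambda>v. d v + d' v) W f"
      by (rule ext) (simp add: gval_add)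
    ultimately show ?thesis using 1(5)[of m W x f] 2(5)[of m W x f] that 2(1) by simp
  qed
  show ?case
  proof (rule exI[of _ n''], rule conjI, rule order_trans[OF 1(1) 2(1)], rule exI[of _ "E + E'"],
        rule exI[of _ "\<lambda>v. d v + d' v"], rule exI[of _ "B \<union> B'"], intro conjI)
    show "\<forall>e\<in>#E + E'. card e = 2 \<and> (\<exists>b\<in>B \<union> B'. e \<subseteq> b)"
    proof
      fix e assume "e \<in># E + E'"
      then consider "e \<in># E" | "e \<in># E'" by auto
      then show "card e = 2 \<and> (\<exists>b\<in>B \<union> B'. e \<subseteq> b)" by cases (use 1(3) 2(3) in blast)+
    qed
    show "\<forall>v. v \<notin> ?L \<union> {n..<n''} \<longrightarrow> d v + d' v = 0" using 1(4,1) 2(4,1) by auto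
  qed (use kext sem in blast)+
next
  case (Integ i j t)
  let ?L = "l ` {..<k}" and ?l = "l(j := n)"
  let ?S = "l ` ({..<k} - {j})"
  define L' where "L' = ?l ` {..<k}"
  have j: "j < k" and wf: "wf_tm k t" using Integ.prems(1) by auto
  have L: "v < n" if "v \<in> ?L" for v using that Integ.prems(3) by auto
  have inj: "inj_on ?l {..<k}" using Integ.prems(2) L by (force simp: inj_on_def)
  have ln: "?l a < Suc n" if "a < k" for a using Integ.prems(3)[OF that] by auto
  obtain n' E d B where 1: "Suc n \<le> n'" "kext k L' {L'} (L' \<union> {Suc n..<n'}) B"
      "\<forall>e\<in>#E. card e = 2 \<and> (\<exists>b\<in>B. e \<subseteq> b)" "\<forall>v. v \<notin> L' \<union> {Suc n..<n'} \<longrightarrow> d v = 0"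
      "\<And>m W f x. n' \<le> m \<Longrightarrow> graphon W \<Longrightarrow> \<forall>a<k. x (?l a) \<in> {0..1} \<Longrightarrow>
         sem t W f (x \<circ> ?l) = iter [Suc n..<n'] (gval m E d W f) x"
    using Integ.IH[OF wf inj ln] unfolding L'_def by blast
  have L'_eq: "L' = insert n ?S"
  proof -
    have "{..<k} = insert j ({..<k} - {j})" using j by auto
    then have "L' = insert (?l j) (?l ` ({..<k} - {j}))" unfolding L'_def using image_insert by metis
    moreover have "?l ` ({..<k} - {j}) = ?S" by (rule image_cong) auto
    ultimately show ?thesis by simp
  qed
  have sub: "?S \<subseteq> ?L" by auto
  have un: "insert n X \<union> (insert n Y \<union> {Suc n..<n'}) = X \<union> {n..<n'}" if "Y \<subseteq> X" "Suc n \<le> n'" for X Y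
    using that by auto
  \<comment> \<open>The fresh vertex \<open>n\<close> is attached to the \<open>k - 1\<close>
    vertices whose labels stay put; together they form the labelled bag of the subterm.\<close>
  have "card ?S \<le> card ({..<k} - {j})" by (rule card_image_le) simp
  also have "\<dots> < k" using j by simp
  finally have "kext k ?L {?L} (insert n ?L) (insert (insert n ?S) {?L})"
    using L by (intro kext_step[OF kext_refl]) auto
  then have "kext k ?L {?L} (insert n ?L) {L', ?L}" by (simp only: L'_eq)
  moreover have step: "kext k (insert n ?L) {L', ?L} (insert n ?L \<union> (L' \<union> {Suc n..<n'})) ({L', ?L} \<union> B)"
  proof (rule kext_mono[OF 1(2)])
    have "{Suc n..<n'} \<inter> insert n ?L = {}" using L by fastforce
    then show "(L' \<union> {Suc n..<n'} - L') \<inter> insert n ?L = {}" by blast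
  qed (use sub in \<open>auto simp only: L'_eq\<close>)
  moreover have "insert n ?L \<union> (L' \<union> {Suc n..<n'}) = ?L \<union> {n..<n'}"
    unfolding L'_eq using sub 1(1) by (rule un)
  ultimately have kext: "kext k ?L {?L} (?L \<union> {n..<n'}) ({L', ?L} \<union> B)"
    using kext_trans[OF step] by simp
  have sem: "sem (Integ i j t) W f (x \<circ> l) = iter [n..<n'] (gval m E d W f) x"
    if m: "n' \<le> m" and W: "graphon W" and x: "\<forall>a<k. x (l a) \<in> {0..1}" for m W f x
  proof -
    have "sem t W f ((x \<circ> l)(j := y)) = iter [Suc n..<n'] (gval m E d W f) (x(n := y))"
      if y: "y \<in> {0..1}" for y
    proof -
      \<comment> \<open>As \<open>n\<close> exceeds all labelled vertices, changing variable
        \<open>j\<close> under the old labelling amounts to changing vertex \<open>n\<close> under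
        the new one.\<close>
      have "sem t W f ((x \<circ> l)(j := y)) = sem t W f (x(n := y) \<circ> ?l)"
      proof (rule sem_cong)
        fix a assume "a \<in> fv t"
        then have "a < k" using wf_tm_fv[OF wf] by auto
        then show "((x \<circ> l)(j := y)) a = (x(n := y) \<circ> ?l) a" using Integ.prems(3)[of a] by auto
      qed
      also have "\<dots> = iter [Suc n..<n'] (gval m E d W f) (x(n := y))"
        using x y Integ.prems(3) by (intro 1(5) m W) fastforce
      finally show ?thesis .
    qed
    then have "sem (Integ i j t) W f (x \<circ> l) =
        (\<integral>y. iter [Suc n..<n'] (gval m E d W f) (x(n := y)) \<partial>unit_lebesgue)"
      unfolding sem.simps by (intro Bochner_Integration.integral_cong) auto
    also have "\<dots> = iter [n..<n'] (gval m E d W f) x" using 1(1) by (simp add: upt_conv_Cons)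
    finally show ?thesis .
  qed
  show ?case
  proof (rule exI[of _ n'], rule conjI, rule Suc_leD[OF 1(1)], rule exI[of _ E],
        rule exI[of _ d], rule exI[of _ "{L', ?L} \<union> B"], intro conjI)
    show "\<forall>e\<in>#E. card e = 2 \<and> (\<exists>b\<in>{L', ?L} \<union> B. e \<subseteq> b)" using 1(3) by blast
    show "\<forall>v. v \<notin> ?L \<union> {n..<n'} \<longrightarrow> d v = 0"
    proof (intro allI impI)
      fix v assume "v \<notin> ?L \<union> {n..<n'}"
      then have "v \<notin> L' \<union> {Suc n..<n'}" using un[OF sub 1(1)] unfolding L'_eq by blast
      then show "d v = 0" using 1(4) by blast
    qed
  qed (use kext sem in blast)+
qed

text \<open>The labels are placed at the vertices below \<open>k\<close>, which are integrated over
  as well. Their bag is itself reached from the empty bag, so the whole graph arises from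
  nothing.\<close>

lemma term_to_graph:
  assumes t: "wf_tm k t"
  obtains m E d B where "multigraph m E" "kext k {} {{}} {..<m} B" "\<And>e. e \<in># E \<Longrightarrow> \<exists>b\<in>B. e \<subseteq> b"
    "\<And>r W f. bounded_signal r W f \<Longrightarrow> r > 0 \<Longrightarrow> (\<integral>x. sem t W f x \<partial>cube {..<k}) = hom_density m E d W f"
proof -
  have "inj_on (\<lambda>a. a) {..<k}" by simp
  from term_to_labelled_graph[OF t this, of k] obtain m E d B where
    1: "k \<le> m" "kext k {..<k} {{..<k}} ({..<k} \<union> {k..<m}) B"
      "\<forall>e\<in>#E. card e = 2 \<and> (\<exists>b\<in>B. e \<subseteq> b)"
    and sem: "\<And>W f x. graphon W \<Longrightarrow> \<forall>a<k. x a \<in> {0..1} \<Longrightarrow>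
         sem t W f x = iter [k..<m] (gval m E d W f) x" by (auto simp: o_def)
  have m: "{..<k} \<union> {k..<m} = {..<m}" using 1(1) by auto
  have "\<exists>B'. kext k {} {{}} ({} \<union> {..<k}) B' \<and> (\<exists>b'\<in>B'. {} \<union> {..<k} \<subseteq> b')"
    by (rule kext_add_vertices[where b = "{}"]) auto
  then obtain B' b' where B': "kext k {} {{}} {..<k} B'" "b' \<in> B'" "{..<k} \<subseteq> b'" by auto
  \<comment> \<open>All bags so far lie within \<open>{..<k}\<close>, so \<open>b'\<close> is
    exactly the labelled bag on which the rest is built.\<close>
  have "b' = {..<k}" using kext_bags[OF B'(1) _ B'(2)] B'(3) by auto
  then have "kext k {..<k} B' ({..<k} \<union> {..<m}) (B' \<union> B)"
    using B'(2) 1(2) unfolding m by (intro kext_mono) auto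
  then have kext: "kext k {} {{}} {..<m} (B' \<union> B)"
    using kext_trans[OF _ B'(1)] 1(1) by (simp add: Un_absorb1)
  have "e \<in> pairs m" if e: "e \<in># E" for e
  proof -
    obtain b where b: "card e = 2" "b \<in> B" "e \<subseteq> b" using 1(3) e by blast
    have "b \<subseteq> {..<m}" using kext_bags[OF kext, of b] b(2) by auto
    then show ?thesis using b by (auto simp: pairs_def)
  qed
  then have E: "multigraph m E" by (auto simp: multigraph_def)
  show ?thesis
  proof (rule that[OF E kext])
    show "\<exists>b\<in>B' \<union> B. e \<subseteq> b" if "e \<in># E" for e using 1(3) that by blast
    fix r W f assume S: "bounded_signal r W f" and r: "(r::real) > 0"
    have "(\<integral>x. sem t W f x \<partial>cube {..<k}) = iter [0..<k] (sem t W f) (\<lambda>_. undefined)"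
      using integral_cube_iter[of "[0..<k]" "sem t W f" "bd r t"] sem_measurable[OF S wf_tm_fv[OF t]]
        sem_bound[OF S r, of t] wf_tm_fv[OF t]
      by (simp add: atLeast0LessThan PiE_iff subset_iff)
    also have "\<dots> = iter [0..<k] (iter [k..<m] (gval m E d W f)) (\<lambda>_. undefined)"
      using S by (intro iter_cong sem) (auto simp: bounded_signal_def)
    also have "\<dots> = iter ([0..<k] @ [k..<m]) (gval m E d W f) (\<lambda>_. undefined)"
      by (simp add: iter_append)
    also have "[0..<k] @ [k..<m] = [0..<m]" using 1(1) by (metis le_add_diff_inverse upt_add_eq_append zero_le)
    finally show "(\<integral>x. sem t W f x \<partial>cube {..<k}) = hom_density m E d W f"
      using hom_density_iter[OF S E] by simp
  qed
qed


section \<open>From graphs to terms\<close>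

text \<open>Greedy colouring: the bag of a new vertex holds fewer than \<open>k\<close> older ones,
  so one of the \<open>k\<close> colors is free, and older bags do not contain the new
  vertex.\<close>

lemma kext_colouring:
  assumes "kext k {} {{}} V B"
  shows "\<exists>l. (\<forall>v\<in>V. l v < k) \<and> (\<forall>b\<in>B. inj_on l b)"
  using assms
proof (induction rule: kext.induct)
  case (kext_step V B b S v)
  then obtain l where l: "\<forall>v\<in>V. l v < k" "\<forall>b\<in>B. inj_on l b" by blast
  have bags: "finite b \<and> b \<subseteq> V" if "b \<in> B" for b using kext_bags[OF kext_step.hyps(1) _ that] by auto
  have S: "finite S" "S \<subseteq> V" using bags[OF kext_step.hyps(2)] kext_step.hyps(3) finite_subset by auto
  have "card (l ` S) < card {..<k}" using card_image_le[OF S(1), of l] kext_step.hyps(5) by simp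
  then have "\<not> {..<k} \<subseteq> l ` S" using card_mono[of "l ` S" "{..<k}"] S(1) by auto
  then obtain c where c: "c < k" "c \<notin> l ` S" by blast
  have "inj_on l S" using l(2) kext_step.hyps(2,3) inj_on_subset by blast
  then have "inj_on (l(v := c)) (insert v S)"
    using c(2) S(2) kext_step.hyps(4) by (auto simp: inj_on_def)
  moreover have "inj_on (l(v := c)) b'" if "b' \<in> B" for b'
    using l(2) that bags[OF that] kext_step.hyps(4) by (auto simp: inj_on_def)
  ultimately have "\<forall>b'\<in>insert (insert v S) B. inj_on (l(v := c)) b'" by blast
  moreover have "\<forall>w\<in>insert v V. (l(v := c)) w < k" using l(1) c(1) by auto
  ultimately show ?case by blast
qed auto

definition bag_env :: "(nat \<Rightarrow> nat) \<Rightarrow> nat set \<Rightarrow> (nat \<Rightarrow> real) \<Rightarrow> nat \<Rightarrow> real" where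
  "bag_env l b x a = x (inv_into b l a)"

lemma bag_env_image: "inj_on l b \<Longrightarrow> v \<in> b \<Longrightarrow> bag_env l b x (l v) = x v"
  by (simp add: bag_env_def)

lemma sem_bag_env_measurable:
  assumes S: "bounded_signal r W f" and fv: "fv t \<subseteq> l ` b" and b: "b \<subseteq> V" "inj_on l b"
  shows "(\<lambda>x. sem t W f (bag_env l b x)) \<in> borel_measurable (cube V)"
proof -
  have "(\<lambda>x. \<lambda>a\<in>l ` b. bag_env l b x a) \<in> cube V \<rightarrow>\<^sub>M cube (l ` b)"
  proof (rule measurable_restrict)
    fix a assume "a \<in> l ` b"
    then have "inv_into b l a \<in> b" by (rule inv_into_into)
    then have "inv_into b l a \<in> V" using b(1) by blast
    then show "(\<lambda>x. bag_env l b x a) \<in> cube V \<rightarrow>\<^sub>M unit_lebesgue"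
      unfolding bag_env_def by (rule measurable_component_singleton)
  qed
  from measurable_compose[OF this sem_measurable[OF S fv]]
  have "(\<lambda>x. sem t W f (\<lambda>a\<in>l ` b. bag_env l b x a)) \<in> borel_measurable (cube V)" .
  moreover have "sem t W f (\<lambda>a\<in>l ` b. bag_env l b x a) = sem t W f (bag_env l b x)" for x
    by (rule sem_cong) (use fv in auto)
  ultimately show ?thesis by simp
qed

lemma sem_bag_env_bound:
  assumes S: "bounded_signal r W f" "r > 0" and fv: "fv t \<subseteq> l ` b" and b: "b \<subseteq> V"
    and x: "x \<in> V \<rightarrow>\<^sub>E {0..1}"
  shows "\<bar>sem t W f (bag_env l b x)\<bar> \<le> bd r t"
proof (rule sem_bound[OF S])
  fix a assume "a \<in> fv t"
  then have "a \<in> l ` b" using fv by blast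
  then have "inv_into b l a \<in> b" by (rule inv_into_into)
  then have "inv_into b l a \<in> V" using b by blast
  then show "bag_env l b x a \<in> {0..1}" unfolding bag_env_def by (rule PiE_mem[OF x])
qed

definition tms_ok :: "nat \<Rightarrow> (nat \<Rightarrow> nat) \<Rightarrow> nat set set \<Rightarrow> (nat set \<Rightarrow> tm) \<Rightarrow> bool" where
  "tms_ok k l B \<tau> \<longleftrightarrow> (\<forall>b\<in>B. wf_tm k (\<tau> b) \<and> fv (\<tau> b) \<subseteq> l ` b)"

text \<open>The vertex added last lies in no bag but its own, so all other factors are constant in
  the innermost integral. The result depends only on \<open>S\<close>, a part of the parent bag
  \<open>b\<close>, and is merged into \<open>\<tau> b\<close>; therefore \<open>\<tau>\<close> is
  arbitrary in the induction.\<close>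

lemma eliminate_vertices:
  assumes "kext k {} {{}} V B" "\<forall>v\<in>V. l v < k" "\<forall>b\<in>B. inj_on l b" "tms_ok k l B \<tau>"
  shows "\<exists>t. wf_tm k t \<and> (\<forall>r W f. r > 0 \<longrightarrow> bounded_signal r W f \<longrightarrow>
    (\<integral>x. (\<Prod>b\<in>B. sem (\<tau> b) W f (bag_env l b x)) \<partial>cube V) = (\<integral>x. sem t W f x \<partial>cube {..<k}))"
  using assms
proof (induction arbitrary: \<tau> rule: kext.induct)
  case kext_refl
  then have \<tau>: "wf_tm k (\<tau> {})" "fv (\<tau> {}) = {}" by (auto simp: tms_ok_def)
  show ?case
  proof (intro exI[of _ "\<tau> {}"] conjI allI impI \<tau>)
    fix r W f
    interpret c: prob_space "cube {..<k}" by (rule prob_space_cube)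
    \<comment> \<open>A closed term has a single value, and \<open>cube {..<k}\<close> has total
      mass 1.\<close>
    have *: "sem (\<tau> {}) W f x = sem (\<tau> {}) W f (\<lambda>_. 0)" for x by (rule sem_cong) (simp add: \<tau>)
    have "(\<integral>x. (\<Prod>b\<in>{{}}. sem (\<tau> b) W f (bag_env l b x)) \<partial>cube {}) = sem (\<tau> {}) W f (\<lambda>_. 0)"
      by (simp add: PiM_empty lebesgue_integral_count_space_finite *[of "bag_env l {} x" for x])
    also have "\<dots> = (\<integral>x. sem (\<tau> {}) W f (\<lambda>_. 0) \<partial>cube {..<k})" by (simp add: c.prob_space)
    also have "\<dots> = (\<integral>x. sem (\<tau> {}) W f x \<partial>cube {..<k})" by (intro Bochner_Integration.integral_cong refl *[symmetric])
    finally show "(\<integral>x. (\<Prod>b\<in>{{}}. sem (\<tau> b) W f (bag_env l b x)) \<partial>cube {}) =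
        (\<integral>x. sem (\<tau> {}) W f x \<partial>cube {..<k})" .
  qed
next
  case (kext_step V B b S v)
  let ?b0 = "insert v S"
  define u where "u = Integ 0 (l v) (\<tau> ?b0)"
  define \<tau>' where "\<tau>' = \<tau>(b := Mul (\<tau> b) u)"
  have bags: "finite b \<and> b \<subseteq> V" if "b \<in> B" for b using kext_bags[OF kext_step.hyps(1) _ that] by auto
  have fin: "finite V" "finite B" using kext_finite[OF kext_step.hyps(1)] by auto
  have SV: "S \<subseteq> V" using bags[OF kext_step.hyps(2)] kext_step.hyps(3) by auto
  have b0: "?b0 \<notin> B" using bags kext_step.hyps(4) by blast
  have inj: "inj_on l c" if "c \<in> insert ?b0 B" for c using kext_step.prems(2) that by blast
  have ok: "wf_tm k (\<tau> c)" "fv (\<tau> c) \<subseteq> l ` c" if "c \<in> insert ?b0 B" for c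
    using kext_step.prems(3) that by (auto simp: tms_ok_def)
  have lv: "l v < k" using kext_step.prems(1) by simp
  have u: "wf_tm k u" "fv u \<subseteq> l ` S" using ok[of ?b0] lv by (auto simp: u_def)
  have "tms_ok k l B \<tau>'"
    unfolding tms_ok_def
  proof
    fix c assume c: "c \<in> B"
    have "l ` S \<subseteq> l ` b" using kext_step.hyps(3) by (rule image_mono)
    then show "wf_tm k (\<tau>' c) \<and> fv (\<tau>' c) \<subseteq> l ` c"
      using ok[of c] u c by (cases "c = b") (auto simp: \<tau>'_def)
  qed
  moreover have "\<forall>v\<in>V. l v < k" "\<forall>b\<in>B. inj_on l b" using kext_step.prems by auto
  ultimately obtain t where t: "wf_tm k t" "\<And>r W f. r > 0 \<Longrightarrow> bounded_signal r W f \<Longrightarrow>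
    (\<integral>x. (\<Prod>b\<in>B. sem (\<tau>' b) W f (bag_env l b x)) \<partial>cube V) = (\<integral>x. sem t W f x \<partial>cube {..<k})"
    using kext_step.IH by blast
  show ?case
  proof (intro exI[of _ t] conjI allI impI t(1))
    fix r :: real and W f assume r: "r > 0" and W: "bounded_signal r W f"
    let ?F = "\<lambda>x. \<Prod>b\<in>insert ?b0 B. sem (\<tau> b) W f (bag_env l b x)"
    have sub: "c \<subseteq> insert v V" if "c \<in> insert ?b0 B" for c using that bags SV by blast
    have fubini: "integrable (cube (insert v V)) ?F"
    proof (rule integrable_cube_bounded)
      show "?F \<in> borel_measurable (cube (insert v V))"
        by (intro borel_measurable_prod sem_bag_env_measurable[OF W] ok sub inj)
      show "\<bar>?F x\<bar> \<le> (\<Prod>b\<in>insert ?b0 B. bd r (\<tau> b))" if "x \<in> insert v V \<rightarrow>\<^sub>E {0..1}" for x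
        unfolding abs_prod
        by (intro prod_mono conjI abs_ge_zero sem_bag_env_bound[OF W r _ _ that] ok sub)
    qed
    have inner: "(\<integral>y. ?F (x(v := y)) \<partial>unit_lebesgue) = (\<Prod>b\<in>B. sem (\<tau>' b) W f (bag_env l b x))" for x
    proof -
      have old: "sem (\<tau> c) W f (bag_env l c (x(v := y))) = sem (\<tau> c) W f (bag_env l c x)" if c: "c \<in> B" for c y
      proof (rule sem_cong)
        fix a assume "a \<in> fv (\<tau> c)"
        then have "inv_into c l a \<in> c" using ok(2)[of c] c by (intro inv_into_into) auto
        then show "bag_env l c (x(v := y)) a = bag_env l c x a"
          using bags[OF c] kext_step.hyps(4) by (auto simp: bag_env_def)
      qed
      \<comment> \<open>The two environments agree on the colors of \<open>?b0\<close>: the color of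
        \<open>v\<close> gets \<open>y\<close>, and the vertices of \<open>S\<close> are shared with
        \<open>b\<close>. Free variables of the term stay within these colors.\<close>
      have new: "sem (\<tau> ?b0) W f (bag_env l ?b0 (x(v := y))) = sem (\<tau> ?b0) W f ((bag_env l b x)(l v := y))" for y
      proof (rule sem_cong)
        fix a assume "a \<in> fv (\<tau> ?b0)"
        then obtain w where w: "w \<in> ?b0" "a = l w" using ok(2)[of ?b0] by blast
        show "bag_env l ?b0 (x(v := y)) a = ((bag_env l b x)(l v := y)) a"
        proof (cases "w = v")
          case True
          then show ?thesis using bag_env_image[OF inj w(1)] w(2) by simp
        next
          case False
          then have "l w \<noteq> l v" using inj[of ?b0] w(1) by (auto simp: inj_on_def)
          moreover have "w \<in> b" using False w(1) kext_step.hyps(3) by auto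
          ultimately show ?thesis
            using bag_env_image[OF inj w(1)] bag_env_image[of l b w] inj[of b] kext_step.hyps(2) False w(2) by simp
        qed
      qed
      have "(\<integral>y. ?F (x(v := y)) \<partial>unit_lebesgue) =
          (\<integral>y. sem (\<tau> ?b0) W f ((bag_env l b x)(l v := y)) * (\<Prod>b\<in>B. sem (\<tau> b) W f (bag_env l b x)) \<partial>unit_lebesgue)"
        using b0 fin(2) old new by (simp cong: prod.cong)
      also have "\<dots> = sem u W f (bag_env l b x) * (\<Prod>b\<in>B. sem (\<tau> b) W f (bag_env l b x))"
        by (simp add: u_def)
      also have "\<dots> = (\<Prod>b\<in>B. sem (\<tau>' b) W f (bag_env l b x))"
      proof -
        have "(\<Prod>c\<in>B - {b}. sem (\<tau>' c) W f (bag_env l c x)) = (\<Prod>c\<in>B - {b}. sem (\<tau> c) W f (bag_env l c x))"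
          by (intro prod.cong) (auto simp: \<tau>'_def)
        then show ?thesis using kext_step.hyps(2) fin(2)
          by (simp add: prod.remove[of B b] \<tau>'_def)
      qed
      finally show ?thesis .
    qed
    from fubini have "(\<integral>x. ?F x \<partial>cube (insert v V)) = (\<integral>x. (\<integral>y. ?F (x(v := y)) \<partial>unit_lebesgue) \<partial>cube V)"
      by (rule cube.product_integral_insert[OF fin(1) kext_step.hyps(4)])
    also have "\<dots> = (\<integral>x. (\<Prod>b\<in>B. sem (\<tau>' b) W f (bag_env l b x)) \<partial>cube V)"
      by (simp only: inner)
    finally show "(\<integral>x. ?F x \<partial>cube (insert v V)) = (\<integral>x. sem t W f x \<partial>cube {..<k})"
      using t(2)[OF r W] by simp
  qed
qed

text \<open>Every vertex factor and every edge factor of the integrand fits into some bag, and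
  functions that split into one term per bag are closed under products.\<close>

lemma graph_to_term:
  assumes kext: "kext k {} {{}} {..<m} B" and E: "multigraph m E" "\<And>e. e \<in># E \<Longrightarrow> \<exists>b\<in>B. e \<subseteq> b"
    and cover: "\<And>v. v < m \<Longrightarrow> \<exists>b\<in>B. v \<in> b"
  shows "\<exists>t. wf_tm k t \<and> (\<forall>r W f. r > 0 \<longrightarrow> bounded_signal r W f \<longrightarrow>
    hom_density m E d W f = (\<integral>x. sem t W f x \<partial>cube {..<k}))"
proof -
  obtain l where l: "\<forall>v\<in>{..<m}. l v < k" "\<forall>b\<in>B. inj_on l b" using kext_colouring[OF kext] by blast
  have bags: "b \<subseteq> {..<m}" if "b \<in> B" for b using kext_bags[OF kext _ that] by auto
  have fin: "finite B" using kext_finite[OF kext] by simp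
  \<comment> \<open>The terms \<open>\<tau>\<close> precede \<open>W\<close> and \<open>f\<close> in
    the quantifier order: one choice has to serve both graphon-signals.\<close>
  define rep where "rep \<Phi> \<longleftrightarrow> (\<exists>\<tau>. tms_ok k l B \<tau> \<and> (\<forall>W f x. graphon W \<longrightarrow> x \<in> {..<m} \<rightarrow>\<^sub>E {0..1} \<longrightarrow>
      \<Phi> W f x = (\<Prod>b\<in>B. sem (\<tau> b) W f (bag_env l b x))))"
    for \<Phi> :: "(real \<Rightarrow> real \<Rightarrow> real) \<Rightarrow> (real \<Rightarrow> real) \<Rightarrow> (nat \<Rightarrow> real) \<Rightarrow> real"
  have rep_one: "rep (\<lambda>W f x. 1)"
    unfolding rep_def by (intro exI[of _ "\<lambda>_. One"]) (simp add: tms_ok_def)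
  have rep_mult: "rep (\<lambda>W f x. \<Phi> W f x * \<Psi> W f x)" if \<Phi>: "rep \<Phi>" and \<Psi>: "rep \<Psi>" for \<Phi> \<Psi>
  proof -
    from \<Phi> obtain \<tau> where 1: "tms_ok k l B \<tau>" "\<And>W f x. graphon W \<Longrightarrow> x \<in> {..<m} \<rightarrow>\<^sub>E {0..1} \<Longrightarrow>
      \<Phi> W f x = (\<Prod>b\<in>B. sem (\<tau> b) W f (bag_env l b x))" unfolding rep_def by blast
    from \<Psi> obtain \<sigma> where 2: "tms_ok k l B \<sigma>" "\<And>W f x. graphon W \<Longrightarrow> x \<in> {..<m} \<rightarrow>\<^sub>E {0..1} \<Longrightarrow>
      \<Psi> W f x = (\<Prod>b\<in>B. sem (\<sigma> b) W f (bag_env l b x))" unfolding rep_def by blast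
    show ?thesis unfolding rep_def
      by (rule exI[of _ "\<lambda>b. Mul (\<tau> b) (\<sigma> b)"])
        (use 1 2 in \<open>simp add: tms_ok_def prod.distrib\<close>)
  qed
  have rep_single: "rep (\<lambda>W f x. sem t W f (bag_env l b x))"
    if b: "b \<in> B" and t: "wf_tm k t" "fv t \<subseteq> l ` b" for b t
  proof -
    let ?\<tau> = "(\<lambda>_. One)(b := t)"
    have "(\<Prod>c\<in>B. sem (?\<tau> c) W f (bag_env l c x)) = sem t W f (bag_env l b x)" for W f x
    proof -
      have "(\<Prod>c\<in>B - {b}. sem (?\<tau> c) W f (bag_env l c x)) = 1" by (rule prod.neutral) auto
      then show ?thesis using prod.remove[OF fin b, of "\<lambda>c. sem (?\<tau> c) W f (bag_env l c x)"] by simp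
    qed
    then show ?thesis unfolding rep_def using t by (intro exI[of _ ?\<tau>]) (auto simp: tms_ok_def)
  qed
  have rep_cong: "rep \<Psi>" if "rep \<Phi>" "\<And>W f x. graphon W \<Longrightarrow> x \<in> {..<m} \<rightarrow>\<^sub>E {0..1} \<Longrightarrow> \<Phi> W f x = \<Psi> W f x" for \<Phi> \<Psi>
    using that unfolding rep_def by metis
  have rep_vertex: "rep (\<lambda>W f x. f (x v))" if v: "v < m" for v
  proof -
    obtain b where b: "b \<in> B" "v \<in> b" using cover[OF v] by blast
    have "rep (\<lambda>W f x. sem (Sig (l v)) W f (bag_env l b x))"
      using b l(1) v by (intro rep_single) auto
    then show ?thesis using bag_env_image[of l b v] l(2) b by simp
  qed
  have rep_edge: "rep (\<lambda>W f x. edge_value W x e)" if e: "e \<in># E" for e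
  proof -
    obtain b where b: "b \<in> B" "e \<subseteq> b" using E(2)[OF e] by blast
    obtain i j where ij: "e = {i, j}" "i \<noteq> j" "i < m" "j < m"
      using E(1) e pairsE[of e m] unfolding multigraph_def by blast
    have inj: "inj_on l b" using l(2) b(1) by blast
    have "rep (\<lambda>W f x. sem (Edge (l i) (l j)) W f (bag_env l b x))"
      using b l(1) ij inj by (intro rep_single) (auto simp: inj_on_def)
    then show ?thesis
    proof (rule rep_cong)
      fix W f and x :: "nat \<Rightarrow> real" assume W: "graphon W" and x: "x \<in> {..<m} \<rightarrow>\<^sub>E {0..1}"
      have "x i \<in> {0..1}" "x j \<in> {0..1}" by (rule PiE_mem[OF x], use ij in simp)+
      then have "edge_value W x {i, j} = W (x i) (x j)" by (rule edge_value_doubleton[OF W _ _ ij(2)])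
      then show "sem (Edge (l i) (l j)) W f (bag_env l b x) = edge_value W x e"
        using bag_env_image[OF inj] b(2) ij(1) by simp
    qed
  qed
  \<comment> \<open>The induction runs over submultisets because only edges of \<open>E\<close> are
    known to lie in a bag.\<close>
  have "rep (\<lambda>W f x. \<Prod>e\<in>#E'. edge_value W x e)" if "E' \<subseteq># E" for E'
    using that
  proof (induction E')
    case (add e E')
    have "e \<in># E" using add.prems by (meson mset_subset_eqD union_single_eq_member)
    moreover have "E' \<subseteq># E" using add.prems by (meson mset_subset_eq_insertD subset_mset.less_imp_le)
    ultimately show ?case using rep_mult[OF rep_edge[of e] add.IH] by simp
  qed (simp add: rep_one)
  then have "rep (\<lambda>W f x. \<Prod>e\<in>#E. edge_value W x e)" by simp
  moreover have "rep (\<lambda>W f x. \<Prod>i<n. f (x i) ^ d i)" if "n \<le> m" for n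
    using that
  proof (induction n)
    case (Suc n)
    have "rep (\<lambda>W f x. f (x n) ^ p)" for p
      using rep_mult[OF rep_vertex[of n]] Suc.prems by (induction p) (simp_all add: rep_one)
    then show ?case using rep_mult[of "\<lambda>W f x. \<Prod>i<n. f (x i) ^ d i" "\<lambda>W f x. f (x n) ^ d n"] Suc by simp
  qed (simp add: rep_one)
  ultimately have "rep (\<lambda>W f x. (\<Prod>i<m. f (x i) ^ d i) * (\<Prod>e\<in>#E. edge_value W x e))"
    by (intro rep_mult) auto
  then obtain \<tau> where \<tau>: "tms_ok k l B \<tau>" "\<And>W f x. graphon W \<Longrightarrow> x \<in> {..<m} \<rightarrow>\<^sub>E {0..1} \<Longrightarrow>
      gval m E d W f x = (\<Prod>b\<in>B. sem (\<tau> b) W f (bag_env l b x))" unfolding rep_def gval_def by blast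
  obtain t where t: "wf_tm k t" "\<And>r W f. r > 0 \<Longrightarrow> bounded_signal r W f \<Longrightarrow>
    (\<integral>x. (\<Prod>b\<in>B. sem (\<tau> b) W f (bag_env l b x)) \<partial>cube {..<m}) = (\<integral>x. sem t W f x \<partial>cube {..<k})"
    using eliminate_vertices[OF kext l \<tau>(1)] by blast
  have "hom_density m E d W f = (\<integral>x. sem t W f x \<partial>cube {..<k})"
    if r: "r > 0" and S: "bounded_signal r W f" for r W f
  proof -
    have "hom_density m E d W f = (\<integral>x. (\<Prod>b\<in>B. sem (\<tau> b) W f (bag_env l b x)) \<partial>cube {..<m})"
      unfolding hom_density_gval using S
      by (intro Bochner_Integration.integral_cong refl \<tau>(2)) (auto simp: bounded_signal_def space_cube)
    then show ?thesis using t(2)[OF that] by simp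
  qed
  then show ?thesis using t(1) by blast
qed

section \<open>Treewidth\<close>

lemma connected_in_mono:
  assumes "connected_in N S" "N \<subseteq> N'" shows "connected_in N' S"
proof -
  have "{(u, v). u \<in> S \<and> v \<in> S \<and> {u, v} \<in> N}\<^sup>* \<subseteq> {(u, v). u \<in> S \<and> v \<in> S \<and> {u, v} \<in> N'}\<^sup>*"
    by (rule rtrancl_mono) (use assms(2) in auto)
  then show ?thesis using assms(1) unfolding connected_in_def by blast
qed

lemma connected_in_insert:
  assumes "connected_in N S" "p \<in> S" "{t, p} \<in> N" shows "connected_in N (insert t S)"
proof -
  let ?R = "\<lambda>S. {(u, v). u \<in> S \<and> v \<in> S \<and> {u, v} \<in> N}"
  have "(?R S)\<^sup>* \<subseteq> (?R (insert t S))\<^sup>*" by (rule rtrancl_mono) auto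
  then have S: "(a, b) \<in> (?R (insert t S))\<^sup>*" if "a \<in> S" "b \<in> S" for a b
    using assms(1) that unfolding connected_in_def by blast
  have "(t, p) \<in> ?R (insert t S)" "(p, t) \<in> ?R (insert t S)"
    using assms(2,3) by (auto simp: insert_commute)
  then have t: "(t, p) \<in> (?R (insert t S))\<^sup>*" "(p, t) \<in> (?R (insert t S))\<^sup>*" by blast+
  have to_p: "(a, p) \<in> (?R (insert t S))\<^sup>*" if "a \<in> insert t S" for a
    using that t S[OF _ assms(2)] by blast
  have from_p: "(p, a) \<in> (?R (insert t S))\<^sup>*" if "a \<in> insert t S" for a
    using that t S[OF assms(2)] by blast
  show ?thesis unfolding connected_in_def
  proof (intro ballI)
    fix a b assume "a \<in> insert t S" "b \<in> insert t S"
    from to_p[OF this(1)] from_p[OF this(2)] show "(a, b) \<in> (?R (insert t S))\<^sup>*"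
      by (rule rtrancl_trans)
  qed
qed

text \<open>Length at least 3 keeps the two neighbours of a vertex on a cycle apart, so a leaf
  cannot lie on a cycle.\<close>

lemma is_cycle_pred:
  assumes "is_cycle N c" "i < length c"
  obtains j where "j < length c" "Suc j mod length c = i" "c ! j \<noteq> c ! (Suc i mod length c)"
    "{c ! j, c ! i} \<in> N"
proof -
  have n: "length c \<ge> 3" and d: "distinct c"
    and e: "\<And>i. i < length c \<Longrightarrow> {c ! i, c ! (Suc i mod length c)} \<in> N"
    using assms(1) by (auto simp: is_cycle_def)
  define j where "j = (if i = 0 then length c - 1 else i - 1)"
  have j: "j < length c" "Suc j mod length c = i" using n assms(2) by (auto simp: j_def)
  have "j \<noteq> Suc i mod length c"
    using n assms(2) by (cases "Suc i = length c") (auto simp: j_def split: if_splits)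
  moreover have "Suc i mod length c < length c" using n by (intro mod_less_divisor) linarith
  ultimately have "c ! j \<noteq> c ! (Suc i mod length c)"
    using nth_eq_iff_index_eq[OF d j(1)] by blast
  then show ?thesis using that j e[OF j(1)] by simp
qed

lemma is_tree_add_leaf:
  assumes T: "is_tree T N" and p: "p \<in> T" and t: "t \<notin> T"
  shows "is_tree (insert t T) (insert {t, p} N)"
proof -
  have NT: "\<And>e. e \<in> N \<Longrightarrow> e \<subseteq> T \<and> card e = 2" and fin: "finite T"
    and conn: "connected_in N T" and acyc: "\<And>c. \<not> is_cycle N c"
    using T by (auto simp: is_tree_def)
  \<comment> \<open>The new node has \<open>p\<close> as its only neighbour, while a cycle through
    it would need two.\<close>
  have nbr: "q = p" if "{t, q} \<in> insert {t, p} N" for q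
    using that NT[of "{t, q}"] t by (auto simp: doubleton_eq_iff)
  have "\<not> is_cycle (insert {t, p} N) c" for c
  proof
    assume c: "is_cycle (insert {t, p} N) c"
    then have n: "length c \<ge> 3" and d: "distinct c"
      and e: "\<And>i. i < length c \<Longrightarrow> {c ! i, c ! (Suc i mod length c)} \<in> insert {t, p} N"
      by (auto simp: is_cycle_def)
    show False
    proof (cases "t \<in> set c")
      case True
      then obtain i where i: "i < length c" "c ! i = t" by (auto simp: in_set_conv_nth)
      obtain j where j: "c ! j \<noteq> c ! (Suc i mod length c)" "{c ! j, c ! i} \<in> insert {t, p} N"
        using is_cycle_pred[OF c i(1)] by blast
      have "c ! (Suc i mod length c) = p" using nbr e[OF i(1)] i(2) by simp
      moreover have "c ! j = p" using nbr[of "c ! j"] j(2) i(2) by (simp add: insert_commute)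
      ultimately show False using j(1) by simp
    next
      case False
      have "{c ! i, c ! (Suc i mod length c)} \<in> N" if i: "i < length c" for i
      proof -
        have mem: "c ! i \<in> set c" "c ! (Suc i mod length c) \<in> set c"
          using i n by (auto intro!: nth_mem mod_less_divisor)
        have "t \<noteq> c ! i" "t \<noteq> c ! (Suc i mod length c)" by (rule notI, use mem False in simp)+
        then have "{c ! i, c ! (Suc i mod length c)} \<noteq> {t, p}" by blast
        then show ?thesis using e[OF i] by blast
      qed
      then have "is_cycle N c" using n d by (simp add: is_cycle_def)
      then show False using acyc by blast
    qed
  qed
  moreover have "connected_in (insert {t, p} N) (insert t T)"
    by (rule connected_in_insert[OF connected_in_mono[OF conn] p]) auto
  moreover have "e \<subseteq> insert t T \<and> card e = 2" if "e \<in> insert {t, p} N" for e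
  proof (cases "e = {t, p}")
    case True
    moreover have "t \<noteq> p" using p t by blast
    ultimately show ?thesis using p by simp
  next
    case False
    then show ?thesis using NT[of e] that by blast
  qed
  ultimately show ?thesis using fin unfolding is_tree_def by blast
qed

lemma is_tree_singleton: "is_tree {t} {}"
proof -
  have "\<not> is_cycle {} c" for c :: "'a list"
  proof
    assume "is_cycle {} c"
    then have "length c \<ge> 3" "\<forall>i<length c. False" by (simp_all add: is_cycle_def)
    then show False by (metis less_le_trans zero_less_numeral)
  qed
  then show ?thesis by (simp add: is_tree_def connected_in_def)
qed

text \<open>The tree grows along with the bags: a new bag becomes a leaf next to a node
  \<open>p\<close> that carries the parent bag. Vertices of \<open>S\<close> already occur at
  \<open>p\<close>, so their sets of nodes stay connected.\<close>

lemma tree_decomposition_of_kext: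
  assumes "kext k {} {{}} V B"
  shows "\<exists>(T :: nat set) N \<beta>. is_tree T N \<and> \<beta> ` T = B \<and> (\<Union>t\<in>T. \<beta> t) = V \<and>
    (\<forall>v\<in>V. connected_in N {t \<in> T. v \<in> \<beta> t}) \<and> (\<forall>t\<in>T. card (\<beta> t) \<le> k)"
  using assms
proof (induction rule: kext.induct)
  case kext_refl
  show ?case
    by (rule exI[of _ "{0}"], rule exI[of _ "{}"], rule exI[of _ "\<lambda>_. {}"]) (simp add: is_tree_singleton)
next
  case (kext_step V B b S v)
  obtain T :: "nat set" and N \<beta> where T: "is_tree T N" "\<beta> ` T = B" "(\<Union>t\<in>T. \<beta> t) = V"
    "\<And>v. v \<in> V \<Longrightarrow> connected_in N {t \<in> T. v \<in> \<beta> t}" "\<And>t. t \<in> T \<Longrightarrow> card (\<beta> t) \<le> k"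
    using kext_step.IH by blast
  obtain p where p: "p \<in> T" "\<beta> p = b" using T(2) kext_step.hyps(2) by blast
  have "finite T" using T(1) by (simp add: is_tree_def)
  then obtain t where t: "t \<notin> T" using ex_new_if_finite[OF infinite_UNIV_nat] by blast
  define \<gamma> where "\<gamma> s = (if s = t then insert v S else \<beta> s)" for s
  have \<gamma>: "\<gamma> t = insert v S" "\<And>s. s \<in> T \<Longrightarrow> \<gamma> s = \<beta> s" using t by (auto simp: \<gamma>_def)
  let ?T = "insert t T" and ?N = "insert {t, p} N"
  have im: "\<gamma> ` T = \<beta> ` T" by (rule image_cong) (use \<gamma> in auto)
  have SV: "S \<subseteq> V" using kext_step.hyps(3) p T(3) by blast
  have 1: "is_tree ?T ?N" by (rule is_tree_add_leaf[OF T(1) p(1) t])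
  have 2: "\<gamma> ` ?T = insert (insert v S) B" using im T(2) \<gamma>(1) by simp
  have 3: "(\<Union>s\<in>?T. \<gamma> s) = insert v V" using im T(3) \<gamma>(1) SV by auto
  have 4: "connected_in ?N {s \<in> ?T. w \<in> \<gamma> s}" if w: "w \<in> insert v V" for w
  proof (cases "w = v")
    case True
    then have "{s \<in> ?T. w \<in> \<gamma> s} = {t}" using T(3) \<gamma> kext_step.hyps(4) by auto
    then show ?thesis by (simp add: connected_in_def)
  next
    case False
    have old: "connected_in ?N {s \<in> T. w \<in> \<beta> s}"
      using w False by (intro connected_in_mono[OF T(4)]) auto
    show ?thesis
    proof (cases "w \<in> S")
      case True
      then have "{s \<in> ?T. w \<in> \<gamma> s} = insert t {s \<in> T. w \<in> \<beta> s}" using \<gamma> by auto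
      moreover have "p \<in> {s \<in> T. w \<in> \<beta> s}" using True kext_step.hyps(3) p by auto
      ultimately show ?thesis using connected_in_insert[OF old] by simp
    next
      case notS: False
      have "{s \<in> ?T. w \<in> \<gamma> s} = {s \<in> T. w \<in> \<beta> s}" using \<gamma> notS False by auto
      then show ?thesis using old by simp
    qed
  qed
  have "card (insert v S) \<le> Suc (card S)" by (cases "finite S") (simp_all add: card_insert_if)
  then have 5: "card (\<gamma> s) \<le> k" if "s \<in> ?T" for s
    using that T(5) \<gamma> kext_step.hyps(5) by auto
  show ?case using 1 2 3 4 5 by blast
qed

text \<open>A leaf is entered and left through its only neighbour, so a walk visiting
  \<open>t\<close> can wait at \<open>p\<close> in the meantime.\<close>

lemma connected_in_remove_leaf:
  assumes conn: "connected_in N S" and leaf: "\<And>q. {t, q} \<in> N \<Longrightarrow> q = p" and "p \<noteq> t"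
  shows "connected_in {e \<in> N. t \<notin> e} (S - {t})"
  unfolding connected_in_def
proof (intro ballI)
  fix a b assume ab: "a \<in> S - {t}" "b \<in> S - {t}"
  let ?R' = "{(u, v). u \<in> S - {t} \<and> v \<in> S - {t} \<and> {u, v} \<in> {e \<in> N. t \<notin> e}}"
  have "(a, b) \<in> {(u, v). u \<in> S \<and> v \<in> S \<and> {u, v} \<in> N}\<^sup>*"
    using conn ab unfolding connected_in_def by blast
  \<comment> \<open>The second implication covers walks that are at \<open>t\<close> at the moment:
    their replacement is at \<open>p\<close>.\<close>
  then have "(b \<noteq> t \<longrightarrow> (a, b) \<in> ?R'\<^sup>*) \<and> (b = t \<longrightarrow> (a, p) \<in> ?R'\<^sup>*)"
  proof (induction rule: rtrancl_induct)
    case base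
    then show ?case using ab by auto
  next
    case (step x y)
    then have xy: "x \<in> S" "y \<in> S" "{x, y} \<in> N" by auto
    show ?case
    proof (cases "x = t")
      case True
      then have "y = p" using leaf xy by auto
      then show ?thesis using step.IH True assms(3) by auto
    next
      case x: False
      then have IH: "(a, x) \<in> ?R'\<^sup>*" using step.IH by blast
      show ?thesis
      proof (cases "y = t")
        case True
        then have "x = p" using leaf[of x] xy by (simp add: insert_commute)
        then show ?thesis using IH True by auto
      next
        case False
        then have "(x, y) \<in> ?R'" using xy x by auto
        with IH have "(a, y) \<in> ?R'\<^sup>*" by (rule rtrancl_into_rtrancl)
        then show ?thesis using False by blast
      qed
    qed
  qed
  then show "(a, b) \<in> ?R'\<^sup>*" using ab by blast
qed

text \<open>An end point of a longest path is a leaf.\<close>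

lemma is_tree_leaf:
  assumes T: "is_tree T N" and "a \<in> T" "b \<in> T" "a \<noteq> b"
  obtains t p where "t \<in> T" "p \<in> T" "p \<noteq> t" "{t, p} \<in> N" "\<And>q. {t, q} \<in> N \<Longrightarrow> q = p"
proof -
  have NT: "\<And>e. e \<in> N \<Longrightarrow> e \<subseteq> T \<and> card e = 2" and fin: "finite T"
    and conn: "connected_in N T" and acyc: "\<And>c. \<not> is_cycle N c"
    using T by (auto simp: is_tree_def)
  define path where "path xs \<longleftrightarrow> set xs \<subseteq> T \<and> distinct xs \<and> length xs \<ge> 2 \<and>
    (\<forall>i. Suc i < length xs \<longrightarrow> {xs ! i, xs ! Suc i} \<in> N)" for xs
  have "(a, b) \<in> {(u, v). u \<in> T \<and> v \<in> T \<and> {u, v} \<in> N}\<^sup>*"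
    using conn assms(2,3) unfolding connected_in_def by blast
  then obtain c where c: "c \<in> T" "{a, c} \<in> N" using assms(4) by (auto elim: converse_rtranclE)
  have "a \<noteq> c" using NT[OF c(2)] by auto
  then have "path [a, c]" using c assms(2) by (auto simp: path_def)
  moreover have "length xs \<le> card T" if "path xs" for xs
  proof -
    have "length xs = card (set xs)" using that by (simp add: path_def distinct_card)
    also have "\<dots> \<le> card T" using that fin by (intro card_mono) (auto simp: path_def)
    finally show ?thesis .
  qed
  then have "\<forall>xs. path xs \<longrightarrow> length xs < Suc (card T)" by (simp add: le_imp_less_Suc)
  ultimately obtain xs where xs: "path xs" "\<And>ys. path ys \<Longrightarrow> length ys \<le> length xs"
    using ex_has_greatest_nat[of path "[a, c]" length "Suc (card T)"] by blast
  have len: "2 \<le> length xs" and d: "distinct xs" and sT: "set xs \<subseteq> T"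
    and e: "\<And>i. Suc i < length xs \<Longrightarrow> {xs ! i, xs ! Suc i} \<in> N"
    using xs(1) by (auto simp: path_def)
  have mem: "xs ! i \<in> T" if "i < length xs" for i using sT nth_mem[OF that] by blast
  have e0: "{xs ! 0, xs ! 1} \<in> N" using e[of 0] len by simp
  show ?thesis
  proof (rule that[of "xs ! 0" "xs ! 1"])
    show "xs ! 0 \<in> T" by (rule mem) (use len in linarith)
    show "xs ! 1 \<in> T" by (rule mem) (use len in linarith)
    show "xs ! 1 \<noteq> xs ! 0" using NT[OF e0] by auto
    show "{xs ! 0, xs ! 1} \<in> N" by (rule e0)
    fix q assume q: "{xs ! 0, q} \<in> N"
    have qT: "q \<in> T" and q0: "q \<noteq> xs ! 0" using NT[OF q] by auto
    have "q \<in> set xs"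
    proof (rule ccontr)
      assume "q \<notin> set xs"
      moreover have "{(q # xs) ! i, (q # xs) ! Suc i} \<in> N" if "Suc i < length (q # xs)" for i
        using that e q by (cases i) (auto simp: insert_commute)
      ultimately have "path (q # xs)" using qT sT d len unfolding path_def by auto
      then show False using xs(2)[of "q # xs"] by simp
    qed
    then obtain j where j: "j < length xs" "xs ! j = q" by (auto simp: in_set_conv_nth)
    have "j = 1"
    proof (rule ccontr)
      assume "j \<noteq> 1"
      then have j2: "j \<ge> 2" using j(2) q0 by (cases j) (auto simp: Suc_le_eq)
      \<comment> \<open>The initial segment up to \<open>q\<close>, closed by the edge from
        \<open>q\<close> back to \<open>xs ! 0\<close>, would be a cycle of length
        \<open>Suc j\<close>, which is at least 3.\<close>
      let ?c = "take (Suc j) xs"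
      have l: "length ?c = Suc j" using j(1) by simp
      have "{?c ! i, ?c ! (Suc i mod length ?c)} \<in> N" if i: "i < Suc j" for i
      proof (cases "i = j")
        case True
        then show ?thesis using q j by (simp add: insert_commute)
      next
        case False
        then show ?thesis using i j(1) e[of i] by simp
      qed
      then have "is_cycle N ?c" using l j2 d unfolding is_cycle_def by (auto simp: distinct_take)
      then show False using acyc by blast
    qed
    then show "q = xs ! 1" using j(2) by simp
  qed
qed

text \<open>Remove a leaf \<open>t\<close> with neighbour \<open>p\<close>. By connectedness, a
  vertex of \<open>\<beta> t\<close> that also occurs in another bag lies in
  \<open>\<beta> p\<close>; so the vertices of \<open>\<beta> t - \<beta> p\<close> are new and can
  be attached to a bag containing \<open>\<beta> p\<close>.\<close>

lemma kext_of_tree_decomposition: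
  assumes "is_tree T N" "\<And>v. connected_in N {t \<in> T. v \<in> \<beta> t}"
    "\<And>t. t \<in> T \<Longrightarrow> finite (\<beta> t) \<and> card (\<beta> t) \<le> k"
  shows "\<exists>B. kext k {} {{}} (\<Union>t\<in>T. \<beta> t) B \<and> (\<forall>t\<in>T. \<exists>b\<in>B. \<beta> t \<subseteq> b)"
proof -
  have "finite T" using assms(1) by (simp add: is_tree_def)
  then show ?thesis using assms
  proof (induction T arbitrary: N rule: finite_psubset_induct)
    case (psubset T)
    note tree = psubset.prems(1) and conn = psubset.prems(2) and bag = psubset.prems(3)
    have "T \<noteq> {}" using tree by (simp add: is_tree_def)
    then obtain a where a: "a \<in> T" by blast
    show ?case
    proof (cases "T = {a}")
      case True
      have "\<exists>B. kext k {} {{}} ({} \<union> \<beta> a) B \<and> (\<exists>b\<in>B. {} \<union> \<beta> a \<subseteq> b)"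
        using bag[OF a] by (intro kext_add_vertices[where b = "{}"]) auto
      then show ?thesis using True by auto
    next
      case False
      then obtain b where "b \<in> T" "a \<noteq> b" using a by blast
      then obtain t p where tp: "t \<in> T" "p \<in> T" "p \<noteq> t" "{t, p} \<in> N" "\<And>q. {t, q} \<in> N \<Longrightarrow> q = p"
        using is_tree_leaf[OF tree a] by metis
      let ?T = "T - {t}" and ?N = "{e \<in> N. t \<notin> e}"
      have tree': "is_tree ?T ?N"
      proof -
        have "is_cycle N c" if "is_cycle ?N c" for c using that by (auto simp: is_cycle_def)
        then show ?thesis
          using tree connected_in_remove_leaf[of N T t p, OF _ tp(5,3)] tp(2,3)
          unfolding is_tree_def by auto
      qed
      have conn': "connected_in ?N {s \<in> ?T. v \<in> \<beta> s}" for v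
      proof -
        have "{s \<in> ?T. v \<in> \<beta> s} = {s \<in> T. v \<in> \<beta> s} - {t}" by auto
        then show ?thesis using connected_in_remove_leaf[OF conn[of v] tp(5,3)] by simp
      qed
      let ?V = "\<Union>s\<in>?T. \<beta> s"
      obtain B where B: "kext k {} {{}} ?V B" "\<And>s. s \<in> ?T \<Longrightarrow> \<exists>b\<in>B. \<beta> s \<subseteq> b"
        using psubset.IH[of ?T ?N, OF _ tree' conn'] bag tp(1) by blast
      have sep: "v \<in> \<beta> p" if v: "v \<in> \<beta> t" "v \<in> ?V" for v
      proof -
        obtain s where s: "s \<in> T" "s \<noteq> t" "v \<in> \<beta> s" using v(2) by blast
        let ?S = "{t \<in> T. v \<in> \<beta> t}"
        \<comment> \<open>A walk from the leaf \<open>t\<close> to \<open>s\<close> inside the nodes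
          that carry \<open>v\<close> has to pass through \<open>p\<close> at its first
          step.\<close>
        have "(t, s) \<in> {(u, w). u \<in> ?S \<and> w \<in> ?S \<and> {u, w} \<in> N}\<^sup>*"
          using conn[of v] s tp(1) v(1) unfolding connected_in_def by blast
        then obtain x where "x \<in> ?S" "{t, x} \<in> N" using s(2) by (auto elim: converse_rtranclE)
        then show ?thesis using tp(5)[of x] by simp
      qed
      obtain b where b: "b \<in> B" "\<beta> p \<subseteq> b" using B(2)[of p] tp(2,3) by blast
      have "(\<beta> t \<inter> \<beta> p) \<union> (\<beta> t - \<beta> p) = \<beta> t" by blast
      then have "\<exists>B'. kext k ?V B (?V \<union> (\<beta> t - \<beta> p)) B' \<and>
          (\<exists>b'\<in>B'. (\<beta> t \<inter> \<beta> p) \<union> (\<beta> t - \<beta> p) \<subseteq> b')"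
        using bag[OF tp(1)] b sep by (intro kext_add_vertices[where b = b]) auto
      then obtain B' b' where B': "kext k ?V B (?V \<union> (\<beta> t - \<beta> p)) B'" "b' \<in> B'" "\<beta> t \<subseteq> b'" by blast
      have "?V \<union> (\<beta> t - \<beta> p) = (\<Union>s\<in>T. \<beta> s)" using tp(1,2,3) by blast
      then have "kext k {} {{}} (\<Union>s\<in>T. \<beta> s) B'" using kext_trans[OF B'(1) B(1)] by simp
      moreover have "\<exists>b\<in>B'. \<beta> s \<subseteq> b" if "s \<in> T" for s
      proof (cases "s = t")
        case True
        then show ?thesis using B'(2,3) by blast
      next
        case False
        then show ?thesis using B(2)[of s] that kext_subset[OF B'(1)] by blast
      qed
      ultimately show ?thesis by blast
    qed
  qed
qed

lemma treewidth_le_iff_kext: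
  assumes k: "k \<ge> 1" and E: "multigraph m E"
  shows "treewidth {..<m} (set_mset E) \<le> k - 1 \<longleftrightarrow>
    (\<exists>B. kext k {} {{}} {..<m} B \<and> (\<forall>e\<in>#E. \<exists>b\<in>B. e \<subseteq> b))"
proof -
  define P where "P w \<longleftrightarrow> (\<exists>(T :: nat set) N \<beta>. tree_decomposition {..<m} (set_mset E) T N \<beta> \<and>
    (\<forall>t\<in>T. card (\<beta> t) \<le> w + 1))" for w
  have tw: "treewidth {..<m} (set_mset E) = (LEAST w. P w)" by (simp add: treewidth_def P_def)
  show ?thesis
  proof
    assume le: "treewidth {..<m} (set_mset E) \<le> k - 1"
    \<comment> \<open>The operator \<open>LEAST\<close> tells something only if some width is
      attained; a single bag with all vertices shows this.\<close>
    have "tree_decomposition {..<m} (set_mset E) {0 :: nat} {} (\<lambda>_. {..<m})"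
      unfolding tree_decomposition_def
    proof (intro conjI is_tree_singleton ballI)
      show "\<exists>t\<in>{0 :: nat}. e \<subseteq> {..<m}" if "e \<in># E" for e
        using E that by (auto simp: multigraph_def pairs_def)
    qed (simp_all add: connected_in_def)
    moreover have "\<forall>t\<in>{0 :: nat}. card {..<m} \<le> m + 1" by simp
    ultimately have "P m" unfolding P_def by blast
    then have "P (treewidth {..<m} (set_mset E))" unfolding tw by (rule LeastI)
    then obtain T :: "nat set" and N \<beta> where T: "tree_decomposition {..<m} (set_mset E) T N \<beta>"
      and c: "\<And>t. t \<in> T \<Longrightarrow> card (\<beta> t) \<le> treewidth {..<m} (set_mset E) + 1"
      unfolding P_def by blast
    have tree: "is_tree T N" and un: "(\<Union>t\<in>T. \<beta> t) = {..<m}"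
      and edges: "\<And>e. e \<in># E \<Longrightarrow> \<exists>t\<in>T. e \<subseteq> \<beta> t"
      and conn: "\<And>v. v < m \<Longrightarrow> connected_in N {t \<in> T. v \<in> \<beta> t}"
      using T by (auto simp: tree_decomposition_def)
    have "connected_in N {t \<in> T. v \<in> \<beta> t}" for v
    proof (cases "v < m")
      case False
      then have "{t \<in> T. v \<in> \<beta> t} = {}" using un by auto
      then show ?thesis unfolding connected_in_def by blast
    qed (rule conn)
    moreover have "finite (\<beta> t) \<and> card (\<beta> t) \<le> k" if "t \<in> T" for t
    proof -
      have "\<beta> t \<subseteq> {..<m}" using un that by blast
      then show ?thesis using c[OF that] le k finite_subset by auto
    qed
    ultimately have "\<exists>B. kext k {} {{}} (\<Union>t\<in>T. \<beta> t) B \<and> (\<forall>t\<in>T. \<exists>b\<in>B. \<beta> t \<subseteq> b)"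
      by (rule kext_of_tree_decomposition[OF tree])
    then obtain B where B: "kext k {} {{}} {..<m} B" "\<And>t. t \<in> T \<Longrightarrow> \<exists>b\<in>B. \<beta> t \<subseteq> b"
      unfolding un by blast
    have "\<exists>b\<in>B. e \<subseteq> b" if e: "e \<in># E" for e
    proof -
      obtain t where t: "t \<in> T" "e \<subseteq> \<beta> t" using edges[OF e] by blast
      then show ?thesis using B(2)[OF t(1)] by blast
    qed
    then show "\<exists>B. kext k {} {{}} {..<m} B \<and> (\<forall>e\<in>#E. \<exists>b\<in>B. e \<subseteq> b)" using B(1) by blast
  next
    assume "\<exists>B. kext k {} {{}} {..<m} B \<and> (\<forall>e\<in>#E. \<exists>b\<in>B. e \<subseteq> b)"
    then obtain B where B: "kext k {} {{}} {..<m} B" "\<And>e. e \<in># E \<Longrightarrow> \<exists>b\<in>B. e \<subseteq> b" by blast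
    obtain T :: "nat set" and N \<beta> where T: "is_tree T N" "\<beta> ` T = B" "(\<Union>t\<in>T. \<beta> t) = {..<m}"
      "\<And>v. v \<in> {..<m} \<Longrightarrow> connected_in N {t \<in> T. v \<in> \<beta> t}" "\<And>t. t \<in> T \<Longrightarrow> card (\<beta> t) \<le> k"
      using tree_decomposition_of_kext[OF B(1)] by blast
    have "tree_decomposition {..<m} (set_mset E) T N \<beta>"
      unfolding tree_decomposition_def using T(1,3,4) B(2) T(2) by blast
    \<comment> \<open>The bags have at most \<open>k\<close> vertices, and
      \<open>k = (k - 1) + 1\<close> because \<open>k \<ge> 1\<close>.\<close>
    then have "P (k - 1)" unfolding P_def using T(5) k by auto
    then show "treewidth {..<m} (set_mset E) \<le> k - 1" unfolding tw by (rule Least_le)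
  qed
qed

text \<open>Vertices that lie on no edge still contribute the factor \<open>f (x v) ^ d v\<close>,
  which needs a bag to be assigned to.\<close>

lemma kext_cover:
  assumes "kext k {} {{}} V B" "v \<in> V" shows "\<exists>b\<in>B. v \<in> b"
  using assms by (induction rule: kext.induct) auto

section \<open>The characterization\<close>

lemma bounded_signal_clip:
  assumes "r > 0" "graphon_signal r W f" shows "bounded_signal r W (\<lambda>x. clip r (f x))"
proof -
  have [measurable]: "f \<in> borel_measurable unit_lebesgue" using assms(2) by (simp add: graphon_signal_def)
  have "(\<lambda>x. clip r (f x)) \<in> borel_measurable unit_lebesgue" unfolding clip_def by measurable
  then show ?thesis using assms clip_bound by (simp add: bounded_signal_def graphon_signal_def)
qed

text \<open>Almost every point of the cube has all of its finitely many coordinates outside the null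
  set where \<open>\<bar>f x\<bar>\<close> exceeds \<open>r\<close>.\<close>

lemma hom_density_clip:
  assumes r: "r > 0" and S: "graphon_signal r W f" and E: "multigraph m E"
  shows "hom_density m E d W (\<lambda>x. clip r (f x)) = hom_density m E d W f"
  unfolding hom_density_gval
proof (rule integral_cong_AE)
  show "gval m E d W (\<lambda>x. clip r (f x)) \<in> borel_measurable (cube {..<m})"
    using bounded_signal_clip[OF r S] by (intro gval_measurable E) (auto simp: bounded_signal_def)
  show "gval m E d W f \<in> borel_measurable (cube {..<m})"
    using S by (intro gval_measurable E) (auto simp: graphon_signal_def)
  have "AE x in unit_lebesgue. \<bar>f x\<bar> \<le> r" using S by (simp add: graphon_signal_def)
  then have "AE x in cube {..<m}. \<bar>f (x i)\<bar> \<le> r" if "i \<in> {..<m}" for i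
    using that by (intro AE_PiM_component prob_space_unit_lebesgue)
  then have "AE x in cube {..<m}. \<forall>i\<in>{..<m}. \<bar>f (x i)\<bar> \<le> r" by (intro AE_finite_allI) auto
  then show "AE x in cube {..<m}. gval m E d W (\<lambda>x. clip r (f x)) x = gval m E d W f x"
  proof (rule AE_mp, intro AE_I2 impI)
    fix x assume "\<forall>i\<in>{..<m}. \<bar>f (x i)\<bar> \<le> r"
    then have "(\<Prod>i<m. clip r (f (x i)) ^ d i) = (\<Prod>i<m. f (x i) ^ d i)"
      by (intro prod.cong) (auto simp: clip_id)
    then show "gval m E d W (\<lambda>x. clip r (f x)) x = gval m E d W f x" by (simp add: gval_def)
  qed
qed

text \<open>The translations between terms and graphs are uniform in the graphon-signal, so an
  equality for one side's object transfers to its translation.\<close>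

lemma terms_eq_iff_hom_densities_eq:
  assumes k: "k \<ge> 1" and r: "r > 0" and W: "bounded_signal r W f" and V: "bounded_signal r V g"
  shows "(\<forall>t. wf_tm k t \<longrightarrow> (\<integral>x. sem t W f x \<partial>cube {..<k}) = (\<integral>x. sem t V g x \<partial>cube {..<k})) \<longleftrightarrow>
    (\<forall>m E d. multigraph m E \<and> treewidth {..<m} (set_mset E) \<le> k - 1 \<longrightarrow>
       hom_density m E d W f = hom_density m E d V g)"
proof (intro iffI allI impI)
  fix m E d
  assume eq: "\<forall>t. wf_tm k t \<longrightarrow> (\<integral>x. sem t W f x \<partial>cube {..<k}) = (\<integral>x. sem t V g x \<partial>cube {..<k})"
    and "multigraph m E \<and> treewidth {..<m} (set_mset E) \<le> k - 1"
  then have E: "multigraph m E" and "treewidth {..<m} (set_mset E) \<le> k - 1" by auto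
  then obtain B where B: "kext k {} {{}} {..<m} B" "\<And>e. e \<in># E \<Longrightarrow> \<exists>b\<in>B. e \<subseteq> b"
    using treewidth_le_iff_kext[OF k E] by blast
  have "\<exists>b\<in>B. v \<in> b" if "v < m" for v using kext_cover[OF B(1)] that by simp
  from graph_to_term[OF B(1) E B(2) this, of d] obtain t where t: "wf_tm k t"
    "\<And>r W f. r > 0 \<Longrightarrow> bounded_signal r W f \<Longrightarrow>
      hom_density m E d W f = (\<integral>x. sem t W f x \<partial>cube {..<k})" by blast
  show "hom_density m E d W f = hom_density m E d V g"
    unfolding t(2)[OF r W] t(2)[OF r V] using eq t(1) by blast
next
  fix t
  assume eq: "\<forall>m E d. multigraph m E \<and> treewidth {..<m} (set_mset E) \<le> k - 1 \<longrightarrow>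
       hom_density m E d W f = hom_density m E d V g"
    and t: "wf_tm k t"
  obtain m E d B where E: "multigraph m E" "kext k {} {{}} {..<m} B" "\<And>e. e \<in># E \<Longrightarrow> \<exists>b\<in>B. e \<subseteq> b"
    and sem: "\<And>r W f. bounded_signal r W f \<Longrightarrow> r > 0 \<Longrightarrow>
      (\<integral>x. sem t W f x \<partial>cube {..<k}) = hom_density m E d W f"
    by (rule term_to_graph[OF t], rule that)
  have "treewidth {..<m} (set_mset E) \<le> k - 1"
    using treewidth_le_iff_kext[OF k E(1)] E(2,3) by blast
  then show "(\<integral>x. sem t W f x \<partial>cube {..<k}) = (\<integral>x. sem t V g x \<partial>cube {..<k})"
    unfolding sem[OF W r] sem[OF V r] using eq E(1) by blast
qed

theorem theoremD10:
  fixes k :: nat and r :: real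
    and W V :: "real \<Rightarrow> real \<Rightarrow> real" and f g :: "real \<Rightarrow> real"
  assumes "k \<ge> 1" and "r > 0"
    and "graphon_signal r W f" and "graphon_signal r V g"
  shows "wl_distribution k r W f = wl_distribution k r V g \<longleftrightarrow>
    (\<forall>(m :: nat) (E :: nat set multiset) (d :: nat \<Rightarrow> nat).
       multigraph m E \<and> treewidth {..<m} (set_mset E) \<le> k - 1 \<longrightarrow>
       hom_density m E d W f = hom_density m E d V g)"
proof -
  \<comment> \<open>Neither side of the equivalence changes under clipping, and clipped signals are
    bounded at every point.\<close>
  let ?f = "\<lambda>x. clip r (f x)" and ?g = "\<lambda>x. clip r (g x)"
  note signals = bounded_signal_clip[OF \<open>r > 0\<close> assms(3)] bounded_signal_clip[OF \<open>r > 0\<close> assms(4)]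
  have "wl_distribution k r W f = wl_distribution k r V g \<longleftrightarrow>
      wl_distribution k r W ?f = wl_distribution k r V ?g"
    by (simp only: wl_distribution_clip[OF \<open>r > 0\<close>])
  also have "\<dots> \<longleftrightarrow> (\<forall>t. wf_tm k t \<longrightarrow>
      (\<integral>x. sem t W ?f x \<partial>cube {..<k}) = (\<integral>x. sem t V ?g x \<partial>cube {..<k}))"
    by (rule wl_distribution_eq_iff_terms[OF signals \<open>r > 0\<close>])
  also have "\<dots> \<longleftrightarrow> (\<forall>m E d. multigraph m E \<and> treewidth {..<m} (set_mset E) \<le> k - 1 \<longrightarrow>
      hom_density m E d W ?f = hom_density m E d V ?g)"
    by (rule terms_eq_iff_hom_densities_eq[OF \<open>k \<ge> 1\<close> \<open>r > 0\<close> signals])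
  also have "\<dots> \<longleftrightarrow> (\<forall>m E d. multigraph m E \<and> treewidth {..<m} (set_mset E) \<le> k - 1 \<longrightarrow>
      hom_density m E d W f = hom_density m E d V g)"
    using hom_density_clip[OF \<open>r > 0\<close> assms(3)] hom_density_clip[OF \<open>r > 0\<close> assms(4)] by metis
  finally show ?thesis .
qed

end
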